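(* Let $\psi\in C^1(\mathbb{R})$ have bounded derivative (with $\psi(0)=0$), and let $c$ be a continuous function with $c(1)=1$ such that $(v,v')\mapsto c(v\cdot v')$ is positive definite on $\mathcal{B}$. For a ROSt law $\mathbb{P}$ with sampling measure $\mu$ and $\lambda\ge 0$ let $$\mathcal{P}(\lambda,\mathbb{P})=\mathbb{E}E_l\Big[\log\,(\mu\times E_z)\big(e^{\psi(\lambda l_c(v)+\lambda z\sqrt{1-c(\|v\|^2)})}\big)\Big].$$ Then: 1. $\mathbb{P}\mapsto\mathcal{P}(\lambda,\mathbb{P})$ is a continuous functional on the space of ROSt's for every $\lambda\ge0$. 2. In the cases $\psi(x)=\log\cosh x$ and $\psi(x)=x$, for $\vec\lambda=(\lambda_p)_{p\ge0}\in \ell^2$ with $\lambda^2=\sum_{p\ge0}\lambda_p^2$, let $$\mathcal{P}(\vec\lambda,\mathbb{P})=\frac{\lambda^2}{2}+\mathbb{E}E_l\Big[\log\mu\Big(e^{\psi(\sum_{p\ge0}\lambda_p l_p(v))-\frac12\sum_{p\ge0}\lambda_p^2\|v\|^{2p}}\Big)\Big].$$ Then for any $\delta>0$ and any given $\vec\lambda'=(\lambda'_p)_{p\ge0}\in\ell^2$, there is a constant $K>0$, depending only on $\vec\lambda'$ and $\delta$, such that if $\|\vec\lambda-\vec\lambda'\|_2<\delta$ then $$\max_{\mathbb{P}\text{ ROSt}}\big|\mathcal{P}(\vec\lambda,\mathbb{P})-\mathcal{P}(\vec\lambda',\mathbb{P})\big|\le K\|\vec\lambda-\vec\lambda'\|_2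 .$$
   Context: Let $\mathbb{N}=\{1,2,\dots\}$. A Random Overlap Structure (ROSt) is a random symmetric positive semidefinite $\mathbb{N}\times\mathbb{N}$ matrix $Q=\{q_{ij}\}$ with $1$'s on the diagonal which is weakly exchangeable: $\tau Q\tau^{-1}$ has the same law as $Q$ for every permutation matrix $\tau$ that fixes all but finitely many elements. The space of ROSt's is the set of laws $\mathbb{P}$ of ROSt's with the weak-$*$ topology (as Borel probability measures on the compact set of such matrices in $[-1,1]^{\mathbb{N}\times\mathbb{N}}$ with the product topology); it is compact. $\mathbb{E}$ denotes expectation under $\mathbb{P}$. $\mathcal{H}$ is a fixed infinite-dimensional separable real Hilbert space with inner product $\cdot$ and norm $\|\cdot\|$, $\mathcal{B}$ is its closed unit ball, and $\mathcal{M}(\mathcal{B})$ is the set of Borel probability measures on $\mathcal{B}$. By the Dovbysh–Sudakov theorem, for every ROSt $Q$ there is a random element $\mu$ of $\mathcal{M}(\mathcal{B})$, called a sampling measure of $Q$, such that conditionally on $\mu$, $(q_{ij})_{i\neq j}$ has the law of $(v^i\cdot v^j)_{i\ne j}$ with $v^1,v^2,\dots$ i.i.d. of law $\mu$; it is determined by the law of $Q$ up to isometry of $\mathcal{B}$. $\mu(f)$ denotes $\int f\,d\mu$. $l_c=(l_c(v),v\in\mathcal{B})$ is a centered Gaussian process (jointly measurable version), independent of $\mathbb{P}$, with expectation $E_l$ and covariance $E_l[l_c(v)l_c(v')]=c(v\cdot v')$. For $p\in\mathbb{N}\cup\{0\}$, $l_p$ is the field with covariance $(v\cdot v')^p$ (convention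 $0^0=1$), and in $\mathcal{P}(\vec\lambda,\mathbb{P})$ the fields $l_p$, $p\ge0$, are independent, with joint expectation $E_l$. $z$ is an independent standard Gaussian with expectation $E_z$, and $(\mu\times E_z)$ denotes integration over $v\sim\mu$ and $z$. $\|\cdot\|_2$ is the $\ell^2$ norm. The functional $\mathcal{P}(\vec\lambda,\mathbb{P})$ is $\mathcal{P}(\lambda,\mathbb{P})$ with $c(x)=\lambda^{-2}\sum_{p\ge0}\lambda_p^2x^p$, after integrating out $z$. *)

theory Defs
  imports "HOL-Probability.Probability"
begin

section \<open>Random overlap structures\<close>

text \<open>
  Replicas are indexed by \<^typ>\<open>nat\<close> starting at \<open>0\<close>. A matrix is a function on pairs of indices, so
  that its type carries the product topology and the corresponding Borel sigma-algebra.
\<close>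

type_synonym overlap = "nat \<times> nat \<Rightarrow> real"

definition overlap_matrices :: "overlap set" where
  "overlap_matrices =
     {q. (\<forall>i j. q (i, j) = q (j, i)) \<and> (\<forall>i. q (i, i) = 1) \<and>
         (\<forall>n (x :: nat \<Rightarrow> real). (\<Sum>i<n. \<Sum>j<n. x i * x j * q (i, j)) \<ge> 0)}"

definition overlap_space :: "overlap measure" where
  "overlap_space = restrict_space borel overlap_matrices"

text \<open>
  Weak exchangeability quantifies over all finitely supported \<open>\<tau>\<close>, so it does not matter that the
  entry \<open>(i, j)\<close> of the conjugated matrix is written with \<open>\<tau>\<close> in place of its inverse.
\<close>

definition rost_law :: "overlap measure \<Rightarrow> bool" where
  "rost_law P \<longleftrightarrow> prob_space P \<and> sets P = sets overlap_space \<and>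
     (\<forall>\<tau> :: nat \<Rightarrow> nat. bij \<tau> \<and> finite {i. \<tau> i \<noteq> i} \<longrightarrow>
        distr P overlap_space (\<lambda>q (i, j). q (\<tau> i, \<tau> j)) = P)"

text \<open>
  The weak-* topology: the coarsest topology on laws for which the integral of every continuous
  function on the set of overlap matrices is a continuous function of the law.
\<close>

definition rost_topology :: "overlap measure topology" where
  "rost_topology =
     (let C = {f :: overlap \<Rightarrow> real. continuous_on overlap_matrices f} in
      pullback_topology {P. rost_law P} (\<lambda>P. \<lambda>f\<in>C. \<integral>q. f q \<partial>P)
        (product_topology (\<lambda>_. euclideanreal) C))"


section \<open>Sampling measures\<close>

text \<open>
  The sigma-algebra of \<^const>\<open>prob_algebra\<close> is generated by the evaluations \<open>\<mu> \<mapsto> \<mu> A\<close>; since the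
  ball is separable and complete, it is the Borel sigma-algebra of the weak topology.
\<close>

definition ball_space :: "'h::{real_inner, polish_space} measure" where
  "ball_space = restrict_space borel (cball 0 1)"

definition off_diag :: "(nat \<times> nat) set" where
  "off_diag = {(i, j). i \<noteq> j}"

definition off_diag_space :: "overlap measure" where
  "off_diag_space = PiM off_diag (\<lambda>_. borel)"

definition replica_law :: "'h::{real_inner, polish_space} measure \<Rightarrow> overlap measure" where
  "replica_law \<mu> = distr (PiM (UNIV :: nat set) (\<lambda>_. \<mu>)) off_diag_space
     (\<lambda>v. \<lambda>(i, j)\<in>off_diag. v i \<bullet> v j)"

text \<open>
  A sampling measure \<open>\<mu>\<close> of \<open>Q\<close> is a random variable on the probability space of \<open>Q\<close>, possibly
  enlarged. Here it is given by the joint law \<open>J\<close> of the pair \<open>(Q, \<mu>)\<close>; the last condition says that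
  \<open>replica_law \<mu>\<close> is the conditional law of the off-diagonal entries of \<open>Q\<close> given \<open>\<mu>\<close>.
\<close>

definition sampling_measure ::
    "overlap measure \<Rightarrow> (overlap \<times> 'h::{real_inner, polish_space} measure) measure \<Rightarrow> bool" where
  "sampling_measure P J \<longleftrightarrow> prob_space J \<and>
     sets J = sets (overlap_space \<Otimes>\<^sub>M prob_algebra ball_space) \<and>
     distr J overlap_space fst = P \<and>
     (\<forall>A\<in>sets (prob_algebra ball_space). \<forall>C\<in>sets off_diag_space.
        emeasure J {(q, \<mu>) \<in> space J. \<mu> \<in> A \<and> restrict q off_diag \<in> C} =
        (\<integral>\<^sup>+(q, \<mu>). indicator A \<mu> * emeasure (replica_law \<mu>) C \<partial>J))"


section \<open>Gaussian fields on the ball\<close>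

definition centered_gaussian :: "'g measure \<Rightarrow> ('g \<Rightarrow> real) \<Rightarrow> bool" where
  "centered_gaussian G X \<longleftrightarrow> X \<in> borel_measurable G \<and>
     ((AE \<omega> in G. X \<omega> = 0) \<or> (\<exists>\<sigma>>0. distributed G lborel X (normal_density 0 \<sigma>)))"

definition gaussian_field ::
    "'g measure \<Rightarrow> (real \<Rightarrow> real) \<Rightarrow> ('h::{real_inner, polish_space} \<Rightarrow> 'g \<Rightarrow> real) \<Rightarrow> bool" where
  "gaussian_field G c l \<longleftrightarrow> prob_space G \<and>
     (\<lambda>(v, \<omega>). l v \<omega>) \<in> borel_measurable (ball_space \<Otimes>\<^sub>M G) \<and>
     (\<forall>F a. finite F \<and> F \<subseteq> cball 0 1 \<longrightarrow> centered_gaussian G (\<lambda>\<omega>. \<Sum>v\<in>F. a v * l v \<omega>)) \<and>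
     (\<forall>v\<in>cball 0 1. \<forall>w\<in>cball 0 1. (\<integral>\<omega>. l v \<omega> * l w \<omega> \<partial>G) = c (v \<bullet> w))"

definition pos_def_on_ball :: "'h::real_inner itself \<Rightarrow> (real \<Rightarrow> real) \<Rightarrow> bool" where
  "pos_def_on_ball _ c \<longleftrightarrow>
     (\<forall>F (a :: 'h \<Rightarrow> real). finite F \<and> F \<subseteq> cball 0 1 \<longrightarrow>
        (\<Sum>v\<in>F. \<Sum>w\<in>F. a v * a w * c (v \<bullet> w)) \<ge> 0)"

text \<open>
  The convention \<open>0 ^ 0 = 1\<close> for the covariance \<open>x ^ p\<close> at \<open>p = 0\<close> is that of the library.
\<close>

definition independent_power_fields ::
    "'g measure \<Rightarrow> (nat \<Rightarrow> 'h::{real_inner, polish_space} \<Rightarrow> 'g \<Rightarrow> real) \<Rightarrow> bool" where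
  "independent_power_fields G l \<longleftrightarrow>
     (\<forall>p. gaussian_field G (\<lambda>x. x ^ p) (l p)) \<and>
     prob_space.indep_vars G (\<lambda>_. PiM (cball 0 1) (\<lambda>_. borel)) (\<lambda>p \<omega>. \<lambda>v\<in>cball 0 1. l p v \<omega>) UNIV"


section \<open>The functionals\<close>

text \<open>
  The functionals take the joint law \<open>J\<close> of the overlap matrix and its sampling measure.
  Independence of the Gaussian field from \<open>J\<close> is built in, as the expectation is the iterated
  integral over \<open>J\<close> and over the probability space \<open>G\<close> of the field.
\<close>

definition P_functional ::
    "(real \<Rightarrow> real) \<Rightarrow> (real \<Rightarrow> real) \<Rightarrow> 'g measure \<Rightarrow> ('h::{real_inner, polish_space} \<Rightarrow> 'g \<Rightarrow> real) \<Rightarrow>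
     real \<Rightarrow> (overlap \<times> 'h measure) measure \<Rightarrow> real" where
  "P_functional \<psi> c G l \<Lambda> J =
     (\<integral>(q, \<mu>). (\<integral>\<omega>.
        ln (\<integral>(v, z). exp (\<psi> (\<Lambda> * l v \<omega> + \<Lambda> * z * sqrt (1 - c ((norm v)\<^sup>2))))
              \<partial>(\<mu> \<Otimes>\<^sub>M density lborel std_normal_density)) \<partial>G) \<partial>J)"

definition ell2 :: "(nat \<Rightarrow> real) set" where
  "ell2 = {\<Lambda>. summable (\<lambda>p. (\<Lambda> p)\<^sup>2)}"

definition ell2_norm :: "(nat \<Rightarrow> real) \<Rightarrow> real" where
  "ell2_norm \<Lambda> = sqrt (\<Sum>p. (\<Lambda> p)\<^sup>2)"

definition P_functional_seq ::
    "(real \<Rightarrow> real) \<Rightarrow> 'g measure \<Rightarrow> (nat \<Rightarrow> 'h::{real_inner, polish_space} \<Rightarrow> 'g \<Rightarrow> real) \<Rightarrow>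
     (nat \<Rightarrow> real) \<Rightarrow> (overlap \<times> 'h measure) measure \<Rightarrow> real" where
  "P_functional_seq \<psi> G l \<Lambda> J =
     (\<Sum>p. (\<Lambda> p)\<^sup>2) / 2 +
     (\<integral>(q, \<mu>). (\<integral>\<omega>.
        ln (\<integral>v. exp (\<psi> (\<Sum>p. \<Lambda> p * l p v \<omega>) - (\<Sum>p. (\<Lambda> p)\<^sup>2 * norm v ^ (2 * p)) / 2) \<partial>\<mu>)
          \<partial>G) \<partial>J)"

end

(*
  Both parts compare ln of a Gibbs integral for two exponents U and V that are dominated by the same
  W. Since 1 / int e^U is at most int e^W, the difference of the logarithms is bounded by eps int e^(2 W) as
  soon as |e^U - e^V| is at most eps e^W, and Gaussian exponential moments bound the expectation of
  int e^(2 W) uniformly in the sampling measure.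

  Continuity: folding the argument of psi into [-R, R] by the triangle wave x -> arcsin (sin x)
  (rescaled) costs O(1/R). After that e^psi is a uniform limit of polynomials in a sine and ln of the
  integral is a uniform limit of polynomials. The expectation of a power of an integral of a
  trigonometric polynomial is an integral over finitely many replicas of Gaussian characteristic
  functions, that is, the expectation under P of a continuous function of the overlaps. The functional
  is therefore a uniform limit of weak-* continuous ones. The extra noise z makes every diagonal
  variance equal to 1, so that only off-diagonal overlaps enter.

  Lipschitz bound: the series in the fields converges almost surely for each v by Kolmogorov's maximal
  inequality, its exponential moments are bounded by those of the partial sums, and the comparison
  above applies with eps = the l^2 distance of the two parameters.
*)

theory Submission
  imports Defs
begin

text \<open>Why a sine: a continuous function of one sine is uniformly close to a trigonometric sum,
  and expectations of characters of a Gaussian field are explicit and bounded at any finite set of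
  points. Cutting the argument of \<open>\<psi>\<close> off at \<open>R\<close> by a constant would
  not give a function of a sine; the triangle wave does, and is the identity where the field is
  moderate. The noise exists only if \<open>c\<close> is at most 1 at squared norms. Positive
  definiteness gives this by a test at two points, and infinite dimension provides the second point.
  Everything must be uniform over sampling measures. This works because the variances have a bound
  independent of the point of the ball: the expectation over the field is taken first, at a fixed
  point, and \<open>\<mu>\<close> then only averages. The same order suits the series, whose
  exceptional null set depends on \<open>v\<close>. For the Lipschitz bound the difference of the
  two series is divided by the distance of the parameters, so that it has coefficients of norm 1 and
  its exponential moments do not depend on the distance.\<close>

section \<open>Logarithms of exponential integrals\<close>

text \<open>Jensen's inequality for \<open>1 / y\<close> at \<open>y = exp (W x)\<close>. The
  tangent at the mean \<open>s\<close> gives \<open>1 / y \<ge> 2 / s - y / s\<^sup>2\<close>, which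
  integrates to \<open>1 / s\<close>; the square in the proof is this tangent bound multiplied
  out.\<close>

lemma (in prob_space) inverse_integral_exp_le:
  assumes [measurable]: "W \<in> borel_measurable M"
    and pos: "\<And>x. x \<in> space M \<Longrightarrow> 0 \<le> W x"
    and int: "integrable M (\<lambda>x. exp (W x :: real))"
  shows "1 / (\<integral>x. exp (W x) \<partial>M) \<le> (\<integral>x. exp (- W x) \<partial>M)"
proof -
  define s where "s = (\<integral>x. exp (W x) \<partial>M)"
  have "1 \<le> s"
    using pos unfolding s_def by (intro integral_ge_const int) auto
  have int': "integrable M (\<lambda>x. exp (- W x))"
    using pos by (intro integrable_const_bound[where B=1]) auto
  have "2 / s - exp (W x) / s\<^sup>2 \<le> exp (- W x)" for x
  proof -
    have "0 \<le> (exp (- W x / 2) - exp (W x / 2) / s)\<^sup>2" by simp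
    also have "\<dots> = exp (- W x) + exp (W x) / s\<^sup>2 - 2 / s"
      by (simp add: power2_eq_square algebra_simps flip: exp_add)
    finally show ?thesis by simp
  qed
  then have "(\<integral>x. 2 / s - exp (W x) / s\<^sup>2 \<partial>M) \<le> (\<integral>x. exp (- W x) \<partial>M)"
    by (intro integral_mono int') (use int in auto)
  moreover have "(\<integral>x. 2 / s - exp (W x) / s\<^sup>2 \<partial>M) = 2 / s - s / s\<^sup>2"
    using int by (simp add: s_def prob_space)
  moreover have "2 / s - s / s\<^sup>2 = 1 / s"
    using \<open>1 \<le> s\<close> by (simp add: power2_eq_square)
  ultimately show ?thesis by (simp add: s_def)
qed

lemma abs_ln_diff_le:
  assumes "0 < (m::real)" "m \<le> a" "m \<le> b"
  shows "\<bar>ln a - ln b\<bar> \<le> \<bar>a - b\<bar> / m"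
proof -
  have *: "ln y - ln x \<le> \<bar>a - b\<bar> / m" if "m \<le> x" "y - x \<le> \<bar>a - b\<bar>" "m \<le> y" for x y :: real
  proof -
    have "ln y - ln x \<le> (y - x) / x" using that assms by (intro ln_diff_le) auto
    also have "\<dots> \<le> \<bar>a - b\<bar> / m" using that assms by (intro frac_le) auto
    finally show ?thesis .
  qed
  show ?thesis using *[of a b] *[of b a] assms by (simp add: abs_le_iff abs_minus_commute)
qed

text \<open>With \<open>s\<close> the integral of \<open>exp W\<close>, both integrals are at least
  \<open>1 / s\<close>, where \<open>ln\<close> has slope at most \<open>s\<close>, and they differ
  by at most \<open>\<epsilon> * s\<close>.\<close>

lemma (in prob_space) ln_integral_exp_diff_le:
  assumes [measurable]: "U \<in> borel_measurable M" "V \<in> borel_measurable M" "W \<in> borel_measurable M"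
    and U: "\<And>x. x \<in> space M \<Longrightarrow> \<bar>U x\<bar> \<le> W x" and V: "\<And>x. x \<in> space M \<Longrightarrow> \<bar>V x\<bar> \<le> W x"
    and UV: "\<And>x. x \<in> space M \<Longrightarrow> \<bar>exp (U x) - exp (V x)\<bar> \<le> \<epsilon> * exp (W x)"
    and int: "integrable M (\<lambda>x. exp (2 * W x :: real))"
  shows "\<bar>ln (\<integral>x. exp (U x) \<partial>M) - ln (\<integral>x. exp (V x) \<partial>M)\<bar> \<le> \<epsilon> * (\<integral>x. exp (2 * W x) \<partial>M)"
proof -
  have W: "0 \<le> W x" if "x \<in> space M" for x using U[OF that] by simp
  have \<epsilon>: "0 \<le> \<epsilon>"
  proof -
    obtain x where "x \<in> space M" using not_empty by auto
    then have "0 \<le> \<epsilon> * exp (W x)" using UV[of x] by linarith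
    then show ?thesis by (simp add: zero_le_mult_iff)
  qed
  have int1: "integrable M (\<lambda>x. exp (W x))"
    by (rule Bochner_Integration.integrable_bound[OF int]) (use W in auto)
  have intU: "integrable M (\<lambda>x. exp (U x))" "integrable M (\<lambda>x. exp (V x))"
    by (rule Bochner_Integration.integrable_bound[OF int1], use U V abs_le_D1 in force, use U V abs_le_D1 in force)+
  have intm: "integrable M (\<lambda>x. exp (- W x))"
    using W by (intro integrable_const_bound[where B=1]) auto
  define s where "s = (\<integral>x. exp (W x) \<partial>M)"
  have "1 \<le> s"
    using W unfolding s_def by (intro integral_ge_const int1) auto
  have lower: "1 / s \<le> (\<integral>x. exp (U x) \<partial>M)" "1 / s \<le> (\<integral>x. exp (V x) \<partial>M)"
    using U V unfolding s_def
    by (intro order_trans[OF inverse_integral_exp_le[OF _ W int1] integral_mono[OF intm]] intU; force)+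
  have "\<bar>ln (\<integral>x. exp (U x) \<partial>M) - ln (\<integral>x. exp (V x) \<partial>M)\<bar> \<le>
      \<bar>(\<integral>x. exp (U x) \<partial>M) - (\<integral>x. exp (V x) \<partial>M)\<bar> / (1 / s)"
    using \<open>1 \<le> s\<close> by (intro abs_ln_diff_le lower) auto
  also have "\<bar>(\<integral>x. exp (U x) \<partial>M) - (\<integral>x. exp (V x) \<partial>M)\<bar> = \<bar>\<integral>x. exp (U x) - exp (V x) \<partial>M\<bar>"
    using intU by simp
  also have "\<dots> \<le> (\<integral>x. \<epsilon> * exp (W x) \<partial>M)"
    using intU UV int1 by (intro order_trans[OF integral_abs_bound integral_mono]) auto
  also have "\<dots> = \<epsilon> * s" by (simp add: s_def)
  finally have 1: "\<bar>ln (\<integral>x. exp (U x) \<partial>M) - ln (\<integral>x. exp (V x) \<partial>M)\<bar> \<le> \<epsilon> * s\<^sup>2"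
    using \<open>1 \<le> s\<close> by (simp add: divide_right_mono power2_eq_square)
  \<comment> \<open>The variance of \<open>exp W\<close> is nonnegative. This replaces
    \<open>s\<^sup>2\<close> by an integral that is linear in the measure and can be exchanged with
    the expectation over the field.\<close>
  have "0 \<le> (\<integral>x. (exp (W x) - s)\<^sup>2 \<partial>M)" by simp
  also have "(\<lambda>x. (exp (W x) - s)\<^sup>2) = (\<lambda>x. exp (2 * W x) - 2 * s * exp (W x) + s\<^sup>2)"
    by (auto simp: power2_eq_square algebra_simps simp flip: exp_add)
  also have "(\<integral>x. \<dots> x \<partial>M) = (\<integral>x. exp (2 * W x) \<partial>M) - 2 * s * s + s\<^sup>2"
    using int int1 by (simp add: s_def prob_space)
  finally have "s\<^sup>2 \<le> (\<integral>x. exp (2 * W x) \<partial>M)" by (simp add: power2_eq_square)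
  with 1 \<epsilon> show ?thesis by (meson mult_left_mono order_trans)
qed

text \<open>\<open>K\<close> bounds the moment with the integral over \<open>G\<close> inside,
  because Gaussian moments are computed at a fixed point \<open>x\<close>; Fubini reverses the
  order. The measure \<open>N\<close> enters the bounds only through \<open>K\<close>, so they are
  uniform over sampling measures.\<close>

lemma expectation_ln_integral_exp:
  fixes U V W :: "'a \<Rightarrow> 'b \<Rightarrow> real"
  assumes "prob_space N" "prob_space G"
    and [measurable]: "case_prod U \<in> borel_measurable (N \<Otimes>\<^sub>M G)" "case_prod V \<in> borel_measurable (N \<Otimes>\<^sub>M G)"
      "case_prod W \<in> borel_measurable (N \<Otimes>\<^sub>M G)"
    and U: "\<And>x \<omega>. x \<in> space N \<Longrightarrow> \<omega> \<in> space G \<Longrightarrow> \<bar>U x \<omega>\<bar> \<le> W x \<omega>"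
    and V: "\<And>x \<omega>. x \<in> space N \<Longrightarrow> \<omega> \<in> space G \<Longrightarrow> \<bar>V x \<omega>\<bar> \<le> W x \<omega>"
    and UV: "\<And>x \<omega>. x \<in> space N \<Longrightarrow> \<omega> \<in> space G \<Longrightarrow> \<bar>exp (U x \<omega>) - exp (V x \<omega>)\<bar> \<le> \<epsilon> * exp (W x \<omega>)"
    and K: "(\<integral>\<^sup>+x. \<integral>\<^sup>+\<omega>. ennreal (exp (2 * W x \<omega>)) \<partial>G \<partial>N) \<le> ennreal K" "0 \<le> K"
  shows "integrable G (\<lambda>\<omega>. ln (\<integral>x. exp (U x \<omega>) \<partial>N))"
    and "\<bar>\<integral>\<omega>. ln (\<integral>x. exp (U x \<omega>) \<partial>N) \<partial>G\<bar> \<le> K"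
    and "\<bar>(\<integral>\<omega>. ln (\<integral>x. exp (U x \<omega>) \<partial>N) \<partial>G) - (\<integral>\<omega>. ln (\<integral>x. exp (V x \<omega>) \<partial>N) \<partial>G)\<bar> \<le> \<epsilon> * K"
proof -
  interpret N: prob_space N by fact
  interpret G: prob_space G by fact
  interpret P: pair_prob_space N G ..
  interpret Q: pair_prob_space G N ..
  have \<epsilon>: "0 \<le> \<epsilon>"
  proof -
    obtain x \<omega> where "x \<in> space N" "\<omega> \<in> space G" using N.not_empty G.not_empty by auto
    then have "0 \<le> \<epsilon> * exp (W x \<omega>)" using UV[of x \<omega>] by linarith
    then show ?thesis by (simp add: zero_le_mult_iff)
  qed
  have [measurable]: "(\<lambda>(\<omega>, x). U x \<omega>) \<in> borel_measurable (G \<Otimes>\<^sub>M N)"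
    "(\<lambda>(\<omega>, x). V x \<omega>) \<in> borel_measurable (G \<Otimes>\<^sub>M N)" "(\<lambda>(\<omega>, x). W x \<omega>) \<in> borel_measurable (G \<Otimes>\<^sub>M N)"
    using assms(3-5)[THEN measurable_compose[OF measurable_pair_swap']] by (simp_all add: split_beta')
  have nn: "(\<integral>\<^sup>+\<omega>. \<integral>\<^sup>+x. ennreal (exp (2 * W x \<omega>)) \<partial>N \<partial>G) \<le> ennreal K"
    using K P.Fubini[of "\<lambda>(x, \<omega>). ennreal (exp (2 * W x \<omega>))"] by simp
  then have "(\<integral>\<^sup>+\<omega>. \<integral>\<^sup>+x. ennreal (exp (2 * W x \<omega>)) \<partial>N \<partial>G) \<noteq> \<infinity>"
    by (auto simp: top_unique)
  then have fin: "AE \<omega> in G. (\<integral>\<^sup>+x. ennreal (exp (2 * W x \<omega>)) \<partial>N) \<noteq> \<infinity>"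
    by (intro nn_integral_noteq_infinite) auto
  \<comment> \<open>The comparison at a fixed \<open>\<omega>\<close> needs
    \<open>exp (2 * W)\<close> to be integrable over \<open>N\<close>, which is known for almost
    every \<open>\<omega>\<close> only.\<close>
  have int: "AE \<omega> in G. \<omega> \<in> space G \<and> integrable N (\<lambda>x. exp (2 * W x \<omega>))"
    using fin AE_space
    by eventually_elim (auto intro!: integrableI_bounded simp: top.not_eq_extremum)
  define k where "k \<omega> = (\<integral>x. exp (2 * W x \<omega>) \<partial>N)" for \<omega>
  have [measurable]: "k \<in> borel_measurable G"
    unfolding k_def by measurable
  have k0: "0 \<le> k \<omega>" for \<omega> by (simp add: k_def)
  have "(\<integral>\<^sup>+\<omega>. ennreal (k \<omega>) \<partial>G) = (\<integral>\<^sup>+\<omega>. \<integral>\<^sup>+x. ennreal (exp (2 * W x \<omega>)) \<partial>N \<partial>G)"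
    using int by (intro nn_integral_cong_AE) (auto simp: k_def nn_integral_eq_integral elim!: eventually_mono)
  with nn have kK: "(\<integral>\<^sup>+\<omega>. ennreal (k \<omega>) \<partial>G) \<le> ennreal K" by simp
  have intk: "integrable G k"
    using kK k0 by (intro integrableI_bounded) (auto simp: le_less_trans)
  have "(\<integral>\<omega>. k \<omega> \<partial>G) \<le> K"
    using kK intk k0 \<open>0 \<le> K\<close> by (simp add: nn_integral_eq_integral)
  have bound: "\<bar>\<integral>\<omega>. f \<omega> \<partial>G\<bar> \<le> e * K" if "AE \<omega> in G. \<bar>f \<omega>\<bar> \<le> e * k \<omega>" "integrable G f" "0 \<le> e" for f e
  proof -
    have "\<bar>\<integral>\<omega>. f \<omega> \<partial>G\<bar> \<le> (\<integral>\<omega>. \<bar>f \<omega>\<bar> \<partial>G)" by (rule integral_abs_bound)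
    also have "\<dots> \<le> (\<integral>\<omega>. e * k \<omega> \<partial>G)"
      using that intk by (intro integral_mono_AE) auto
    also have "\<dots> \<le> e * K"
      using \<open>(\<integral>\<omega>. k \<omega> \<partial>G) \<le> K\<close> \<open>0 \<le> e\<close> by (simp add: mult_left_mono)
    finally show ?thesis .
  qed
  \<comment> \<open>Comparison with the exponent 0, where the logarithm is \<open>ln 1 = 0\<close>.
    As \<open>W\<close> is nonnegative, \<open>exp F\<close> and 1 both lie in
    \<open>{0..exp W}\<close>, so the error factor is 1.\<close>
  have one: "AE \<omega> in G. \<bar>ln (\<integral>x. exp (F x \<omega>) \<partial>N)\<bar> \<le> 1 * k \<omega>"
    if [measurable]: "(\<lambda>(\<omega>, x). F x \<omega>) \<in> borel_measurable (G \<Otimes>\<^sub>M N)"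
      and F: "\<And>x \<omega>. x \<in> space N \<Longrightarrow> \<omega> \<in> space G \<Longrightarrow> \<bar>F x \<omega>\<bar> \<le> W x \<omega>" for F
    using int
  proof eventually_elim
    case (elim \<omega>)
    then have [simp]: "\<omega> \<in> space G" by simp
    have "\<bar>exp (F x \<omega>) - 1\<bar> \<le> exp (W x \<omega>)" if "x \<in> space N" for x
    proof -
      have "exp (F x \<omega>) \<le> exp (W x \<omega>)" "1 \<le> exp (W x \<omega>)" "0 < exp (F x \<omega>)" using F[OF that, of \<omega>] by auto
      then show ?thesis by linarith
    qed
    moreover have "0 \<le> W x \<omega>" if "x \<in> space N" for x using F[OF that, of \<omega>] by simp
    ultimately have "\<bar>ln (\<integral>x. exp (F x \<omega>) \<partial>N) - ln (\<integral>x. exp 0 \<partial>N)\<bar> \<le> 1 * (\<integral>x. exp (2 * W x \<omega>) \<partial>N)"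
      using F elim by (intro N.ln_integral_exp_diff_le) auto
    then show ?case by (simp add: k_def N.prob_space)
  qed
  have intF: "integrable G (\<lambda>\<omega>. ln (\<integral>x. exp (F x \<omega>) \<partial>N))"
    if [measurable]: "(\<lambda>(\<omega>, x). F x \<omega>) \<in> borel_measurable (G \<Otimes>\<^sub>M N)"
      and F: "\<And>x \<omega>. x \<in> space N \<Longrightarrow> \<omega> \<in> space G \<Longrightarrow> \<bar>F x \<omega>\<bar> \<le> W x \<omega>" for F
    by (rule Bochner_Integration.integrable_bound[OF intk])
      (use one[OF that] k0 in \<open>auto elim!: eventually_mono\<close>)
  show 1: "integrable G (\<lambda>\<omega>. ln (\<integral>x. exp (U x \<omega>) \<partial>N))"
    using U by (intro intF) auto
  show "\<bar>\<integral>\<omega>. ln (\<integral>x. exp (U x \<omega>) \<partial>N) \<partial>G\<bar> \<le> K"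
    using bound[OF one 1] U by auto
  have 2: "integrable G (\<lambda>\<omega>. ln (\<integral>x. exp (V x \<omega>) \<partial>N))"
    using V by (intro intF) auto
  have "AE \<omega> in G. \<bar>ln (\<integral>x. exp (U x \<omega>) \<partial>N) - ln (\<integral>x. exp (V x \<omega>) \<partial>N)\<bar> \<le> \<epsilon> * k \<omega>"
    using int
    by eventually_elim (auto simp: k_def intro!: N.ln_integral_exp_diff_le U V UV)
  then show "\<bar>(\<integral>\<omega>. ln (\<integral>x. exp (U x \<omega>) \<partial>N) \<partial>G) - (\<integral>\<omega>. ln (\<integral>x. exp (V x \<omega>) \<partial>N) \<partial>G)\<bar> \<le> \<epsilon> * K"
    using bound[of "\<lambda>\<omega>. ln (\<integral>x. exp (U x \<omega>) \<partial>N) - ln (\<integral>x. exp (V x \<omega>) \<partial>N)" \<epsilon>] 1 2 \<epsilon> by simp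
qed

section \<open>Gaussian variables and fields\<close>

text \<open>Completing the square: the factor \<open>exp (t * x)\<close> moves the mean of the
  density to \<open>t * \<sigma>\<^sup>2\<close>.\<close>

lemma nn_integral_exp_normal_density:
  assumes "0 < \<sigma>"
  shows "(\<integral>\<^sup>+x. ennreal (normal_density 0 \<sigma> x) * ennreal (exp (t * x)) \<partial>lborel) = ennreal (exp (t\<^sup>2 * \<sigma>\<^sup>2 / 2))"
proof -
  have "normal_density 0 \<sigma> x * exp (t * x) = exp (t\<^sup>2 * \<sigma>\<^sup>2 / 2) * normal_density (t * \<sigma>\<^sup>2) \<sigma> x" for x
  proof -
    have "- x\<^sup>2 / (2 * \<sigma>\<^sup>2) + t * x = t\<^sup>2 * \<sigma>\<^sup>2 / 2 + - (x - t * \<sigma>\<^sup>2)\<^sup>2 / (2 * \<sigma>\<^sup>2)"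
      using assms by (simp add: field_simps power2_eq_square)
    then show ?thesis
      by (simp add: normal_density_def flip: exp_add)
  qed
  then have "(\<integral>\<^sup>+x. ennreal (normal_density 0 \<sigma> x) * ennreal (exp (t * x)) \<partial>lborel) =
      (\<integral>\<^sup>+x. ennreal (exp (t\<^sup>2 * \<sigma>\<^sup>2 / 2)) * ennreal (normal_density (t * \<sigma>\<^sup>2) \<sigma> x) \<partial>lborel)"
    by (simp flip: ennreal_mult)
  also have "\<dots> = ennreal (exp (t\<^sup>2 * \<sigma>\<^sup>2 / 2)) * (\<integral>\<^sup>+x. ennreal (normal_density (t * \<sigma>\<^sup>2) \<sigma> x) \<partial>lborel)"
    by (rule nn_integral_cmult) simp
  also have "(\<integral>\<^sup>+x. ennreal (normal_density (t * \<sigma>\<^sup>2) \<sigma> x) \<partial>lborel) = 1"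
    using assms by (simp add: nn_integral_eq_integral)
  finally show ?thesis by simp
qed

context prob_space
begin

lemma centered_gaussian_measurable: "centered_gaussian M X \<Longrightarrow> X \<in> borel_measurable M"
  by (simp add: centered_gaussian_def)

lemma normal_integrable_power2:
  assumes X: "distributed M lborel X (normal_density 0 \<sigma>)" and "0 < \<sigma>"
  shows "integrable M (\<lambda>\<omega>. (X \<omega>)\<^sup>2)" and "(\<integral>\<omega>. (X \<omega>)\<^sup>2 \<partial>M) = \<sigma>\<^sup>2"
proof -
  show "integrable M (\<lambda>\<omega>. (X \<omega>)\<^sup>2)"
    using distributed_integrable[OF X, of "\<lambda>x. x\<^sup>2"] integrable_normal_moment[OF \<open>0 < \<sigma>\<close>, of 0 2] by simp
  show "(\<integral>\<omega>. (X \<omega>)\<^sup>2 \<partial>M) = \<sigma>\<^sup>2"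
    using normal_distributed_variance[OF \<open>0 < \<sigma>\<close> X] normal_distributed_expectation[OF \<open>0 < \<sigma>\<close> X] by simp
qed

lemma centered_gaussian_integrable_power2:
  assumes X: "centered_gaussian M X"
  shows "integrable M (\<lambda>\<omega>. (X \<omega>)\<^sup>2)"
proof -
  have [measurable]: "X \<in> borel_measurable M" using X by (rule centered_gaussian_measurable)
  from X consider "AE \<omega> in M. X \<omega> = 0" | \<sigma> where "0 < \<sigma>" "distributed M lborel X (normal_density 0 \<sigma>)"
    by (auto simp: centered_gaussian_def)
  then show ?thesis
  proof cases
    case 1
    then have "integrable M (\<lambda>\<omega>. (X \<omega>)\<^sup>2) \<longleftrightarrow> integrable M (\<lambda>\<omega>. 0 :: real)"
      by (intro integrable_cong_AE) auto
    then show ?thesis by simp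
  qed (rule normal_integrable_power2)
qed

lemma centered_gaussian_expectation_0:
  assumes X: "centered_gaussian M X"
  shows "expectation X = 0"
proof -
  have [measurable]: "X \<in> borel_measurable M" using X by (rule centered_gaussian_measurable)
  from X consider "AE \<omega> in M. X \<omega> = 0" | \<sigma> where "0 < \<sigma>" "distributed M lborel X (normal_density 0 \<sigma>)"
    by (auto simp: centered_gaussian_def)
  then show ?thesis
  proof cases
    case 1
    then have "expectation X = expectation (\<lambda>_. 0)" by (intro integral_cong_AE) auto
    then show ?thesis by simp
  qed (rule normal_distributed_expectation)
qed

lemma centered_gaussian_exp:
  assumes X: "centered_gaussian M X"
  shows "(\<integral>\<^sup>+\<omega>. ennreal (exp (t * X \<omega>)) \<partial>M) = ennreal (exp (t\<^sup>2 * expectation (\<lambda>\<omega>. (X \<omega>)\<^sup>2) / 2))"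
proof -
  have [measurable]: "X \<in> borel_measurable M" using X by (rule centered_gaussian_measurable)
  from X consider "AE \<omega> in M. X \<omega> = 0" | \<sigma> where "0 < \<sigma>" "distributed M lborel X (normal_density 0 \<sigma>)"
    by (auto simp: centered_gaussian_def)
  then show ?thesis
  proof cases
    case 1
    then have "(\<integral>\<^sup>+\<omega>. ennreal (exp (t * X \<omega>)) \<partial>M) = (\<integral>\<^sup>+\<omega>. 1 \<partial>M)"
      by (intro nn_integral_cong_AE) auto
    moreover have "expectation (\<lambda>\<omega>. (X \<omega>)\<^sup>2) = expectation (\<lambda>\<omega>. 0)"
      using 1 by (intro integral_cong_AE) auto
    ultimately show ?thesis by (simp add: emeasure_space_1)
  next
    case 2
    have "(\<integral>\<^sup>+\<omega>. ennreal (exp (t * X \<omega>)) \<partial>M) =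
        (\<integral>\<^sup>+x. ennreal (normal_density 0 \<sigma> x) * ennreal (exp (t * x)) \<partial>lborel)"
      by (rule distributed_nn_integral[OF 2(2), symmetric]) simp
    then show ?thesis
      using nn_integral_exp_normal_density[OF 2(1)] normal_integrable_power2(2)[OF 2(2,1)] by simp
  qed
qed

lemma centered_gaussian_exp_abs:
  assumes X: "centered_gaussian M X"
  shows "(\<integral>\<^sup>+\<omega>. ennreal (exp (t * \<bar>X \<omega>\<bar>)) \<partial>M) \<le> ennreal (2 * exp (t\<^sup>2 * expectation (\<lambda>\<omega>. (X \<omega>)\<^sup>2) / 2))"
proof -
  have [measurable]: "X \<in> borel_measurable M" using X by (rule centered_gaussian_measurable)
  have "(\<integral>\<^sup>+\<omega>. ennreal (exp (t * \<bar>X \<omega>\<bar>)) \<partial>M) \<le>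
      (\<integral>\<^sup>+\<omega>. ennreal (exp (t * X \<omega>)) + ennreal (exp (- t * X \<omega>)) \<partial>M)"
    by (intro nn_integral_mono) (auto simp: abs_if simp flip: ennreal_plus)
  also have "\<dots> = ennreal (2 * exp (t\<^sup>2 * expectation (\<lambda>\<omega>. (X \<omega>)\<^sup>2) / 2))"
    using centered_gaussian_exp[OF X, of t] centered_gaussian_exp[OF X, of "-t"]
    by (subst nn_integral_add) (auto simp flip: ennreal_plus)
  finally show ?thesis .
qed

lemma centered_gaussian_cis:
  assumes X: "centered_gaussian M X"
  shows "(\<integral>\<omega>. cis (X \<omega>) \<partial>M) = of_real (exp (- expectation (\<lambda>\<omega>. (X \<omega>)\<^sup>2) / 2))"
proof -
  have [measurable]: "X \<in> borel_measurable M" using X by (rule centered_gaussian_measurable)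
  have [measurable]: "cis \<in> borel_measurable borel"
    by (intro borel_measurable_continuous_onI continuous_intros)
  from X consider "AE \<omega> in M. X \<omega> = 0" | \<sigma> where "0 < \<sigma>" "distributed M lborel X (normal_density 0 \<sigma>)"
    by (auto simp: centered_gaussian_def)
  then show ?thesis
  proof cases
    case 1
    then have "(\<integral>\<omega>. cis (X \<omega>) \<partial>M) = (\<integral>\<omega>. 1 \<partial>M)"
      by (intro integral_cong_AE) auto
    moreover have "expectation (\<lambda>\<omega>. (X \<omega>)\<^sup>2) = expectation (\<lambda>\<omega>. 0)"
      using 1 by (intro integral_cong_AE) auto
    ultimately show ?thesis by (simp add: prob_space)
  next
    case 2
    have d: "distributed M lborel (\<lambda>\<omega>. X \<omega> / \<sigma>) std_normal_density"
      using normal_standard_normal_convert[OF 2(1), of X 0] 2(2) by simp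
    have "(\<integral>\<omega>. cis (X \<omega>) \<partial>M) = (\<integral>\<omega>. iexp (\<sigma> * (X \<omega> / \<sigma>)) \<partial>M)"
      using 2(1) by (simp add: cis_conv_exp)
    also have "\<dots> = (\<integral>x. iexp (\<sigma> * x) \<partial>distr M lborel (\<lambda>\<omega>. X \<omega> / \<sigma>))"
      by (subst integral_distr) auto
    also have "\<dots> = char std_normal_distribution \<sigma>"
      using d by (simp add: char_def distributed_def)
    also have "\<dots> = of_real (exp (- \<sigma>\<^sup>2 / 2))"
      by (simp add: char_std_normal_distribution)
    finally show ?thesis using normal_integrable_power2(2)[OF 2(2,1)] by simp
  qed
qed

end

lemma centered_gaussian_std_normal:
  "centered_gaussian (density lborel std_normal_density) (\<lambda>z. z)"
  "(\<integral>z. z\<^sup>2 \<partial>density lborel std_normal_density) = 1"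
proof -
  have d: "distributed (density lborel std_normal_density) lborel (\<lambda>z. z) (normal_density 0 1)"
    by (auto simp: distributed_def distr_id2)
  then show "centered_gaussian (density lborel std_normal_density) (\<lambda>z. z)"
    unfolding centered_gaussian_def by (auto intro!: exI[of _ 1])
  interpret prob_space "density lborel std_normal_density"
    by (rule prob_space_normal_density) simp
  show "(\<integral>z. z\<^sup>2 \<partial>density lborel std_normal_density) = 1"
    using normal_integrable_power2(2)[OF d] by simp
qed

lemma centered_gaussian_cmult:
  assumes "prob_space G" "centered_gaussian G X"
  shows "centered_gaussian G (\<lambda>\<omega>. s * X \<omega>)"
proof (cases "s = 0")
  case False
  interpret prob_space G by fact
  from assms(2) consider "X \<in> borel_measurable G" "AE \<omega> in G. X \<omega> = 0" | \<sigma> where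
     "X \<in> borel_measurable G" "0 < \<sigma>" "distributed G lborel X (normal_density 0 \<sigma>)"
    by (auto simp: centered_gaussian_def)
  then show ?thesis
  proof cases
    case 2
    have "distributed G lborel (\<lambda>\<omega>. 0 + s * X \<omega>) (normal_density (0 + s * 0) (\<bar>s\<bar> * \<sigma>))"
      using 2 False by (intro normal_density_affine) auto
    then show ?thesis
      using 2 False unfolding centered_gaussian_def by (intro conjI disjI2 exI[of _ "\<bar>s\<bar> * \<sigma>"]) auto
  qed (auto simp: centered_gaussian_def elim!: eventually_mono)
qed (simp add: centered_gaussian_def)

context
  fixes G :: "'g measure" and c :: "real \<Rightarrow> real" and l :: "'h::{real_inner, polish_space} \<Rightarrow> 'g \<Rightarrow> real"
  assumes field: "gaussian_field G c l"
begin

interpretation G: prob_space G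
  using field unfolding gaussian_field_def by blast

lemma gaussian_field_prob_space: "prob_space G"
  by (rule G.prob_space_axioms)

lemma gaussian_field_measurable: "(\<lambda>(v, \<omega>). l v \<omega>) \<in> borel_measurable (ball_space \<Otimes>\<^sub>M G)"
  using field by (simp add: gaussian_field_def)

lemma gaussian_field_sum:
  assumes "finite F" "F \<subseteq> cball 0 1"
  shows "centered_gaussian G (\<lambda>\<omega>. \<Sum>v\<in>F. a v * l v \<omega>)"
  using field assms by (simp add: gaussian_field_def)

lemma gaussian_field_single:
  assumes "v \<in> cball 0 1"
  shows "centered_gaussian G (l v)" "(\<integral>\<omega>. (l v \<omega>)\<^sup>2 \<partial>G) = c ((norm v)\<^sup>2)"
proof -
  show "centered_gaussian G (l v)"
    using gaussian_field_sum[of "{v}" "\<lambda>_. 1"] assms by simp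
  show "(\<integral>\<omega>. (l v \<omega>)\<^sup>2 \<partial>G) = c ((norm v)\<^sup>2)"
    using field assms by (simp add: gaussian_field_def power2_eq_square dot_square_norm[unfolded power2_eq_square])
qed

lemma gaussian_field_integrable_mult:
  assumes "v \<in> cball 0 1" "w \<in> cball 0 1"
  shows "integrable G (\<lambda>\<omega>. l v \<omega> * l w \<omega>)"
proof -
  have [measurable]: "l v \<in> borel_measurable G" "l w \<in> borel_measurable G"
    using assms gaussian_field_single(1) G.centered_gaussian_measurable by blast+
  show ?thesis
  proof (rule Bochner_Integration.integrable_bound)
    show "integrable G (\<lambda>\<omega>. (l v \<omega>)\<^sup>2 + (l w \<omega>)\<^sup>2)"
      using assms by (intro Bochner_Integration.integrable_add G.centered_gaussian_integrable_power2 gaussian_field_single)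
    have "\<bar>x * y\<bar> \<le> x\<^sup>2 + y\<^sup>2" for x y :: real
      using sum_squares_bound[of "\<bar>x\<bar>" "\<bar>y\<bar>"] abs_ge_zero[of "x * y"] unfolding abs_mult power2_abs by linarith
    then show "AE \<omega> in G. norm (l v \<omega> * l w \<omega>) \<le> norm ((l v \<omega>)\<^sup>2 + (l w \<omega>)\<^sup>2)" by simp
  qed simp
qed

text \<open>The definition of a field speaks of sets of points, but replicas are indexed and may
  coincide. Coefficients over equal points are collected first.\<close>

lemma gaussian_field_family:
  assumes I: "finite I" and v: "\<And>i. i \<in> I \<Longrightarrow> v i \<in> cball 0 1"
  shows "centered_gaussian G (\<lambda>\<omega>. \<Sum>i\<in>I. a i * l (v i) \<omega>)"
    and "(\<integral>\<omega>. (\<Sum>i\<in>I. a i * l (v i) \<omega>)\<^sup>2 \<partial>G) = (\<Sum>i\<in>I. \<Sum>j\<in>I. a i * a j * c (v i \<bullet> v j))"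
proof -
  have "(\<Sum>i\<in>I. a i * l (v i) \<omega>) = (\<Sum>w\<in>v ` I. (\<Sum>i\<in>{i\<in>I. v i = w}. a i) * l w \<omega>)" for \<omega>
    using I by (subst sum.image_gen[where g=v]) (auto simp: sum_distrib_right intro!: sum.cong)
  then show "centered_gaussian G (\<lambda>\<omega>. \<Sum>i\<in>I. a i * l (v i) \<omega>)"
    using gaussian_field_sum[of "v ` I" "\<lambda>w. \<Sum>i\<in>{i\<in>I. v i = w}. a i"] I v by (auto simp: image_subset_iff)
  have "(\<integral>\<omega>. (\<Sum>i\<in>I. a i * l (v i) \<omega>)\<^sup>2 \<partial>G) = (\<integral>\<omega>. (\<Sum>i\<in>I. \<Sum>j\<in>I. a i * a j * (l (v i) \<omega> * l (v j) \<omega>)) \<partial>G)"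
    by (simp add: power2_eq_square sum_product mult_ac)
  also have "\<dots> = (\<Sum>i\<in>I. \<Sum>j\<in>I. a i * a j * (\<integral>\<omega>. l (v i) \<omega> * l (v j) \<omega> \<partial>G))"
  proof -
    have int: "integrable G (\<lambda>\<omega>. a i * a j * (l (v i) \<omega> * l (v j) \<omega>))" if "i \<in> I" "j \<in> I" for i j
      using that v by (intro integrable_mult_right gaussian_field_integrable_mult) auto
    show ?thesis
      using int
      by (intro trans[OF Bochner_Integration.integral_sum] sum.cong refl Bochner_Integration.integrable_sum) simp_all
  qed
  also have "\<dots> = (\<Sum>i\<in>I. \<Sum>j\<in>I. a i * a j * c (v i \<bullet> v j))"
    using field v by (simp add: gaussian_field_def)
  finally show "(\<integral>\<omega>. (\<Sum>i\<in>I. a i * l (v i) \<omega>)\<^sup>2 \<partial>G) = (\<Sum>i\<in>I. \<Sum>j\<in>I. a i * a j * c (v i \<bullet> v j))" .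
qed

text \<open>The place where expectations over the field turn into functions of inner
  products.\<close>

lemma gaussian_field_char:
  fixes a :: "'i \<Rightarrow> real"
  assumes "finite I" "\<And>i. i \<in> I \<Longrightarrow> v i \<in> cball 0 1"
  shows "(\<integral>\<omega>. cis (\<Sum>i\<in>I. a i * l (v i) \<omega>) \<partial>G) =
    of_real (exp (- (\<Sum>i\<in>I. \<Sum>j\<in>I. a i * a j * c (v i \<bullet> v j)) / 2))"
proof -
  have "centered_gaussian G (\<lambda>\<omega>. \<Sum>i\<in>I. a i * l (v i) \<omega>)"
    using assms by (intro gaussian_field_family(1)) auto
  moreover have "(\<integral>\<omega>. (\<Sum>i\<in>I. a i * l (v i) \<omega>)\<^sup>2 \<partial>G) = (\<Sum>i\<in>I. \<Sum>j\<in>I. a i * a j * c (v i \<bullet> v j))"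
    using assms by (intro gaussian_field_family(2)) auto
  ultimately show ?thesis
    using G.centered_gaussian_cis[of "\<lambda>\<omega>. \<Sum>i\<in>I. a i * l (v i) \<omega>"] by simp
qed

end

section \<open>Replicas\<close>

text \<open>Cylinder sets form a generator stable under intersection, and on them the product
  measure is a finite product of evaluations of \<open>\<mu>\<close>. Measurability of
  \<open>replica_law\<close> rests on this.\<close>

lemma PiM_prob_algebra [measurable]:
  "(\<lambda>\<mu>. PiM (UNIV :: 'i set) (\<lambda>_. \<mu>)) \<in> prob_algebra M \<rightarrow>\<^sub>M prob_algebra (PiM UNIV (\<lambda>_. M))"
proof (rule measurable_prob_algebra_generated[OF sets_PiM Int_stable_prod_algebra prod_algebra_sets_into_space])
  fix \<mu> assume "\<mu> \<in> space (prob_algebra M)"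
  then have "prob_space \<mu>" and sets: "sets \<mu> = sets M" by (auto simp: space_prob_algebra)
  then show "prob_space (PiM UNIV (\<lambda>_. \<mu>))" by (intro prob_space_PiM)
  show "sets (PiM UNIV (\<lambda>_. \<mu>)) = sets (PiM UNIV (\<lambda>_. M))"
    using sets by (intro sets_PiM_cong) auto
next
  fix A assume "A \<in> prod_algebra (UNIV :: 'i set) (\<lambda>_. M)"
  then obtain J E where J: "finite J" "A = prod_emb UNIV (\<lambda>_. M) J (PiE J E)" "\<And>i. i \<in> J \<Longrightarrow> E i \<in> sets M"
    by (rule prod_algebraE) auto
  have "emeasure (PiM UNIV (\<lambda>_. \<mu>)) A = (\<Prod>i\<in>J. emeasure \<mu> (E i))" if \<mu>: "\<mu> \<in> space (prob_algebra M)" for \<mu>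
  proof -
    interpret prob_space \<mu> using \<mu> by (simp add: space_prob_algebra)
    interpret product_prob_space "\<lambda>_. \<mu>" UNIV ..
    have sets: "sets \<mu> = sets M" using \<mu> by (simp add: space_prob_algebra)
    have "A = prod_emb UNIV (\<lambda>_. \<mu>) J (PiE J E)"
      using J(2) sets_eq_imp_space_eq[OF sets] by (simp add: prod_emb_def)
    then show ?thesis
      using J(1,3) emeasure_PiM_emb[of J E] sets by simp
  qed
  moreover have "(\<lambda>\<mu>. \<Prod>i\<in>J. emeasure \<mu> (E i)) \<in> borel_measurable (prob_algebra M)"
    using J by (intro borel_measurable_prod_ennreal) (auto simp: prob_algebra_def intro!: measurable_restrict_space1 measurable_emeasure_subprob_algebra)
  ultimately show "(\<lambda>\<mu>. emeasure (PiM UNIV (\<lambda>_. \<mu>)) A) \<in> borel_measurable (prob_algebra M)"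
    by (subst measurable_cong) auto
qed

text \<open>The replica identity: independence of the coordinates. The infinite product serves for
  every \<open>n\<close>, since \<open>replica_law\<close> is built on it.\<close>

lemma (in prob_space) integral_power_eq_PiM:
  fixes f :: "'a \<Rightarrow> complex"
  assumes f: "integrable M f"
  shows "(\<integral>x. f x \<partial>M) ^ n = (\<integral>v. (\<Prod>i<n. f (v i)) \<partial>PiM (UNIV :: nat set) (\<lambda>_. M))"
proof -
  interpret product_prob_space "\<lambda>_. M" "UNIV :: nat set" ..
  let ?P = "PiM (UNIV :: nat set) (\<lambda>_. M)"
  have distr: "distr ?P M (\<lambda>v. v i) = M" for i
    by (rule PiM_component) auto
  \<comment> \<open>The joint map of all coordinates is the identity, so their joint law is already
    the product of their laws.\<close>
  have "P.indep_vars (\<lambda>_. M) (\<lambda>i v. v i) (UNIV :: nat set)"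
    by (subst P.indep_vars_iff_distr_eq_PiM) (auto simp: distr restrict_UNIV distr_id2)
  then have "P.indep_vars (\<lambda>_. M) (\<lambda>i v. v i) {..<n}"
    by (rule P.indep_vars_subset) simp
  then have "P.indep_vars (\<lambda>_. borel) (\<lambda>i v. f (v i)) {..<n}"
    by (rule P.indep_vars_compose2) (rule borel_measurable_integrable[OF f])
  moreover have "integrable ?P (\<lambda>v. f (v i))" for i
    using f integrable_distr_eq[of "\<lambda>v. v i" ?P M f] by (simp add: distr)
  ultimately have "(\<integral>v. (\<Prod>i<n. f (v i)) \<partial>?P) = (\<Prod>i<n. \<integral>v. f (v i) \<partial>?P)"
    by (intro P.indep_vars_lebesgue_integral) auto
  also have "\<dots> = (\<Prod>i<n. \<integral>x. f x \<partial>M)"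
    using f integral_distr[of "\<lambda>v. v _" ?P M f] by (simp add: distr)
  finally show ?thesis by simp
qed

lemma ball_space_inner [measurable]:
  "(\<lambda>x. f x \<bullet> g x) \<in> borel_measurable M"
  if "f \<in> M \<rightarrow>\<^sub>M (ball_space :: 'h::{real_inner, polish_space} measure)" "g \<in> M \<rightarrow>\<^sub>M ball_space"
proof -
  have "f \<in> borel_measurable M" "g \<in> borel_measurable M"
    using that by (auto simp: ball_space_def measurable_restrict_space2_iff)
  then show ?thesis by measurable
qed

lemma space_ball_space: "space ball_space = cball 0 1"
  by (simp add: ball_space_def space_restrict_space)

lemma norm_measurable_ball_space [measurable]:
  "norm \<in> borel_measurable (ball_space :: 'h::{real_inner, polish_space} measure)"
  unfolding ball_space_def by (intro measurable_restrict_space1) simp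

lemma space_prob_algebra_ball_space:
  assumes "\<mu> \<in> space (prob_algebra ball_space)"
  shows "space \<mu> = cball 0 1"
proof -
  have "sets \<mu> = sets ball_space" using assms by (simp add: space_prob_algebra)
  from sets_eq_imp_space_eq[OF this] show ?thesis by (simp add: space_ball_space)
qed

lemma replica_inner_measurable:
  "(\<lambda>v. \<lambda>(i, j)\<in>off_diag. v i \<bullet> v j) \<in>
    PiM (UNIV :: nat set) (\<lambda>_. ball_space :: 'h::{real_inner, polish_space} measure) \<rightarrow>\<^sub>M off_diag_space"
  unfolding off_diag_space_def by (intro measurable_restrict) auto

lemma replica_law_measurable [measurable]:
  "replica_law \<in> prob_algebra (ball_space :: 'h::{real_inner, polish_space} measure) \<rightarrow>\<^sub>M prob_algebra off_diag_space"
  unfolding replica_law_def[abs_def]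
  using measurable_comp[OF PiM_prob_algebra measurable_distr_prob_space[OF replica_inner_measurable]]
  by (simp add: comp_def)

lemma restrict_off_diag_measurable:
  "(\<lambda>q. restrict q off_diag) \<in> overlap_space \<rightarrow>\<^sub>M off_diag_space"
  unfolding off_diag_space_def overlap_space_def
  by (intro measurable_restrict measurable_restrict_space1 borel_measurable_continuous_onI
      continuous_on_product_coordinates)

text \<open>The conditional-law clause of \<open>sampling_measure\<close> with the whole space of
  measures as \<open>A\<close>: the law of the off-diagonal entries is a mixture of replica
  laws.\<close>

lemma distr_off_diag:
  fixes J :: "(overlap \<times> 'h::{real_inner, polish_space} measure) measure"
  assumes "sampling_measure P J"
  shows "distr J off_diag_space (\<lambda>(q, \<mu>). restrict q off_diag) = J \<bind> (\<lambda>(q, \<mu>). replica_law \<mu>)"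
proof (rule measure_eqI)
  interpret prob_space J using assms by (simp add: sampling_measure_def)
  have [measurable_cong]: "sets J = sets (overlap_space \<Otimes>\<^sub>M prob_algebra ball_space)"
    using assms by (simp add: sampling_measure_def)
  have k: "(\<lambda>(q, \<mu>). replica_law \<mu>) \<in> J \<rightarrow>\<^sub>M subprob_algebra off_diag_space"
    by (rule measurable_prob_algebraD) measurable
  have sets: "sets (J \<bind> (\<lambda>(q, \<mu>). replica_law \<mu>)) = sets off_diag_space"
    by (rule sets_bind[OF _ not_empty]) (use k in \<open>auto dest: subprob_measurableD\<close>)
  then show "sets (distr J off_diag_space (\<lambda>(q, \<mu>). restrict q off_diag)) = sets (J \<bind> (\<lambda>(q, \<mu>). replica_law \<mu>))"
    by simp
  have m: "(\<lambda>(q, \<mu>). restrict q off_diag) \<in> J \<rightarrow>\<^sub>M off_diag_space"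
    using restrict_off_diag_measurable unfolding split_beta' by measurable
  fix C assume "C \<in> sets (distr J off_diag_space (\<lambda>(q, \<mu>). restrict q off_diag))"
  then have C: "C \<in> sets off_diag_space" by simp
  have spJ: "space J = space overlap_space \<times> space (prob_algebra ball_space)"
    using sets_eq_imp_space_eq[of J "overlap_space \<Otimes>\<^sub>M prob_algebra ball_space"] assms
    by (simp add: sampling_measure_def space_pair_measure)
  have "(\<lambda>(q, \<mu>). restrict q off_diag) -` C \<inter> space J =
      {(q, \<mu>) \<in> space J. \<mu> \<in> space (prob_algebra ball_space) \<and> restrict q off_diag \<in> C}"
    unfolding spJ by auto
  also have "emeasure J \<dots> =
      (\<integral>\<^sup>+(q, \<mu>). indicator (space (prob_algebra ball_space)) \<mu> * emeasure (replica_law \<mu>) C \<partial>J)"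
    using assms C unfolding sampling_measure_def by blast
  also have "\<dots> = (\<integral>\<^sup>+x. emeasure ((\<lambda>(q, \<mu>). replica_law \<mu>) x) C \<partial>J)"
    using spJ by (intro nn_integral_cong) (auto simp: split_beta')
  finally show "emeasure (distr J off_diag_space (\<lambda>(q, \<mu>). restrict q off_diag)) C =
      emeasure (J \<bind> (\<lambda>(q, \<mu>). replica_law \<mu>)) C"
    unfolding emeasure_distr[OF m C] emeasure_bind[OF not_empty k C] .
qed

lemma integral_replica_law:
  fixes f :: "overlap \<Rightarrow> real" and \<mu> :: "'h::{real_inner, polish_space} measure"
  assumes "\<mu> \<in> space (prob_algebra ball_space)" "f \<in> borel_measurable off_diag_space"
  shows "(\<integral>v. f (\<lambda>(i, j)\<in>off_diag. v i \<bullet> v j) \<partial>PiM (UNIV :: nat set) (\<lambda>_. \<mu>)) = (\<integral>q. f q \<partial>replica_law \<mu>)"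
proof -
  have "sets (PiM (UNIV :: nat set) (\<lambda>_. \<mu>)) = sets (PiM (UNIV :: nat set) (\<lambda>_. ball_space))"
    using assms by (intro sets_PiM_cong) (auto simp: space_prob_algebra)
  then have "(\<lambda>v. \<lambda>(i, j)\<in>off_diag. v i \<bullet> v j) \<in> PiM (UNIV :: nat set) (\<lambda>_. \<mu>) \<rightarrow>\<^sub>M off_diag_space"
    using replica_inner_measurable measurable_cong_sets by blast
  from integral_distr[OF this assms(2)] show ?thesis
    by (simp add: replica_law_def)
qed

text \<open>The bridge between the two sides: integrals against \<open>P\<close>, which the weak-*
  topology controls, and replica integrals averaged over the sampling measure.\<close>

lemma integral_off_diag:
  fixes J :: "(overlap \<times> 'h::{real_inner, polish_space} measure) measure" and f :: "overlap \<Rightarrow> real"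
  assumes J: "sampling_measure P J"
    and [measurable]: "f \<in> borel_measurable off_diag_space" and B: "\<And>q. \<bar>f q\<bar> \<le> B"
  shows "(\<integral>q. f (restrict q off_diag) \<partial>P) =
    (\<integral>(q, \<mu>). (\<integral>v. f (\<lambda>(i, j)\<in>off_diag. v i \<bullet> v j) \<partial>PiM (UNIV :: nat set) (\<lambda>_. \<mu>)) \<partial>J)"
proof -
  interpret prob_space J using J by (simp add: sampling_measure_def)
  have sJ [measurable_cong]: "sets J = sets (overlap_space \<Otimes>\<^sub>M prob_algebra ball_space)"
    and PJ: "distr J overlap_space fst = P"
    using J by (simp_all add: sampling_measure_def)
  have spJ: "space J = space overlap_space \<times> space (prob_algebra ball_space)"
    using sets_eq_imp_space_eq[OF sJ] by (simp add: space_pair_measure)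
  have k: "(\<lambda>(q, \<mu>). replica_law \<mu>) \<in> J \<rightarrow>\<^sub>M subprob_algebra off_diag_space"
    by (rule measurable_prob_algebraD) measurable
  have m0: "(\<lambda>q. restrict q off_diag) \<in> overlap_space \<rightarrow>\<^sub>M off_diag_space"
    by (rule restrict_off_diag_measurable)
  have m: "(\<lambda>(q, \<mu>). restrict q off_diag) \<in> J \<rightarrow>\<^sub>M off_diag_space"
    using m0 unfolding split_beta' by measurable
  let ?F = "\<lambda>\<mu>. \<integral>v. f (\<lambda>(i, j)\<in>off_diag. v i \<bullet> v j) \<partial>PiM (UNIV :: nat set) (\<lambda>_. \<mu>)"
  have "(\<integral>q. f (restrict q off_diag) \<partial>P) = (\<integral>x. f ((\<lambda>(q, \<mu>). restrict q off_diag) x) \<partial>J)"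
    unfolding PJ[symmetric] using m0 by (subst integral_distr) (auto simp: split_beta')
  also have "\<dots> = (\<integral>q. f q \<partial>(J \<bind> (\<lambda>(q, \<mu>). replica_law \<mu>)))"
    unfolding distr_off_diag[OF J, symmetric] using m by (subst integral_distr) auto
  also have "\<dots> = (\<integral>x. \<integral>q. f q \<partial>((\<lambda>(q, \<mu>). replica_law \<mu>) x) \<partial>J)"
  proof -
    have "prob_space (replica_law \<mu>)"
      if "\<mu> \<in> space (prob_algebra ball_space)" for \<mu> :: "'h measure"
      using measurable_space[OF replica_law_measurable that] by (simp add: space_prob_algebra)
    then have "AE x in J. emeasure ((\<lambda>(q, \<mu>). replica_law \<mu>) x) (space ((\<lambda>(q, \<mu>). replica_law \<mu>) x)) \<le> ennreal 1"
      using spJ by (auto simp: prob_space.emeasure_space_1)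
    then show ?thesis
      by (intro integral_bind[OF assms(2) B k finite_measure_axioms])
  qed
  also have "\<dots> = (\<integral>(q, \<mu>). ?F \<mu> \<partial>J)"
    using spJ by (intro Bochner_Integration.integral_cong) (auto simp: integral_replica_law[OF _ assms(2)])
  finally show ?thesis .
qed

section \<open>Replica moments of trigonometric polynomials\<close>

lemma cis_measurable [measurable]: "cis \<in> borel_measurable borel"
  by (intro borel_measurable_continuous_onI continuous_intros)

lemma cis_sum: "finite I \<Longrightarrow> cis (\<Sum>i\<in>I. f i) = (\<Prod>i\<in>I. cis (f i))"
  by (induction I rule: finite_induct) (auto simp: cis_mult[symmetric])

lemma prob_space_std_normal: "prob_space (density lborel std_normal_density)"
  by (rule prob_space_normal_density) simp

lemma std_normal_char:
  "(\<integral>z. cis (t * z) \<partial>density lborel std_normal_density) = of_real (exp (- t\<^sup>2 / 2))"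
proof -
  interpret prob_space "density lborel std_normal_density" by (rule prob_space_std_normal)
  have "(\<integral>z. (t * z)\<^sup>2 \<partial>density lborel std_normal_density) = t\<^sup>2"
    using centered_gaussian_std_normal(2) by (simp add: power_mult_distrib)
  then show ?thesis
    using centered_gaussian_cis[OF centered_gaussian_cmult[OF prob_space_std_normal centered_gaussian_std_normal(1)], of t]
    by simp
qed

text \<open>\<open>m\<close> assigns a frequency index to each of \<open>n\<close> replicas. The
  exponent is minus half the variance of \<open>\<Lambda> * (\<Sum>i<n. s (m i) * X i)\<close>,
  where \<open>X i\<close> is the field at replica \<open>i\<close> plus a noise of its own;
  \<open>X i\<close> has variance 1, and \<open>c (q (i, j))\<close> is the covariance of
  \<open>X i\<close> and \<open>X j\<close>.\<close>

definition trig_moment ::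
    "(real \<Rightarrow> real) \<Rightarrow> real \<Rightarrow> 'i set \<Rightarrow> ('i \<Rightarrow> complex) \<Rightarrow> ('i \<Rightarrow> real) \<Rightarrow> nat \<Rightarrow> overlap \<Rightarrow> complex" where
  "trig_moment c \<Lambda> A \<alpha> s n q =
     (\<Sum>m\<in>PiE {..<n} (\<lambda>_. A). (\<Prod>i<n. \<alpha> (m i)) *
       of_real (exp (- \<Lambda>\<^sup>2 / 2 * (\<Sum>i<n. \<Sum>j<n. s (m i) * s (m j) * (if i = j then 1 else c (q (i, j)))))))"

context
  fixes G :: "'g measure" and c :: "real \<Rightarrow> real" and l :: "'h::{real_inner, polish_space} \<Rightarrow> 'g \<Rightarrow> real"
    and \<mu> :: "'h measure" and \<Lambda> :: real
  assumes field: "gaussian_field G c l"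
    and c: "c \<in> borel_measurable borel" "\<And>v :: 'h. v \<in> cball 0 1 \<Longrightarrow> c ((norm v)\<^sup>2) \<le> 1"
    and \<mu>: "\<mu> \<in> space (prob_algebra ball_space)"
begin

interpretation G: prob_space G
  using field by (rule gaussian_field_prob_space)

interpretation \<mu>: prob_space \<mu>
  using \<mu> by (simp add: space_prob_algebra)

interpretation \<gamma>: prob_space "density lborel std_normal_density"
  by (rule prob_space_std_normal)

lemma sets_\<mu> [measurable_cong]: "sets \<mu> = sets ball_space"
  using \<mu> by (simp add: space_prob_algebra)

lemmas space_\<mu> = space_prob_algebra_ball_space[OF \<mu>]

lemmas [measurable] = gaussian_field_measurable[OF field]

text \<open>Integrating the noise first turns it into a damping factor depending on
  \<open>v\<close>, so that replicas need to be taken of \<open>\<mu>\<close> alone.\<close>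

lemma integral_std_normal_trig:
  assumes "\<omega> \<in> space G" "finite A"
  shows "(\<integral>(v, z). (\<Sum>m\<in>A. \<alpha> m * cis (s m * (\<Lambda> * l v \<omega> + \<Lambda> * z * sqrt (1 - c ((norm v)\<^sup>2)))))
          \<partial>(\<mu> \<Otimes>\<^sub>M density lborel std_normal_density)) =
    (\<integral>v. (\<Sum>m\<in>A. \<alpha> m * cis (s m * \<Lambda> * l v \<omega>) * of_real (exp (- \<Lambda>\<^sup>2 / 2 * ((s m)\<^sup>2 * (1 - c ((norm v)\<^sup>2)))))) \<partial>\<mu>)"
proof -
  note c(1)[measurable]
  interpret pair_prob_space \<mu> "density lborel std_normal_density" ..
  let ?h = "\<lambda>v z. \<Sum>m\<in>A. \<alpha> m * cis (s m * (\<Lambda> * l v \<omega> + \<Lambda> * z * sqrt (1 - c ((norm v)\<^sup>2))))"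
  have [measurable]: "(\<lambda>v. l v \<omega>) \<in> borel_measurable \<mu>"
    using measurable_compose[OF measurable_Pair1' gaussian_field_measurable[OF field]] assms(1) by simp
  have "integrable (\<mu> \<Otimes>\<^sub>M density lborel std_normal_density) (\<lambda>(v, z). ?h v z)"
    unfolding split_beta'
    by (intro Bochner_Integration.integrable_sum P.integrable_const_bound[where B="norm (\<alpha> _)"])
      (auto simp: norm_mult)
  then have "(\<integral>(v, z). ?h v z \<partial>(\<mu> \<Otimes>\<^sub>M density lborel std_normal_density)) =
      (\<integral>v. \<integral>z. ?h v z \<partial>density lborel std_normal_density \<partial>\<mu>)"
    by (rule integral_fst[symmetric])
  also have "\<dots> = (\<integral>v. (\<Sum>m\<in>A. \<alpha> m * cis (s m * \<Lambda> * l v \<omega>) *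
      of_real (exp (- \<Lambda>\<^sup>2 / 2 * ((s m)\<^sup>2 * (1 - c ((norm v)\<^sup>2)))))) \<partial>\<mu>)"
  proof (rule Bochner_Integration.integral_cong[OF refl])
    fix v assume "v \<in> space \<mu>"
    \<comment> \<open>Ensures that \<open>sqrt (1 - c ((norm v)\<^sup>2))\<close> squares to its
      argument.\<close>
    then have c1: "c ((norm v)\<^sup>2) \<le> 1" using c by (auto simp: space_\<mu>)
    let ?t = "\<lambda>m. s m * \<Lambda> * sqrt (1 - c ((norm v)\<^sup>2))"
    have "(\<integral>z. ?h v z \<partial>density lborel std_normal_density) =
        (\<integral>z. (\<Sum>m\<in>A. (\<alpha> m * cis (s m * \<Lambda> * l v \<omega>)) * cis (?t m * z)) \<partial>density lborel std_normal_density)"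
      by (simp add: cis_mult algebra_simps)
    also have "\<dots> = (\<Sum>m\<in>A. (\<integral>z. (\<alpha> m * cis (s m * \<Lambda> * l v \<omega>)) * cis (?t m * z) \<partial>density lborel std_normal_density))"
      by (intro Bochner_Integration.integral_sum \<gamma>.integrable_const_bound[where B="norm (\<alpha> _)"])
        (auto simp: norm_mult)
    also have "\<dots> = (\<Sum>m\<in>A. \<alpha> m * cis (s m * \<Lambda> * l v \<omega>) * of_real (exp (- (?t m)\<^sup>2 / 2)))"
      by (simp add: std_normal_char)
    also have "\<dots> = (\<Sum>m\<in>A. \<alpha> m * cis (s m * \<Lambda> * l v \<omega>) *
        of_real (exp (- \<Lambda>\<^sup>2 / 2 * ((s m)\<^sup>2 * (1 - c ((norm v)\<^sup>2))))))"
      using c1 by (simp add: power_mult_distrib mult_ac)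
    finally show "(\<integral>z. ?h v z \<partial>density lborel std_normal_density) = \<dots>" .
  qed
  finally show ?thesis .
qed

lemma expectation_power_trig:
  assumes A: "finite A"
  shows "(\<integral>\<omega>. (\<integral>(v, z). (\<Sum>m\<in>A. \<alpha> m * cis (s m * (\<Lambda> * l v \<omega> + \<Lambda> * z * sqrt (1 - c ((norm v)\<^sup>2)))))
          \<partial>(\<mu> \<Otimes>\<^sub>M density lborel std_normal_density)) ^ n \<partial>G) =
    (\<integral>v. trig_moment c \<Lambda> A \<alpha> s n (\<lambda>(i, j). v i \<bullet> v j) \<partial>PiM (UNIV :: nat set) (\<lambda>_. \<mu>))"
proof -
  note c(1)[measurable]
  let ?e = "\<lambda>v m. exp (- \<Lambda>\<^sup>2 / 2 * ((s m)\<^sup>2 * (1 - c ((norm v)\<^sup>2))))"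
  let ?b = "\<lambda>v \<omega>. \<Sum>m\<in>A. \<alpha> m * cis (s m * \<Lambda> * l v \<omega>) * of_real (?e v m)"
  let ?P = "PiM (UNIV :: nat set) (\<lambda>_. \<mu>)"
  interpret P: product_prob_space "\<lambda>_. \<mu>" "UNIV :: nat set" ..
  interpret Q: pair_prob_space ?P G ..
  have spP: "v i \<in> cball 0 1" if "v \<in> space ?P" for v i
    using that by (auto simp: space_PiM space_\<mu> Pi_iff)
  have b_bound: "norm (?b v \<omega>) \<le> (\<Sum>m\<in>A. norm (\<alpha> m))" if "v \<in> cball 0 1" for v \<omega>
  proof (rule order_trans[OF norm_sum sum_mono])
    fix m
    have "?e v m \<le> 1" using c(2)[OF that] by simp
    then show "norm (\<alpha> m * cis (s m * \<Lambda> * l v \<omega>) * of_real (?e v m)) \<le> norm (\<alpha> m)"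
      unfolding norm_mult norm_cis norm_of_real by (simp add: mult_left_le)
  qed
  have m_b: "(\<lambda>(v, \<omega>). ?b v \<omega>) \<in> borel_measurable (\<mu> \<Otimes>\<^sub>M G)"
    by measurable
  have "(\<integral>\<omega>. (\<integral>(v, z). (\<Sum>m\<in>A. \<alpha> m * cis (s m * (\<Lambda> * l v \<omega> + \<Lambda> * z * sqrt (1 - c ((norm v)\<^sup>2)))))
          \<partial>(\<mu> \<Otimes>\<^sub>M density lborel std_normal_density)) ^ n \<partial>G) = (\<integral>\<omega>. (\<integral>v. ?b v \<omega> \<partial>\<mu>) ^ n \<partial>G)"
    using A by (intro Bochner_Integration.integral_cong) (auto simp: integral_std_normal_trig)
  also have "\<dots> = (\<integral>\<omega>. \<integral>v. (\<Prod>i<n. ?b (v i) \<omega>) \<partial>?P \<partial>G)"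
  proof (rule Bochner_Integration.integral_cong[OF refl \<mu>.integral_power_eq_PiM])
    fix \<omega> assume "\<omega> \<in> space G"
    then have "(\<lambda>v. ?b v \<omega>) \<in> borel_measurable \<mu>"
      using measurable_compose[OF measurable_Pair1' m_b] by simp
    then show "integrable \<mu> (\<lambda>v. ?b v \<omega>)"
      by (intro \<mu>.integrable_const_bound[OF AE_I2[OF b_bound]]) (simp_all only: space_\<mu>)
  qed
  \<comment> \<open>The trigonometric sums are bounded, so Fubini applies. Inside, the replicas are
    now fixed and only finitely many jointly Gaussian variables remain.\<close>
  also have "\<dots> = (\<integral>v. \<integral>\<omega>. (\<Prod>i<n. ?b (v i) \<omega>) \<partial>G \<partial>?P)"
  proof (rule Q.Fubini_integral)
    show "integrable (?P \<Otimes>\<^sub>M G) (\<lambda>(v, \<omega>). \<Prod>i<n. ?b (v i) \<omega>)"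
    proof (rule Q.integrable_const_bound)
      have "(\<lambda>x. (\<lambda>(v, \<omega>). ?b v \<omega>) (fst x i, snd x)) \<in> borel_measurable (?P \<Otimes>\<^sub>M G)" for i
        by (rule measurable_compose[OF _ m_b]) measurable
      then show "(\<lambda>(v, \<omega>). \<Prod>i<n. ?b (v i) \<omega>) \<in> borel_measurable (?P \<Otimes>\<^sub>M G)"
        unfolding split_beta' by (intro borel_measurable_prod) simp
      have "norm (\<Prod>i<n. ?b (v i) \<omega>) \<le> (\<Prod>i<n. \<Sum>m\<in>A. norm (\<alpha> m))" if "v \<in> space ?P" for v \<omega>
        unfolding prod_norm[symmetric] using spP[OF that] b_bound by (intro prod_mono) auto
      then show "AE x in ?P \<Otimes>\<^sub>M G. norm (case x of (v, \<omega>) \<Rightarrow> \<Prod>i<n. ?b (v i) \<omega>) \<le> (\<Prod>i<n. \<Sum>m\<in>A. norm (\<alpha> m))"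
        by (intro AE_I2) (auto simp: space_pair_measure)
    qed
  qed
  also have "\<dots> = (\<integral>v. trig_moment c \<Lambda> A \<alpha> s n (\<lambda>(i, j). v i \<bullet> v j) \<partial>?P)"
  proof (rule Bochner_Integration.integral_cong[OF refl])
    fix v assume "v \<in> space ?P"
    then have v: "v i \<in> cball 0 1" for i by (rule spP)
    have [measurable]: "l (v i) \<in> borel_measurable G" for i
      using gaussian_field_single(1)[OF field v] G.centered_gaussian_measurable by blast
    let ?M = "PiE {..<n} (\<lambda>_. A)"
    let ?C = "\<lambda>m. (\<Prod>i<n. \<alpha> (m i)) * of_real (\<Prod>i<n. ?e (v i) (m i))"
    \<comment> \<open>A product over replicas of sums over frequencies is a sum over all choices
      \<open>m\<close> of one frequency per replica.\<close>
    have "(\<integral>\<omega>. (\<Prod>i<n. ?b (v i) \<omega>) \<partial>G) =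
        (\<integral>\<omega>. (\<Sum>m\<in>?M. ?C m * cis (\<Sum>i<n. (s (m i) * \<Lambda>) * l (v i) \<omega>)) \<partial>G)"
      using A by (subst prod_sum_PiE) (auto simp: cis_sum prod.distrib mult_ac)
    also have "\<dots> = (\<Sum>m\<in>?M. \<integral>\<omega>. ?C m * cis (\<Sum>i<n. (s (m i) * \<Lambda>) * l (v i) \<omega>) \<partial>G)"
      by (intro Bochner_Integration.integral_sum G.integrable_const_bound[where B="norm (?C _)"] AE_I2)
        (auto simp: norm_mult)
    also have "\<dots> = (\<Sum>m\<in>?M. ?C m * of_real (exp (- (\<Sum>i<n. \<Sum>j<n. (s (m i) * \<Lambda>) * (s (m j) * \<Lambda>) * c (v i \<bullet> v j)) / 2)))"
      using v by (simp add: gaussian_field_char[OF field])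
    also have "\<dots> = trig_moment c \<Lambda> A \<alpha> s n (\<lambda>(i, j). v i \<bullet> v j)"
      unfolding trig_moment_def
    proof (intro sum.cong refl)
      fix m
      have "(\<Prod>i<n. ?e (v i) (m i)) * exp (- (\<Sum>i<n. \<Sum>j<n. (s (m i) * \<Lambda>) * (s (m j) * \<Lambda>) * c (v i \<bullet> v j)) / 2) =
          exp (- \<Lambda>\<^sup>2 / 2 * (\<Sum>i<n. \<Sum>j<n. s (m i) * s (m j) * (if i = j then 1 else c (v i \<bullet> v j))))"
      proof -
        \<comment> \<open>At \<open>j = i\<close> the damping
          \<open>1 - c ((norm (v i))\<^sup>2)\<close> completes \<open>c (v i \<bullet> v i)\<close>
          to 1; the other terms are unchanged.\<close>
        have "(\<Sum>j<n. s (m i) * s (m j) * (if i = j then 1 else c (v i \<bullet> v j))) =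
            (s (m i))\<^sup>2 * (1 - c ((norm (v i))\<^sup>2)) + (\<Sum>j<n. s (m i) * s (m j) * c (v i \<bullet> v j))" if "i < n" for i
        proof -
          have "(\<Sum>j<n. s (m i) * s (m j) * (if i = j then 1 else c (v i \<bullet> v j))) =
            (\<Sum>j<n. (if i = j then (s (m i))\<^sup>2 * (1 - c ((norm (v i))\<^sup>2)) else 0) + s (m i) * s (m j) * c (v i \<bullet> v j))"
            by (intro sum.cong) (auto simp: dot_square_norm power2_eq_square algebra_simps)
          also have "\<dots> = (s (m i))\<^sup>2 * (1 - c ((norm (v i))\<^sup>2)) + (\<Sum>j<n. s (m i) * s (m j) * c (v i \<bullet> v j))"
            using that by (simp add: sum.distrib)
          finally show ?thesis .
        qed
        then have "(\<Sum>i<n. \<Sum>j<n. s (m i) * s (m j) * (if i = j then 1 else c (v i \<bullet> v j))) =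
            (\<Sum>i<n. (s (m i))\<^sup>2 * (1 - c ((norm (v i))\<^sup>2))) + (\<Sum>i<n. \<Sum>j<n. s (m i) * s (m j) * c (v i \<bullet> v j))"
          by (simp add: sum.distrib)
        moreover have "(\<Sum>i<n. \<Sum>j<n. (s (m i) * \<Lambda>) * (s (m j) * \<Lambda>) * c (v i \<bullet> v j)) =
            \<Lambda>\<^sup>2 * (\<Sum>i<n. \<Sum>j<n. s (m i) * s (m j) * c (v i \<bullet> v j))"
          by (simp add: sum_distrib_left power2_eq_square mult_ac)
        moreover have "(\<Prod>i<n. ?e (v i) (m i)) = exp (- \<Lambda>\<^sup>2 / 2 * (\<Sum>i<n. (s (m i))\<^sup>2 * (1 - c ((norm (v i))\<^sup>2))))"
          by (simp add: exp_sum sum_distrib_left)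
        ultimately show ?thesis
          by (simp add: exp_add[symmetric] algebra_simps)
      qed
      then show "?C m * of_real (exp (- (\<Sum>i<n. \<Sum>j<n. (s (m i) * \<Lambda>) * (s (m j) * \<Lambda>) * c (v i \<bullet> v j)) / 2)) =
          (\<Prod>i<n. \<alpha> (m i)) * of_real (exp (- \<Lambda>\<^sup>2 / 2 * (\<Sum>i<n. \<Sum>j<n. s (m i) * s (m j) *
            (if i = j then 1 else c (case (i, j) of (i, j) \<Rightarrow> v i \<bullet> v j)))))"
        unfolding prod.case mult.assoc[of _ "of_real _" "of_real _"] of_real_mult[symmetric] by (rule arg_cong)
    qed
    finally show "(\<integral>\<omega>. (\<Prod>i<n. ?b (v i) \<omega>) \<partial>G) = \<dots>" .
  qed
  finally show ?thesis .
qed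

end

section \<open>Polynomials in a sine as trigonometric sums\<close>

text \<open>Euler's formula and the binomial theorem; the frequency \<open>2 * j - k\<close> is
  \<open>j - (k - j)\<close>.\<close>

lemma sin_power_eq_cis_sum:
  "of_real (sin x ^ k) =
    (\<Sum>j\<le>k. of_nat (k choose j) * (- 1) ^ (k - j) / (2 * \<i>) ^ k * cis ((2 * real j - real k) * x))"
proof -
  have "of_real (sin x) = (cis x + - cis (- x)) / (2 * \<i>)"
    by (simp add: complex_eq_iff)
  then have "of_real (sin x ^ k) = (cis x + - cis (- x)) ^ k / (2 * \<i>) ^ k"
    by (metis of_real_power power_divide)
  also have "(cis x + - cis (- x)) ^ k = (\<Sum>j\<le>k. of_nat (k choose j) * cis x ^ j * (- cis (- x)) ^ (k - j))"
    by (rule binomial_ring)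
  also have "\<dots> = (\<Sum>j\<le>k. of_nat (k choose j) * (- 1) ^ (k - j) * cis ((2 * real j - real k) * x))"
  proof (intro sum.cong refl)
    fix j assume "j \<in> {..k}"
    then have "real j * x + real (k - j) * (- x) = (2 * real j - real k) * x"
      by (simp add: of_nat_diff algebra_simps)
    then have "cis x ^ j * cis (- x) ^ (k - j) = cis ((2 * real j - real k) * x)"
      by (simp only: Complex.DeMoivre cis_mult)
    moreover have "(- cis (- x)) ^ (k - j) = (- 1) ^ (k - j) * cis (- x) ^ (k - j)"
      by (rule power_minus)
    ultimately show "of_nat (k choose j) * cis x ^ j * (- cis (- x)) ^ (k - j) =
        of_nat (k choose j) * (- 1) ^ (k - j) * cis ((2 * real j - real k) * x)"
      by (simp add: mult_ac)
  qed
  finally show ?thesis by (simp add: sum_divide_distrib)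
qed

lemma polynomial_sin_eq_cis_sum:
  obtains A :: "(nat \<times> nat) set" and \<alpha> :: "nat \<times> nat \<Rightarrow> complex" and s :: "nat \<times> nat \<Rightarrow> real"
  where "finite A" "\<And>x. of_real (\<Sum>k\<le>n. a k * sin (b * x) ^ k) = (\<Sum>m\<in>A. \<alpha> m * cis (s m * x))"
proof
  let ?A = "SIGMA k:{..n}. {..k}"
  show "finite ?A" by simp
  fix x
  have "of_real (\<Sum>k\<le>n. a k * sin (b * x) ^ k) = (\<Sum>k\<le>n. \<Sum>j\<le>k.
      (of_real (a k) * (of_nat (k choose j) * (- 1) ^ (k - j) / (2 * \<i>) ^ k)) * cis ((2 * real j - real k) * b * x))"
    unfolding of_real_sum of_real_mult sin_power_eq_cis_sum sum_distrib_left by (simp add: mult_ac)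
  also have "\<dots> = (\<Sum>m\<in>?A. (case m of (k, j) \<Rightarrow> of_real (a k) * (of_nat (k choose j) * (- 1) ^ (k - j) / (2 * \<i>) ^ k)) *
      cis ((case m of (k, j) \<Rightarrow> (2 * real j - real k) * b) * x))"
    by (subst sum.Sigma) (auto simp: split_beta')
  finally show "of_real (\<Sum>k\<le>n. a k * sin (b * x) ^ k) = \<dots>" .
qed

lemma real_polynomial_approx:
  fixes f :: "real \<Rightarrow> real"
  assumes "continuous_on {a..b} f" "0 < e"
  obtains p and n :: nat where "\<And>x. x \<in> {a..b} \<Longrightarrow> \<bar>f x - (\<Sum>k\<le>n. p k * x ^ k)\<bar> < e"
proof -
  obtain g where g: "real_polynomial_function g" "\<And>x. x \<in> {a..b} \<Longrightarrow> \<bar>f x - g x\<bar> < e"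
    using Stone_Weierstrass_real_polynomial_function[OF compact_Icc assms] by blast
  then obtain p n where "g = (\<lambda>x. \<Sum>k\<le>n. p k * x ^ k)"
    using real_polynomial_function_imp_sum by blast
  with g that show thesis by blast
qed

section \<open>Regularity of the replica moments as functions of the overlaps\<close>

lemma trig_moment_continuous:
  assumes "continuous_on UNIV c"
  shows "continuous_on UNIV (trig_moment c \<Lambda> A \<alpha> s n)"
proof -
  have "continuous_on UNIV (\<lambda>q :: overlap. if i = j then 1 else c (q (i, j)))" for i j
    by (cases "i = j")
      (auto intro!: continuous_on_compose2[OF assms] continuous_on_product_coordinates)
  then show ?thesis
    unfolding trig_moment_def[abs_def] by (intro continuous_intros)
qed

lemma trig_moment_measurable:
  assumes [measurable]: "c \<in> borel_measurable borel"
  shows "trig_moment c \<Lambda> A \<alpha> s n \<in> borel_measurable off_diag_space"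
proof -
  have [measurable]: "(\<lambda>q. if i = j then 1 else c (q (i, j))) \<in> borel_measurable off_diag_space" for i j :: nat
  proof (cases "i = j")
    case False
    then have "(\<lambda>q. q (i, j)) \<in> borel_measurable off_diag_space"
      unfolding off_diag_space_def by (intro measurable_component_singleton) (simp add: off_diag_def)
    from measurable_compose[OF this assms] show ?thesis
      using False by simp
  qed simp
  show ?thesis
    unfolding trig_moment_def[abs_def] by measurable
qed

text \<open>\<open>restrict\<close> puts \<open>undefined\<close> on the diagonal, and the case
  \<open>i = j\<close> of \<open>trig_moment\<close> masks exactly these entries.\<close>

lemma trig_moment_restrict: "trig_moment c \<Lambda> A \<alpha> s n (restrict q off_diag) = trig_moment c \<Lambda> A \<alpha> s n q"
  unfolding trig_moment_def by (intro sum.cong refl arg_cong2[where f="(*)"] arg_cong[where f="of_real"]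
    arg_cong[where f=exp]) (auto simp: off_diag_def)

text \<open>At an arbitrary \<open>q\<close> the quadratic form may be negative, so its exponential
  is estimated through absolute values and the bound \<open>C\<close>, not by 1.\<close>

lemma trig_moment_bounded:
  assumes C: "\<And>x. \<bar>c x\<bar> \<le> C" and A: "finite A"
  shows "\<exists>B. \<forall>q. norm (trig_moment c \<Lambda> A \<alpha> s n q) \<le> B"
proof (intro exI allI)
  let ?D = "max 1 C"
  fix q
  show "norm (trig_moment c \<Lambda> A \<alpha> s n q) \<le> (\<Sum>m\<in>PiE {..<n} (\<lambda>_. A).
    norm (\<Prod>i<n. \<alpha> (m i)) * exp (\<Lambda>\<^sup>2 / 2 * (\<Sum>i<n. \<Sum>j<n. \<bar>s (m i) * s (m j)\<bar> * ?D)))"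
    unfolding trig_moment_def
  proof (rule order_trans[OF norm_sum sum_mono])
    fix m
    have "\<bar>s (m i) * s (m j) * (if i = j then 1 else c (q (i, j)))\<bar> \<le> \<bar>s (m i) * s (m j)\<bar> * ?D" for i j
      using C[of "q (i, j)"] unfolding abs_mult[of "_ * _"] by (intro mult_left_mono) auto
    then have "\<bar>\<Sum>i<n. \<Sum>j<n. s (m i) * s (m j) * (if i = j then 1 else c (q (i, j)))\<bar> \<le>
        (\<Sum>i<n. \<Sum>j<n. \<bar>s (m i) * s (m j)\<bar> * ?D)"
      by (intro order_trans[OF sum_abs] sum_mono) 
    then have "- (\<Sum>i<n. \<Sum>j<n. s (m i) * s (m j) * (if i = j then 1 else c (q (i, j)))) \<le>
        (\<Sum>i<n. \<Sum>j<n. \<bar>s (m i) * s (m j)\<bar> * ?D)" by linarith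
    then have "- \<Lambda>\<^sup>2 / 2 * (\<Sum>i<n. \<Sum>j<n. s (m i) * s (m j) * (if i = j then 1 else c (q (i, j)))) \<le>
        \<Lambda>\<^sup>2 / 2 * (\<Sum>i<n. \<Sum>j<n. \<bar>s (m i) * s (m j)\<bar> * ?D)"
      using mult_left_mono[of "- (\<Sum>i<n. \<Sum>j<n. s (m i) * s (m j) * (if i = j then 1 else c (q (i, j))))" _ "\<Lambda>\<^sup>2 / 2"]
      by simp
    then show "norm ((\<Prod>i<n. \<alpha> (m i)) * of_real (exp (- \<Lambda>\<^sup>2 / 2 *
        (\<Sum>i<n. \<Sum>j<n. s (m i) * s (m j) * (if i = j then 1 else c (q (i, j))))))) \<le>
        norm (\<Prod>i<n. \<alpha> (m i)) * exp (\<Lambda>\<^sup>2 / 2 * (\<Sum>i<n. \<Sum>j<n. \<bar>s (m i) * s (m j)\<bar> * ?D))"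
      unfolding norm_mult norm_of_real by (intro mult_left_mono) auto
  qed
qed

section \<open>Folding the line by a triangle wave\<close>

text \<open>The triangle wave of period \<open>4 * R\<close> and height \<open>R\<close>. Writing it
  through \<open>arcsin\<close> displays it as a continuous function of a sine, to which polynomial
  approximation on \<open>[-1, 1]\<close> applies.\<close>

definition fold_real :: "real \<Rightarrow> real \<Rightarrow> real" where
  "fold_real R x = 2 * R / pi * arcsin (sin (pi / (2 * R) * x))"

lemma fold_real:
  assumes "0 < R"
  shows "\<bar>fold_real R x\<bar> \<le> R" "\<bar>fold_real R x\<bar> \<le> \<bar>x\<bar>" "\<bar>x\<bar> \<le> R \<Longrightarrow> fold_real R x = x"
proof -
  let ?y = "pi / (2 * R) * x"
  have "\<bar>arcsin (sin ?y)\<bar> \<le> pi / 2"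
    using arcsin_bounded[of "sin ?y"] by (intro abs_leI) auto
  then have "2 * R / pi * \<bar>arcsin (sin ?y)\<bar> \<le> 2 * R / pi * (pi / 2)"
    using assms by (intro mult_left_mono) auto
  then show 1: "\<bar>fold_real R x\<bar> \<le> R"
    using assms by (simp add: fold_real_def abs_mult)
  show 2: "fold_real R x = x" if "\<bar>x\<bar> \<le> R"
  proof -
    have "\<bar>?y\<bar> \<le> pi / 2"
      using that assms by (simp add: abs_mult field_simps)
    then have "arcsin (sin ?y) = ?y" unfolding abs_le_iff by (intro arcsin_sin) linarith+
    then show ?thesis using assms by (simp add: fold_real_def)
  qed
  show "\<bar>fold_real R x\<bar> \<le> \<bar>x\<bar>"
    using 1 2 by (cases "\<bar>x\<bar> \<le> R") auto
qed

lemma fold_real_measurable [measurable]: "fold_real R \<in> borel_measurable borel"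
proof -
  have "continuous_on UNIV (fold_real R)"
    unfolding fold_real_def[abs_def] by (intro continuous_intros) auto
  then show ?thesis by (rule borel_measurable_continuous_onI)
qed

section \<open>Approximation by functions of the overlaps\<close>

abbreviation with_noise :: "'a measure \<Rightarrow> ('a \<times> real) measure" where
  "with_noise \<mu> \<equiv> \<mu> \<Otimes>\<^sub>M density lborel std_normal_density"

text \<open>The noise is part of the point \<open>x = (v, z)\<close>, so that the comparison of
  logarithms applies with \<open>with_noise \<mu>\<close> as the measure that is integrated inside
  the logarithm.\<close>

definition smoothed_field ::
    "(real \<Rightarrow> real) \<Rightarrow> ('h::real_normed_vector \<Rightarrow> 'g \<Rightarrow> real) \<Rightarrow> real \<Rightarrow> 'h \<times> real \<Rightarrow> 'g \<Rightarrow> real" where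
  "smoothed_field c l \<Lambda> x \<omega> = \<Lambda> * l (fst x) \<omega> + \<Lambda> * snd x * sqrt (1 - c ((norm (fst x))\<^sup>2))"

context
  fixes G :: "'g measure" and c :: "real \<Rightarrow> real" and l :: "'h::{real_inner, polish_space} \<Rightarrow> 'g \<Rightarrow> real"
    and \<psi> :: "real \<Rightarrow> real" and L \<Lambda> :: real
  assumes field: "gaussian_field G c l"
    and c: "c \<in> borel_measurable borel" "\<And>v :: 'h. v \<in> cball 0 1 \<Longrightarrow> c ((norm v)\<^sup>2) \<le> 1"
    and c_nonneg: "\<And>v :: 'h. v \<in> cball 0 1 \<Longrightarrow> 0 \<le> c ((norm v)\<^sup>2)"
    and \<psi>: "continuous_on UNIV \<psi>" "\<And>x. \<bar>\<psi> x\<bar> \<le> L * \<bar>x\<bar>"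
    and \<Lambda>: "0 \<le> \<Lambda>" and L: "0 \<le> L"
begin

interpretation G: prob_space G
  using field by (rule gaussian_field_prob_space)

interpretation \<gamma>: prob_space "density lborel std_normal_density"
  by (rule prob_space_std_normal)

abbreviation "smoothed \<equiv> smoothed_field c l \<Lambda>"

lemma smoothed_measurable:
  "case_prod smoothed \<in> borel_measurable ((ball_space \<Otimes>\<^sub>M borel) \<Otimes>\<^sub>M G)"
proof -
  note c(1)[measurable]
  have "(\<lambda>x. (fst (fst x), snd x)) \<in> (ball_space \<Otimes>\<^sub>M borel) \<Otimes>\<^sub>M G \<rightarrow>\<^sub>M ball_space \<Otimes>\<^sub>M G"
    by measurable
  from measurable_compose[OF this gaussian_field_measurable[OF field]]
  have [measurable]: "(\<lambda>x. l (fst (fst x)) (snd x)) \<in> borel_measurable ((ball_space \<Otimes>\<^sub>M borel) \<Otimes>\<^sub>M G)"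
    by simp
  show ?thesis
    unfolding smoothed_field_def[abs_def] split_beta' by measurable
qed

context
  fixes \<mu> :: "'h measure"
  assumes \<mu>: "\<mu> \<in> space (prob_algebra ball_space)"
begin

interpretation \<mu>: prob_space \<mu>
  using \<mu> by (simp add: space_prob_algebra)

interpretation N: pair_prob_space \<mu> "density lborel std_normal_density" ..

lemma sets_with_noise: "sets (with_noise \<mu>) = sets (ball_space \<Otimes>\<^sub>M borel)"
  using \<mu> by (intro sets_pair_measure_cong) (auto simp: space_prob_algebra)

lemma snd_measurable_with_noise [measurable]: "snd \<in> borel_measurable (with_noise \<mu>)"
  using measurable_snd[of \<mu> "density lborel std_normal_density"] by simp

lemma smoothed_measurable' [measurable]: "case_prod smoothed \<in> borel_measurable ((with_noise \<mu>) \<Otimes>\<^sub>M G)"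
  using smoothed_measurable measurable_cong_sets[OF sets_pair_measure_cong[OF sets_with_noise refl] refl, of G] by blast

text \<open>Field and noise each have standard deviation at most \<open>\<Lambda>\<close> after
  scaling, and each contributes a factor \<open>2 * exp ((T * \<Lambda>)\<^sup>2 / 2)\<close>. The
  bound is the same for all \<open>\<mu>\<close>.\<close>

lemma smoothed_exp_bound:
  assumes "0 \<le> T"
  shows "(\<integral>\<^sup>+x. \<integral>\<^sup>+\<omega>. ennreal (exp (T * \<bar>smoothed x \<omega>\<bar>)) \<partial>G \<partial>with_noise \<mu>) \<le> ennreal (4 * exp ((T * \<Lambda>)\<^sup>2))"
proof -
  let ?t = "T * \<Lambda>"
  have "(\<integral>\<^sup>+\<omega>. ennreal (exp (T * \<bar>smoothed x \<omega>\<bar>)) \<partial>G) \<le> ennreal (2 * exp (?t\<^sup>2 / 2)) * ennreal (exp (?t * \<bar>snd x\<bar>))"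
    if "x \<in> space (with_noise \<mu>)" for x
  proof -
    obtain v z where x: "x = (v, z)" by (cases x)
    have v: "v \<in> cball 0 1"
      using that by (simp add: x space_pair_measure space_prob_algebra_ball_space[OF \<mu>])
    have g: "centered_gaussian G (l v)" and g2: "(\<integral>\<omega>. (l v \<omega>)\<^sup>2 \<partial>G) = c ((norm v)\<^sup>2)"
      using gaussian_field_single[OF field v] by auto
    have [measurable]: "l v \<in> borel_measurable G"
      using g by (rule G.centered_gaussian_measurable)
    have "T * \<bar>smoothed x \<omega>\<bar> \<le> ?t * \<bar>l v \<omega>\<bar> + ?t * \<bar>z\<bar>" for \<omega>
    proof -
      have s: "\<bar>sqrt (1 - c ((norm v)\<^sup>2))\<bar> \<le> 1"
        using c(2)[OF v] c_nonneg[OF v] by simp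
      have "\<bar>smoothed x \<omega>\<bar> \<le> \<Lambda> * \<bar>l v \<omega>\<bar> + \<Lambda> * \<bar>z\<bar> * \<bar>sqrt (1 - c ((norm v)\<^sup>2))\<bar>"
        using \<Lambda> by (auto simp: smoothed_field_def x abs_mult intro!: order_trans[OF abs_triangle_ineq])
      also have "\<dots> \<le> \<Lambda> * \<bar>l v \<omega>\<bar> + \<Lambda> * \<bar>z\<bar>"
        using mult_left_mono[OF s, of "\<Lambda> * \<bar>z\<bar>"] \<Lambda> by simp
      finally have "T * \<bar>smoothed x \<omega>\<bar> \<le> T * (\<Lambda> * \<bar>l v \<omega>\<bar> + \<Lambda> * \<bar>z\<bar>)"
        using \<open>0 \<le> T\<close> by (rule mult_left_mono)
      then show ?thesis by (simp add: algebra_simps)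
    qed
    then have "(\<integral>\<^sup>+\<omega>. ennreal (exp (T * \<bar>smoothed x \<omega>\<bar>)) \<partial>G) \<le>
        (\<integral>\<^sup>+\<omega>. ennreal (exp (?t * \<bar>l v \<omega>\<bar>)) * ennreal (exp (?t * \<bar>z\<bar>)) \<partial>G)"
      by (intro nn_integral_mono) (simp add: exp_add[symmetric] flip: ennreal_mult)
    also have "\<dots> = (\<integral>\<^sup>+\<omega>. ennreal (exp (?t * \<bar>l v \<omega>\<bar>)) \<partial>G) * ennreal (exp (?t * \<bar>z\<bar>))"
      by (rule nn_integral_multc) measurable
    also have "\<dots> \<le> ennreal (2 * exp (?t\<^sup>2 / 2)) * ennreal (exp (?t * \<bar>z\<bar>))"
    proof (intro mult_right_mono)
      have "?t\<^sup>2 * c ((norm v)\<^sup>2) / 2 \<le> ?t\<^sup>2 / 2" using c(2)[OF v] by (simp add: mult_left_le)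
      then show "(\<integral>\<^sup>+\<omega>. ennreal (exp (?t * \<bar>l v \<omega>\<bar>)) \<partial>G) \<le> ennreal (2 * exp (?t\<^sup>2 / 2))"
        using G.centered_gaussian_exp_abs[OF g, of ?t] g2 by (auto elim!: order_trans intro!: ennreal_leI)
    qed simp
    finally show ?thesis by (simp add: x)
  qed
  then have "(\<integral>\<^sup>+x. \<integral>\<^sup>+\<omega>. ennreal (exp (T * \<bar>smoothed x \<omega>\<bar>)) \<partial>G \<partial>with_noise \<mu>) \<le>
      (\<integral>\<^sup>+x. ennreal (2 * exp (?t\<^sup>2 / 2)) * ennreal (exp (?t * \<bar>snd x\<bar>)) \<partial>with_noise \<mu>)"
    by (rule nn_integral_mono)
  also have "\<dots> = ennreal (2 * exp (?t\<^sup>2 / 2)) * (\<integral>\<^sup>+x. ennreal (exp (?t * \<bar>snd x\<bar>)) \<partial>with_noise \<mu>)"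
    by (rule nn_integral_cmult) measurable
  also have "(\<integral>\<^sup>+x. ennreal (exp (?t * \<bar>snd x\<bar>)) \<partial>with_noise \<mu>) =
      (\<integral>\<^sup>+v. \<integral>\<^sup>+z. ennreal (exp (?t * \<bar>z\<bar>)) \<partial>density lborel std_normal_density \<partial>\<mu>)"
  proof -
    have "(\<lambda>x. ennreal (exp (?t * \<bar>snd x\<bar>))) \<in> borel_measurable (with_noise \<mu>)"
      by measurable
    from \<gamma>.nn_integral_fst[OF this] show ?thesis by simp
  qed
  also have "\<dots> = (\<integral>\<^sup>+z. ennreal (exp (?t * \<bar>z\<bar>)) \<partial>density lborel std_normal_density)"
    by (simp add: \<mu>.emeasure_space_1)
  also have "\<dots> \<le> ennreal (2 * exp (?t\<^sup>2 / 2))"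
    using \<gamma>.centered_gaussian_exp_abs[OF centered_gaussian_std_normal(1), of ?t] centered_gaussian_std_normal(2) by simp
  finally have "(\<integral>\<^sup>+x. \<integral>\<^sup>+\<omega>. ennreal (exp (T * \<bar>smoothed x \<omega>\<bar>)) \<partial>G \<partial>with_noise \<mu>) \<le>
      ennreal (2 * exp (?t\<^sup>2 / 2)) * ennreal (2 * exp (?t\<^sup>2 / 2))"
    by (simp add: mult_left_mono)
  also have "\<dots> = ennreal (4 * exp (?t\<^sup>2))"
    by (simp add: ennreal_mult[symmetric] exp_add[symmetric])
  finally show ?thesis .
qed

lemma smoothed_ln_fold:
  assumes R: "0 < R"
  shows "\<bar>\<integral>\<omega>. ln (\<integral>x. exp (\<psi> (smoothed x \<omega>)) \<partial>with_noise \<mu>) \<partial>G\<bar> \<le> 4 * exp ((2 * (L + 1) * \<Lambda>)\<^sup>2)"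
    and "integrable G (\<lambda>\<omega>. ln (\<integral>x. exp (\<psi> (fold_real R (smoothed x \<omega>))) \<partial>with_noise \<mu>))"
    and "\<bar>(\<integral>\<omega>. ln (\<integral>x. exp (\<psi> (smoothed x \<omega>)) \<partial>with_noise \<mu>) \<partial>G) -
      (\<integral>\<omega>. ln (\<integral>x. exp (\<psi> (fold_real R (smoothed x \<omega>))) \<partial>with_noise \<mu>) \<partial>G)\<bar> \<le>
      2 / R * (4 * exp ((2 * (L + 1) * \<Lambda>)\<^sup>2))"
proof -
  \<comment> \<open>\<open>L\<close> controls both exponents. The additional 1 provides a factor
    \<open>exp \<bar>y\<bar>\<close>, which exceeds \<open>R / 2\<close> wherever folding changes
    \<open>y\<close> and thus pays for the error factor \<open>2 / R\<close>.\<close>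
  define W where "W x \<omega> = (L + 1) * \<bar>smoothed x \<omega>\<bar>" for x \<omega>
  have [measurable]: "\<psi> \<in> borel_measurable borel"
    using \<psi>(1) by (rule borel_measurable_continuous_onI)
  have b1: "\<bar>\<psi> y\<bar> \<le> L * \<bar>x\<bar>" if "\<bar>y\<bar> \<le> \<bar>x\<bar>" for x y
    using \<psi>(2)[of y] mult_left_mono[OF that L] by linarith
  have b2: "\<bar>\<psi> y\<bar> \<le> (L + 1) * \<bar>x\<bar>" if "\<bar>y\<bar> \<le> \<bar>x\<bar>" for x y
    using b1[OF that] by (simp add: algebra_simps)
  have b3: "\<bar>exp (\<psi> y) - exp (\<psi> (fold_real R y))\<bar> \<le> 2 / R * exp ((L + 1) * \<bar>y\<bar>)" for y
  proof (cases "\<bar>y\<bar> \<le> R")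
    case False
    have "exp (\<psi> y) \<le> exp (L * \<bar>y\<bar>)" "exp (\<psi> (fold_real R y)) \<le> exp (L * \<bar>y\<bar>)"
      using b1[of y y] b1[OF fold_real(2)[OF R], of y] by auto
    then have "\<bar>exp (\<psi> y) - exp (\<psi> (fold_real R y))\<bar> \<le> exp (L * \<bar>y\<bar>)"
      by (smt (verit) exp_gt_zero)
    also have "\<dots> \<le> exp (L * \<bar>y\<bar>) * (2 / R * exp \<bar>y\<bar>)"
    proof -
      have "R \<le> \<bar>y\<bar>" "1 + \<bar>y\<bar> \<le> exp \<bar>y\<bar>" using False by (auto intro: exp_ge_add_one_self)
      then have "R \<le> 2 * exp \<bar>y\<bar>" using R by linarith
      then have "1 \<le> 2 / R * exp \<bar>y\<bar>" using R by (simp add: field_simps)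
      then have "exp (L * \<bar>y\<bar>) * 1 \<le> exp (L * \<bar>y\<bar>) * (2 / R * exp \<bar>y\<bar>)"
        by (intro mult_left_mono) auto
      then show ?thesis by (simp only: mult_1_right)
    qed
    also have "\<dots> = 2 / R * exp ((L + 1) * \<bar>y\<bar>)"
      by (simp add: algebra_simps exp_add)
    finally show ?thesis .
  qed (use R fold_real(3)[OF R] in simp)
  have K: "(\<integral>\<^sup>+x. \<integral>\<^sup>+\<omega>. ennreal (exp (2 * W x \<omega>)) \<partial>G \<partial>with_noise \<mu>) \<le> ennreal (4 * exp ((2 * (L + 1) * \<Lambda>)\<^sup>2))"
  proof -
    have "0 \<le> 2 * (L + 1)" using L by simp
    from smoothed_exp_bound[OF this] show ?thesis
      unfolding W_def mult.assoc[symmetric] .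
  qed
  have mW: "case_prod W \<in> borel_measurable ((with_noise \<mu>) \<Otimes>\<^sub>M G)"
    unfolding W_def by measurable
  have mU: "(\<lambda>(x, \<omega>). \<psi> (smoothed x \<omega>)) \<in> borel_measurable ((with_noise \<mu>) \<Otimes>\<^sub>M G)"
    by measurable
  have mV: "(\<lambda>(x, \<omega>). \<psi> (fold_real R (smoothed x \<omega>))) \<in> borel_measurable ((with_noise \<mu>) \<Otimes>\<^sub>M G)"
    by measurable
  have K0: "0 \<le> 4 * exp ((2 * (L + 1) * \<Lambda>)\<^sup>2)" by simp
  have U: "\<bar>\<psi> (smoothed x \<omega>)\<bar> \<le> W x \<omega>" for x \<omega>
    unfolding W_def by (rule b2) simp
  have V: "\<bar>\<psi> (fold_real R (smoothed x \<omega>))\<bar> \<le> W x \<omega>" for x \<omega>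
    unfolding W_def by (rule b2[OF fold_real(2)[OF R]])
  have UV: "\<bar>exp (\<psi> (smoothed x \<omega>)) - exp (\<psi> (fold_real R (smoothed x \<omega>)))\<bar> \<le> 2 / R * exp (W x \<omega>)" for x \<omega>
    unfolding W_def by (rule b3)
  \<comment> \<open>Comparing the folded exponent with itself, at error 0, extracts its
    integrability from the general lemma.\<close>
  have VV: "\<bar>exp (\<psi> (fold_real R (smoothed x \<omega>))) - exp (\<psi> (fold_real R (smoothed x \<omega>)))\<bar> \<le> 0 * exp (W x \<omega>)" for x \<omega>
    by simp
  note ln_bound = expectation_ln_integral_exp[OF N.P.prob_space_axioms G.prob_space_axioms _ _ mW _ _ _ K K0]
  show "\<bar>\<integral>\<omega>. ln (\<integral>x. exp (\<psi> (smoothed x \<omega>)) \<partial>with_noise \<mu>) \<partial>G\<bar> \<le> 4 * exp ((2 * (L + 1) * \<Lambda>)\<^sup>2)"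
    by (rule ln_bound(2)[OF mU mV U V UV])
  show "integrable G (\<lambda>\<omega>. ln (\<integral>x. exp (\<psi> (fold_real R (smoothed x \<omega>))) \<partial>with_noise \<mu>))"
    by (rule ln_bound(1)[OF mV mV V V VV])
  show "\<bar>(\<integral>\<omega>. ln (\<integral>x. exp (\<psi> (smoothed x \<omega>)) \<partial>with_noise \<mu>) \<partial>G) -
      (\<integral>\<omega>. ln (\<integral>x. exp (\<psi> (fold_real R (smoothed x \<omega>))) \<partial>with_noise \<mu>) \<partial>G)\<bar> \<le>
      2 / R * (4 * exp ((2 * (L + 1) * \<Lambda>)\<^sup>2))"
    by (rule ln_bound(3)[OF mU mV U V UV])
qed

end

text \<open>The function \<open>f\<close> is chosen before \<open>\<mu>\<close>, so the estimate
  survives averaging over the random sampling measure and becomes one about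
  \<open>P\<close>.\<close>

lemma smoothed_functional_approx:
  assumes cc: "continuous_on UNIV c" "\<And>x. \<bar>c x\<bar> \<le> C" and \<epsilon>: "0 < \<epsilon>"
  obtains f :: "overlap \<Rightarrow> real" and B where
    "continuous_on UNIV f" "\<And>q. \<bar>f q\<bar> \<le> B" "\<And>q. f (restrict q off_diag) = f q"
    "f \<in> borel_measurable off_diag_space"
    "\<And>\<mu>. \<mu> \<in> space (prob_algebra ball_space) \<Longrightarrow>
      \<bar>(\<integral>\<omega>. ln (\<integral>x. exp (\<psi> (smoothed x \<omega>)) \<partial>with_noise \<mu>) \<partial>G) -
        (\<integral>v. f (\<lambda>(i, j)\<in>off_diag. v i \<bullet> v j) \<partial>PiM (UNIV :: nat set) (\<lambda>_. \<mu>))\<bar> \<le> \<epsilon>"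
proof -
  define K where "K = 4 * exp ((2 * (L + 1) * \<Lambda>)\<^sup>2)"
  have K: "0 < K" by (simp add: K_def)
  \<comment> \<open>The error is split into thirds; this choice makes the folding error
    \<open>2 / R * K\<close> equal to \<open>\<epsilon> / 3\<close>.\<close>
  define R where "R = 6 * K / \<epsilon>"
  have R: "0 < R" using K \<epsilon> by (simp add: R_def)
  have RK: "2 / R * K = \<epsilon> / 3" using K \<epsilon> by (simp add: R_def)
  \<comment> \<open>Lower bound of \<open>exp (\<psi> y)\<close> for
    \<open>\<bar>y\<bar> \<le> R\<close>, hence of the folded integral.\<close>
  define m where "m = exp (- (L * R))"
  have m: "0 < m" by (simp add: m_def)
  \<comment> \<open>\<open>m / 2\<close> keeps the perturbed integral above \<open>m / 2\<close>.
    There \<open>ln\<close> has slope at most \<open>2 / m\<close>, so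
    \<open>\<epsilon> * m / 6\<close> makes the logarithm move by at most
    \<open>\<epsilon> / 3\<close>.\<close>
  define \<eta> where "\<eta> = min (m / 2) (\<epsilon> * m / 6)"
  have \<eta>: "0 < \<eta>" using m \<epsilon> by (simp add: \<eta>_def)
  have [measurable]: "\<psi> \<in> borel_measurable borel"
    using \<psi>(1) by (rule borel_measurable_continuous_onI)
  have "continuous_on {-1..1} (\<lambda>x. exp (\<psi> (2 * R / pi * arcsin x)))"
    by (intro continuous_on_exp continuous_on_compose2[OF \<psi>(1)] continuous_on_mult_left
        continuous_on_arcsin' subset_UNIV)
  from real_polynomial_approx[OF this \<eta>] obtain p and n :: nat where
    p: "\<And>x. x \<in> {-1..1} \<Longrightarrow> \<bar>exp (\<psi> (2 * R / pi * arcsin x)) - (\<Sum>k\<le>n. p k * x ^ k)\<bar> < \<eta>"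
    by blast
  define h where "h x = (\<Sum>k\<le>n. p k * sin (pi / (2 * R) * x) ^ k)" for x
  have [measurable]: "h \<in> borel_measurable borel"
    unfolding h_def[abs_def] by measurable
  have h: "\<bar>exp (\<psi> (fold_real R x)) - h x\<bar> \<le> \<eta>" for x
    using p[of "sin (pi / (2 * R) * x)"] by (simp add: fold_real_def h_def)
  obtain A :: "(nat \<times> nat) set" and \<alpha> s where A: "finite A" "\<And>x. of_real (h x) = (\<Sum>m\<in>A. \<alpha> m * cis (s m * x))"
    unfolding h_def using polynomial_sin_eq_cis_sum[where n=n and a=p and b="pi / (2 * R)"] by blast
  \<comment> \<open>Since \<open>\<eta> \<le> m / 2\<close>, the perturbed integral stays in
    \<open>{m / 2..M}\<close>, where \<open>ln\<close> is replaced by a polynomial at the cost of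
    the last third.\<close>
  define M where "M = exp (L * R) + m / 2"
  have cont: "continuous_on {m / 2..M} ln"
    using m by (intro continuous_on_ln continuous_on_id) auto
  have "0 < \<epsilon> / 3" using \<epsilon> by simp
  from real_polynomial_approx[OF cont this] obtain r and d :: nat where
    r: "\<And>x. x \<in> {m / 2..M} \<Longrightarrow> \<bar>ln x - (\<Sum>k\<le>d. r k * x ^ k)\<bar> < \<epsilon> / 3"
    by blast
  \<comment> \<open>The moments have complex type. Their integrals over replicas turn out to be the
    real moments of \<open>b\<close> below, so \<open>Re\<close> changes nothing after
    integration.\<close>
  define f where "f q = Re (\<Sum>k\<le>d. of_real (r k) * trig_moment c \<Lambda> A \<alpha> s k q)" for q
  have "\<exists>B. \<forall>q. norm (trig_moment c \<Lambda> A \<alpha> s k q) \<le> B" for k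
    using cc(2) A(1) by (rule trig_moment_bounded)
  then obtain B where B: "\<And>k q. norm (trig_moment c \<Lambda> A \<alpha> s k q) \<le> B k" by metis
  show thesis
  proof
    show "continuous_on UNIV f"
      unfolding f_def by (intro continuous_intros trig_moment_continuous cc)
    show "\<bar>f q\<bar> \<le> (\<Sum>k\<le>d. \<bar>r k\<bar> * B k)" for q
      unfolding f_def
      by (rule order_trans[OF abs_Re_le_cmod order_trans[OF norm_sum sum_mono]])
        (simp add: norm_mult mult_left_mono B)
    show "f (restrict q off_diag) = f q" for q
      by (simp add: f_def trig_moment_restrict)
    show f_meas: "f \<in> borel_measurable off_diag_space"
      using trig_moment_measurable[OF c(1)] unfolding f_def[abs_def] by measurable
    fix \<mu> :: "'h measure" assume \<mu>: "\<mu> \<in> space (prob_algebra ball_space)"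
    interpret \<mu>: prob_space \<mu> using \<mu> by (simp add: space_prob_algebra)
    interpret N: pair_prob_space \<mu> "density lborel std_normal_density" ..
    interpret Q: pair_prob_space G "with_noise \<mu>" ..
    note smoothed_measurable'[OF \<mu>, measurable]
    have [measurable]: "(\<lambda>(\<omega>, x). smoothed x \<omega>) \<in> borel_measurable (G \<Otimes>\<^sub>M with_noise \<mu>)"
      using measurable_compose[OF measurable_pair_swap' smoothed_measurable'[OF \<mu>]] by (simp add: split_beta')
    let ?P = "PiM (UNIV :: nat set) (\<lambda>_. \<mu>)"
    interpret P: product_prob_space "\<lambda>_. \<mu>" "UNIV :: nat set" ..
    define b where "b \<omega> = (\<integral>x. h (smoothed x \<omega>) \<partial>with_noise \<mu>)" for \<omega>
    define a where "a \<omega> = (\<integral>x. exp (\<psi> (fold_real R (smoothed x \<omega>))) \<partial>with_noise \<mu>)" for \<omega>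
    have [measurable]: "b \<in> borel_measurable G" "a \<in> borel_measurable G"
      unfolding b_def[abs_def] a_def[abs_def] by measurable
    have e_bounds: "m \<le> exp (\<psi> (fold_real R x))" "exp (\<psi> (fold_real R x)) \<le> exp (L * R)" for x
    proof -
      have "\<bar>\<psi> (fold_real R x)\<bar> \<le> L * R"
        using \<psi>(2)[of "fold_real R x"] mult_left_mono[OF fold_real(1)[OF R] L] by (rule order_trans)
      then show "m \<le> exp (\<psi> (fold_real R x))" "exp (\<psi> (fold_real R x)) \<le> exp (L * R)"
        by (auto simp: m_def abs_le_iff)
    qed
    have ab: "\<bar>a \<omega> - b \<omega>\<bar> \<le> \<eta>" "m \<le> a \<omega>" "a \<omega> \<le> exp (L * R)" if \<omega>: "\<omega> \<in> space G" for \<omega>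
    proof -
      have [measurable]: "(\<lambda>x. smoothed x \<omega>) \<in> borel_measurable (with_noise \<mu>)"
        using measurable_compose[OF measurable_Pair2' smoothed_measurable'[OF \<mu>]] \<omega> by simp
      have inta: "integrable (with_noise \<mu>) (\<lambda>x. exp (\<psi> (fold_real R (smoothed x \<omega>))))"
        using e_bounds by (intro N.P.integrable_const_bound[where B="exp (L * R)"]) auto
      have "\<bar>h x\<bar> \<le> exp (L * R) + \<eta>" for x
        using h[of x] e_bounds[of x] m by linarith
      then have intb: "integrable (with_noise \<mu>) (\<lambda>x. h (smoothed x \<omega>))"
        by (intro N.P.integrable_const_bound[where B="exp (L * R) + \<eta>"]) auto
      show "m \<le> a \<omega>"
        unfolding a_def using e_bounds by (intro N.P.integral_ge_const inta) auto
      show "a \<omega> \<le> exp (L * R)"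
        unfolding a_def using e_bounds by (intro N.P.integral_le_const inta) auto
      have "\<bar>a \<omega> - b \<omega>\<bar> = \<bar>\<integral>x. exp (\<psi> (fold_real R (smoothed x \<omega>))) - h (smoothed x \<omega>) \<partial>with_noise \<mu>\<bar>"
        unfolding a_def b_def using inta intb by simp
      also have "\<dots> \<le> (\<integral>x. \<bar>exp (\<psi> (fold_real R (smoothed x \<omega>))) - h (smoothed x \<omega>)\<bar> \<partial>with_noise \<mu>)"
        by (rule integral_abs_bound)
      also have "\<dots> \<le> \<eta>"
        using h inta intb by (intro N.P.integral_le_const) auto
      finally show "\<bar>a \<omega> - b \<omega>\<bar> \<le> \<eta>" .
    qed
    have b_bounds: "b \<omega> \<in> {m / 2..M}" if "\<omega> \<in> space G" for \<omega>
    proof -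
      have "\<eta> \<le> m / 2" by (simp add: \<eta>_def)
      then show ?thesis using ab[OF that] unfolding M_def atLeastAtMost_iff by linarith
    qed
    have ln_r: "\<bar>ln (a \<omega>) - (\<Sum>k\<le>d. r k * b \<omega> ^ k)\<bar> \<le> 2 * \<epsilon> / 3" if \<omega>: "\<omega> \<in> space G" for \<omega>
    proof -
      have "\<bar>ln (a \<omega>) - ln (b \<omega>)\<bar> \<le> \<bar>a \<omega> - b \<omega>\<bar> / (m / 2)"
        using ab[OF \<omega>] b_bounds[OF \<omega>] m by (intro abs_ln_diff_le) auto
      also have "\<dots> \<le> (\<epsilon> * m / 6) / (m / 2)"
        using ab[OF \<omega>] m by (intro divide_right_mono) (auto simp: \<eta>_def)
      also have "\<dots> = \<epsilon> / 3" using m by simp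
      finally show ?thesis using r[OF b_bounds[OF \<omega>]] by linarith
    qed
    have intb: "integrable G (\<lambda>\<omega>. b \<omega> ^ k)" for k
    proof (rule G.integrable_const_bound[where B="M ^ k"])
      have "norm (b \<omega>) \<le> M" if "\<omega> \<in> space G" for \<omega>
        using b_bounds[OF that] m by (simp add: abs_le_iff)
      then show "AE \<omega> in G. norm (b \<omega> ^ k) \<le> M ^ k"
        unfolding norm_power by (intro AE_I2 power_mono) auto
    qed simp
    have "of_real (\<integral>\<omega>. b \<omega> ^ k \<partial>G) = (\<integral>v. trig_moment c \<Lambda> A \<alpha> s k (\<lambda>(i, j). v i \<bullet> v j) \<partial>?P)" for k
    proof -
      have "of_real (\<integral>\<omega>. b \<omega> ^ k \<partial>G) = (\<integral>\<omega>. (\<integral>x. complex_of_real (h (smoothed x \<omega>)) \<partial>with_noise \<mu>) ^ k \<partial>G)"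
        by (simp only: integral_complex_of_real b_def[symmetric] of_real_power[symmetric])
      also have "\<dots> = (\<integral>\<omega>. (\<integral>(v, z). (\<Sum>m\<in>A. \<alpha> m * cis (s m * (\<Lambda> * l v \<omega> + \<Lambda> * z * sqrt (1 - c ((norm v)\<^sup>2)))))
          \<partial>with_noise \<mu>) ^ k \<partial>G)"
        by (simp only: A(2) smoothed_field_def split_beta')
      also have "\<dots> = (\<integral>v. trig_moment c \<Lambda> A \<alpha> s k (\<lambda>(i, j). v i \<bullet> v j) \<partial>?P)"
        by (rule expectation_power_trig[OF field c \<mu> A(1)])
      finally show ?thesis .
    qed
    moreover have int_t: "integrable ?P (\<lambda>v. trig_moment c \<Lambda> A \<alpha> s k (\<lambda>(i, j)\<in>off_diag. v i \<bullet> v j))" for k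
    proof (rule P.integrable_const_bound[where B="B k"])
      have "sets ?P = sets (PiM (UNIV :: nat set) (\<lambda>_. ball_space))"
        using \<mu> by (intro sets_PiM_cong) (auto simp: space_prob_algebra)
      then have "(\<lambda>v. \<lambda>(i, j)\<in>off_diag. v i \<bullet> v j) \<in> ?P \<rightarrow>\<^sub>M off_diag_space"
        using replica_inner_measurable measurable_cong_sets by blast
      from measurable_compose[OF this trig_moment_measurable[OF c(1)]]
      show "(\<lambda>v. trig_moment c \<Lambda> A \<alpha> s k (\<lambda>(i, j)\<in>off_diag. v i \<bullet> v j)) \<in> borel_measurable ?P" .
    qed (simp add: B)
    moreover have "trig_moment c \<Lambda> A \<alpha> s k (\<lambda>(i, j)\<in>off_diag. v i \<bullet> v j) =
        trig_moment c \<Lambda> A \<alpha> s k (\<lambda>(i, j). v i \<bullet> v j)" for k and v :: "nat \<Rightarrow> 'h"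
      by (rule trig_moment_restrict)
    ultimately have bk: "of_real (\<integral>\<omega>. b \<omega> ^ k \<partial>G) =
        (\<integral>v. trig_moment c \<Lambda> A \<alpha> s k (\<lambda>(i, j)\<in>off_diag. v i \<bullet> v j) \<partial>?P)" for k by simp
    have "(\<integral>v. f (\<lambda>(i, j)\<in>off_diag. v i \<bullet> v j) \<partial>?P) =
        Re (\<integral>v. (\<Sum>k\<le>d. of_real (r k) * trig_moment c \<Lambda> A \<alpha> s k (\<lambda>(i, j)\<in>off_diag. v i \<bullet> v j)) \<partial>?P)"
      unfolding f_def using int_t by (intro integral_Re) auto
    also have "(\<integral>v. (\<Sum>k\<le>d. of_real (r k) * trig_moment c \<Lambda> A \<alpha> s k (\<lambda>(i, j)\<in>off_diag. v i \<bullet> v j)) \<partial>?P) =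
        (\<Sum>k\<le>d. of_real (r k) * of_real (\<integral>\<omega>. b \<omega> ^ k \<partial>G))"
      unfolding bk using int_t by (subst Bochner_Integration.integral_sum) auto
    also have "Re \<dots> = (\<Sum>k\<le>d. r k * (\<integral>\<omega>. b \<omega> ^ k \<partial>G))" by simp
    also have "\<dots> = (\<integral>\<omega>. (\<Sum>k\<le>d. r k * b \<omega> ^ k) \<partial>G)"
      using intb by (subst Bochner_Integration.integral_sum) auto
    finally have f_eq: "(\<integral>v. f (\<lambda>(i, j)\<in>off_diag. v i \<bullet> v j) \<partial>?P) = (\<integral>\<omega>. (\<Sum>k\<le>d. r k * b \<omega> ^ k) \<partial>G)" .
    have inta: "integrable G (\<lambda>\<omega>. ln (a \<omega>))"
      unfolding a_def by (rule smoothed_ln_fold(2)[OF \<mu> R])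
    have "\<bar>(\<integral>\<omega>. ln (a \<omega>) \<partial>G) - (\<integral>\<omega>. (\<Sum>k\<le>d. r k * b \<omega> ^ k) \<partial>G)\<bar> =
        \<bar>\<integral>\<omega>. ln (a \<omega>) - (\<Sum>k\<le>d. r k * b \<omega> ^ k) \<partial>G\<bar>"
      using inta intb by simp
    also have "\<dots> \<le> (\<integral>\<omega>. \<bar>ln (a \<omega>) - (\<Sum>k\<le>d. r k * b \<omega> ^ k)\<bar> \<partial>G)"
      by (rule integral_abs_bound)
    also have "\<dots> \<le> 2 * \<epsilon> / 3"
      using inta intb ln_r by (intro G.integral_le_const) auto
    finally have "\<bar>(\<integral>\<omega>. ln (a \<omega>) \<partial>G) - (\<integral>\<omega>. (\<Sum>k\<le>d. r k * b \<omega> ^ k) \<partial>G)\<bar> \<le> 2 * \<epsilon> / 3" .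
    moreover have "\<bar>(\<integral>\<omega>. ln (\<integral>x. exp (\<psi> (smoothed x \<omega>)) \<partial>with_noise \<mu>) \<partial>G) - (\<integral>\<omega>. ln (a \<omega>) \<partial>G)\<bar> \<le> \<epsilon> / 3"
      using smoothed_ln_fold(3)[OF \<mu> R] unfolding K_def[symmetric] RK a_def .
    ultimately show "\<bar>(\<integral>\<omega>. ln (\<integral>x. exp (\<psi> (smoothed x \<omega>)) \<partial>with_noise \<mu>) \<partial>G) -
        (\<integral>v. f (\<lambda>(i, j)\<in>off_diag. v i \<bullet> v j) \<partial>?P)\<bar> \<le> \<epsilon>"
      unfolding f_eq by linarith
  qed
qed

end

section \<open>Continuity\<close>

lemma continuous_map_integral_rost:
  assumes f: "continuous_on overlap_matrices f"
  shows "continuous_map rost_topology euclideanreal (\<lambda>P. \<integral>q. f q \<partial>P)"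
proof -
  let ?C = "{f :: overlap \<Rightarrow> real. continuous_on overlap_matrices f}"
  have "continuous_map rost_topology euclideanreal ((\<lambda>\<phi>. \<phi> f) \<circ> (\<lambda>P. \<lambda>f\<in>?C. \<integral>q. f q \<partial>P))"
    unfolding rost_topology_def Let_def
    using f by (intro continuous_map_pullback continuous_map_product_projection) simp
  also have "(\<lambda>\<phi>. \<phi> f) \<circ> (\<lambda>P. \<lambda>f\<in>?C. \<integral>q. f q \<partial>P) = (\<lambda>P. \<integral>q. f q \<partial>P)"
    using f by (simp add: comp_def)
  finally show ?thesis .
qed

lemma topspace_rost_topology: "topspace rost_topology \<subseteq> {P. rost_law P}"
  unfolding rost_topology_def Let_def topspace_pullback_topology by blast

lemma continuous_map_real_uniform_approx:
  fixes g :: "'a \<Rightarrow> real"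
  assumes "\<And>\<epsilon>. 0 < \<epsilon> \<Longrightarrow> \<exists>h. continuous_map X euclideanreal h \<and> (\<forall>x\<in>topspace X. \<bar>g x - h x\<bar> \<le> \<epsilon>)"
  shows "continuous_map X euclideanreal g"
proof -
  have "\<exists>h. continuous_map X euclideanreal h \<and> (\<forall>x\<in>topspace X. \<bar>g x - h x\<bar> \<le> inverse (real (Suc n)))" for n
    by (rule assms) simp
  then obtain h where h: "\<And>n. continuous_map X euclideanreal (h n)"
    "\<And>n x. x \<in> topspace X \<Longrightarrow> \<bar>g x - h n x\<bar> \<le> inverse (real (Suc n))"
    by metis
  show ?thesis
  proof (rule Met_TC.continuous_map_uniform_limit[where f=h and F=sequentially, unfolded mtopology_is_euclidean])
    show "\<forall>\<^sub>F n in sequentially. continuous_map X euclideanreal (h n)"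
      by (simp add: h)
    fix \<epsilon> :: real assume "0 < \<epsilon>"
    then have "\<forall>\<^sub>F n in sequentially. inverse (real (Suc n)) < \<epsilon>"
      using LIMSEQ_inverse_real_of_nat by (rule order_tendstoD(2)[rotated])
    then show "\<forall>\<^sub>F n in sequentially. \<forall>x\<in>topspace X. g x \<in> UNIV \<and> dist (h n x) (g x) < \<epsilon>"
    proof eventually_elim
      case (elim n)
      then show ?case using h(2)[of _ n] by (fastforce simp: dist_real_def abs_minus_commute)
    qed
  qed simp
qed

section \<open>Diagonal values of the covariance\<close>

text \<open>To \<open>v\<close> is added a multiple of a unit vector \<open>e\<close> orthogonal to
  it, of length \<open>sqrt (1 - (norm v)\<^sup>2)\<close>. Infinite dimension gives a vector
  outside \<open>span {v}\<close>, whose component orthogonal to \<open>v\<close> yields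
  \<open>e\<close>.\<close>

lemma exists_unit_vector_inner_eq:
  fixes v :: "'h::real_inner"
  assumes infinite_dim: "\<not> (\<exists>B :: 'h set. finite B \<and> span B = UNIV)" and v: "v \<in> cball 0 1"
  obtains u where "norm u = 1" "u \<bullet> v = (norm v)\<^sup>2"
proof -
  obtain w where w: "w \<notin> span {v}" using infinite_dim by blast
  define w' where "w' = w - (w \<bullet> v / (v \<bullet> v)) *\<^sub>R v"
  have "w' \<noteq> 0"
    using w span_scale[OF span_base, of v "{v}" "w \<bullet> v / (v \<bullet> v)"] by (auto simp: w'_def)
  have orth: "w' \<bullet> v = 0"
    by (cases "v = 0") (auto simp: w'_def inner_diff_left)
  define e where "e = (1 / norm w') *\<^sub>R w'"
  have e: "norm e = 1" "e \<bullet> v = 0" using \<open>w' \<noteq> 0\<close> orth by (auto simp: e_def)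
  have v1: "(norm v)\<^sup>2 \<le> 1" using v by (simp add: power_le_one)
  define u where "u = v + sqrt (1 - (norm v)\<^sup>2) *\<^sub>R e"
  have "u \<bullet> v = (norm v)\<^sup>2" using e by (simp add: u_def inner_add_left dot_square_norm)
  moreover have "u \<bullet> u = 1"
  proof -
    have "u \<bullet> u = v \<bullet> v + (sqrt (1 - (norm v)\<^sup>2))\<^sup>2 * (e \<bullet> e)"
      using e by (simp only: u_def inner_add_left inner_add_right inner_scaleR_left inner_scaleR_right
        inner_commute[of v e] power2_eq_square) simp
    moreover have "e \<bullet> e = 1" using e by (simp add: dot_square_norm)
    ultimately show ?thesis using v1 by (simp only: real_sqrt_pow2 dot_square_norm diff_ge_0_iff_ge) simp
  qed
  then have "norm u = 1" by (simp add: norm_eq_1)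
  ultimately show thesis using that by blast
qed

text \<open>
  The choice \<open>u \<bullet> v = v \<bullet> v\<close> makes the quadratic form of \<open>c\<close> on the coefficients \<open>(1, -1)\<close> at \<open>(u, v)\<close>
  equal to \<open>c 1 - c ((norm v)\<^sup>2)\<close>.
\<close>

lemma pos_def_on_ball_le_1:
  assumes infinite_dim: "\<not> (\<exists>B :: 'h::real_inner set. finite B \<and> span B = UNIV)"
    and c: "pos_def_on_ball TYPE('h) c" "c 1 = 1" and v: "(v :: 'h) \<in> cball 0 1"
  shows "c ((norm v)\<^sup>2) \<le> 1"
proof -
  obtain u :: 'h where u: "norm u = 1" "u \<bullet> v = (norm v)\<^sup>2"
    using infinite_dim v by (rule exists_unit_vector_inner_eq)
  show ?thesis
  \<comment> \<open>For \<open>u = v\<close> the two-point set collapses and the test is void, but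
    then \<open>(norm v)\<^sup>2 = 1\<close>.\<close>
  proof (cases "u = v")
    case False
    have "0 \<le> (\<Sum>x\<in>{u, v}. \<Sum>y\<in>{u, v}. (if x = u then 1 else - 1) * (if y = u then 1 else - 1) * c (x \<bullet> y))"
      using c(1) u v by (auto simp: pos_def_on_ball_def)
    also have "\<dots> = 1 - c ((norm v)\<^sup>2)"
      using False u c(2) by (simp add: dot_square_norm inner_commute[of v u])
    finally show ?thesis by simp
  qed (use u c in simp)
qed

lemma C1_bounded_deriv_lipschitz:
  fixes \<psi> :: "real \<Rightarrow> real"
  assumes "\<psi> C1_differentiable_on UNIV" "bounded (range (deriv \<psi>))"
  obtains L where "0 \<le> L" "\<And>x y. \<bar>\<psi> x - \<psi> y\<bar> \<le> L * \<bar>x - y\<bar>"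
proof -
  obtain D where D: "\<And>x. (\<psi> has_vector_derivative D x) (at x)"
    using assms(1) by (auto simp: C1_differentiable_on_def)
  then have D': "(\<psi> has_field_derivative D x) (at x)" for x
    by (simp add: has_real_derivative_iff_has_vector_derivative)
  obtain L where L: "\<And>x. norm (deriv \<psi> x) \<le> L"
    using assms(2) by (auto simp: bounded_iff)
  have "\<bar>\<psi> x - \<psi> y\<bar> \<le> L * \<bar>x - y\<bar>" for x y
    using field_differentiable_bound[of UNIV \<psi> D L y x] D' L DERIV_imp_deriv[OF D']
    by (simp add: abs_minus_commute)
  moreover have "0 \<le> L" using L[of 0] norm_ge_zero order_trans by blast
  ultimately show thesis using that by blast
qed

text \<open>By Cauchy-Schwarz the covariance is evaluated on \<open>[-1, 1]\<close> only. This
  permits replacing \<open>c\<close> by an extension that is continuous and bounded on the whole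
  line.\<close>

lemma gaussian_field_cong:
  assumes "gaussian_field G c (l :: 'h::{real_inner, polish_space} \<Rightarrow> 'g \<Rightarrow> real)" "\<And>x. \<bar>x\<bar> \<le> 1 \<Longrightarrow> c x = c' x"
  shows "gaussian_field G c' l"
proof -
  have "\<bar>v \<bullet> w\<bar> \<le> 1" if "v \<in> cball 0 1" "w \<in> cball 0 1" for v w :: 'h
    using Cauchy_Schwarz_ineq2[of v w] mult_le_one[of "norm v" "norm w"] that by simp
  then show ?thesis using assms unfolding gaussian_field_def by metis
qed

section \<open>Measurability and integrability in the sampling measure\<close>

text \<open>Applied with \<open>\<kappa>\<close> attaching the noise to \<open>\<mu>\<close>, and
  with \<open>\<kappa>\<close> the identity for the series.\<close>

lemma integral_ln_integral_measurable:
  assumes f: "(\<lambda>(x, \<omega>). f x \<omega>) \<in> borel_measurable (M \<Otimes>\<^sub>M G)" and "prob_space G"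
    and \<kappa>: "\<kappa> \<in> L \<rightarrow>\<^sub>M prob_algebra M"
  shows "(\<lambda>\<mu>. \<integral>\<omega>. ln (\<integral>x. exp (f x \<omega> :: real) \<partial>\<kappa> \<mu>) \<partial>G) \<in> borel_measurable L"
proof -
  interpret G: prob_space G by fact
  have eq: "(\<integral>x. exp (f x \<omega>) \<partial>\<kappa> \<mu>) = enn2real (\<integral>\<^sup>+x. ennreal (exp (f x \<omega>)) \<partial>\<kappa> \<mu>)"
    if "\<mu> \<in> space L" "\<omega> \<in> space G" for \<mu> \<omega>
  \<comment> \<open>Valid also where the integral diverges: the Bochner integral is then 0, and so
    is \<open>enn2real\<close> of infinity.\<close>
  proof (rule integral_eq_nn_integral)
    have "sets (\<kappa> \<mu>) = sets M" using measurable_space[OF \<kappa> that(1)] by (simp add: space_prob_algebra)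
    moreover have "(\<lambda>x. exp (f x \<omega>)) \<in> borel_measurable M"
      using measurable_compose[OF measurable_Pair2' f] that(2) by simp
    ultimately show "(\<lambda>x. exp (f x \<omega>)) \<in> borel_measurable (\<kappa> \<mu>)"
      using measurable_cong_sets by blast
  qed simp
  have "(\<lambda>p. \<integral>\<^sup>+x. ennreal (exp (f x (snd p))) \<partial>\<kappa> (fst p)) \<in> borel_measurable (L \<Otimes>\<^sub>M G)"
  proof (rule nn_integral_measurable_subprob_algebra2)
    have "(\<lambda>p. (snd p, snd (fst p))) \<in> (L \<Otimes>\<^sub>M G) \<Otimes>\<^sub>M M \<rightarrow>\<^sub>M M \<Otimes>\<^sub>M G" by measurable
    from measurable_compose[OF this f]
    show "(\<lambda>(p, x). ennreal (exp (f x (snd p)))) \<in> borel_measurable ((L \<Otimes>\<^sub>M G) \<Otimes>\<^sub>M M)"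
      by (simp add: split_beta')
    show "(\<lambda>p. \<kappa> (fst p)) \<in> L \<Otimes>\<^sub>M G \<rightarrow>\<^sub>M subprob_algebra M"
      using measurable_compose[OF measurable_fst \<kappa>] by (rule measurable_prob_algebraD)
  qed
  then have "(\<lambda>(\<mu>, \<omega>). ln (enn2real (\<integral>\<^sup>+x. ennreal (exp (f x \<omega>)) \<partial>\<kappa> \<mu>))) \<in> borel_measurable (L \<Otimes>\<^sub>M G)"
    unfolding split_beta' by measurable
  then have "(\<lambda>\<mu>. \<integral>\<omega>. ln (enn2real (\<integral>\<^sup>+x. ennreal (exp (f x \<omega>)) \<partial>\<kappa> \<mu>)) \<partial>G) \<in> borel_measurable L"
    by (rule G.borel_measurable_lebesgue_integral)
  moreover have "(\<integral>\<omega>. ln (\<integral>x. exp (f x \<omega>) \<partial>\<kappa> \<mu>) \<partial>G) =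
      (\<integral>\<omega>. ln (enn2real (\<integral>\<^sup>+x. ennreal (exp (f x \<omega>)) \<partial>\<kappa> \<mu>)) \<partial>G)" if "\<mu> \<in> space L" for \<mu>
    using that by (intro Bochner_Integration.integral_cong) (simp_all add: eq)
  ultimately show ?thesis
    by (simp cong: measurable_cong)
qed

lemma sampling_measure_space:
  assumes "sampling_measure P J" "(q, \<mu>) \<in> space J"
  shows "\<mu> \<in> space (prob_algebra ball_space)"
  using assms sets_eq_imp_space_eq[of J "overlap_space \<Otimes>\<^sub>M prob_algebra ball_space"]
  by (auto simp: sampling_measure_def space_pair_measure)

lemma sampling_measure_integrable:
  assumes J: "sampling_measure P (J :: (overlap \<times> 'h::{real_inner, polish_space} measure) measure)"
    and f: "f \<in> borel_measurable (prob_algebra (ball_space :: 'h measure))"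
    and B: "\<And>\<mu>. \<mu> \<in> space (prob_algebra ball_space) \<Longrightarrow> \<bar>f \<mu> :: real\<bar> \<le> B"
  shows "integrable J (\<lambda>(q, \<mu>). f \<mu>)"
proof -
  interpret prob_space J using J by (simp add: sampling_measure_def)
  have "sets J = sets (overlap_space \<Otimes>\<^sub>M prob_algebra ball_space)" using J by (simp add: sampling_measure_def)
  moreover have "(\<lambda>(q, \<mu>). f \<mu>) \<in> borel_measurable (overlap_space \<Otimes>\<^sub>M prob_algebra ball_space)"
    using f unfolding split_beta' by measurable
  ultimately have "(\<lambda>(q, \<mu>). f \<mu>) \<in> borel_measurable J" using measurable_cong_sets by blast
  then show ?thesis
    using B sampling_measure_space[OF J] by (intro integrable_const_bound[where B=B]) auto
qed

text \<open>No regularity of the selection \<open>S\<close> is needed: the functional is uniformly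
  close to integrals of continuous functions against \<open>P\<close>, and these do not depend on
  \<open>S\<close>.\<close>

lemma P_functional_continuous:
  fixes l :: "'h::{real_inner, polish_space} \<Rightarrow> 'g \<Rightarrow> real"
    and S :: "overlap measure \<Rightarrow> (overlap \<times> 'h measure) measure"
  assumes infinite_dim: "\<not> (\<exists>B :: 'h set. finite B \<and> span B = UNIV)"
    and \<psi>: "\<psi> C1_differentiable_on UNIV" "bounded (range (deriv \<psi>))" "\<psi> 0 = 0"
    and c: "continuous_on {-1..1} c" "c 1 = 1" "pos_def_on_ball TYPE('h) c"
    and field: "gaussian_field G c l"
    and S: "\<And>P. rost_law P \<Longrightarrow> sampling_measure P (S P)"
    and \<Lambda>: "0 \<le> \<Lambda>"
  shows "continuous_map rost_topology euclideanreal (\<lambda>P. P_functional \<psi> c G l \<Lambda> (S P))"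
proof -
  \<comment> \<open>\<open>c\<close> is clamped outside \<open>[-1, 1]\<close>, as the approximating
    functions are defined on all of \<open>overlap\<close>, where entries may be any reals.\<close>
  define c' where "c' x = c (max (- 1) (min 1 x))" for x
  have c'_eq: "c x = c' x" if "\<bar>x\<bar> \<le> 1" for x
    using that by (simp add: c'_def max.absorb2 min.absorb2 abs_le_iff)
  have c'_cont: "continuous_on UNIV c'"
    unfolding c'_def[abs_def] by (intro continuous_on_compose2[OF c(1)] continuous_intros) auto
  then have c'_meas: "c' \<in> borel_measurable borel" by (rule borel_measurable_continuous_onI)
  have "bounded (c ` {-1..1})"
    by (intro compact_imp_bounded compact_continuous_image c(1)) simp
  then obtain C where C: "\<And>x. x \<in> {-1..1} \<Longrightarrow> norm (c x) \<le> C"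
    unfolding bounded_iff by blast
  have c'_bound: "\<bar>c' x\<bar> \<le> C" for x
    using C[of "max (- 1) (min 1 x)"] by (simp add: c'_def)
  have norm2: "\<bar>(norm v)\<^sup>2\<bar> \<le> 1" if "v \<in> cball 0 1" for v :: 'h
    using that by (simp add: power_le_one)
  have c'_le: "c' ((norm v)\<^sup>2) \<le> 1" if "v \<in> cball 0 1" for v :: 'h
    using pos_def_on_ball_le_1[OF infinite_dim c(3,2) that] c'_eq[OF norm2[OF that]] by simp
  have field': "gaussian_field G c' l"
    using field c'_eq by (rule gaussian_field_cong)
  \<comment> \<open>The value is the variance of the field at \<open>v\<close>.\<close>
  have c'_nonneg: "0 \<le> c' ((norm v)\<^sup>2)" if "v \<in> cball 0 1" for v :: 'h
    unfolding gaussian_field_single(2)[OF field' that, symmetric] by simp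
  obtain L where L: "0 \<le> L" "\<And>x y. \<bar>\<psi> x - \<psi> y\<bar> \<le> L * \<bar>x - y\<bar>"
    using C1_bounded_deriv_lipschitz[OF \<psi>(1,2)] by blast
  have \<psi>_bound: "\<bar>\<psi> x\<bar> \<le> L * \<bar>x\<bar>" for x using L(2)[of x 0] \<psi>(3) by simp
  have \<psi>_cont: "continuous_on UNIV \<psi>"
    using \<psi>(1) by (rule C1_differentiable_imp_continuous_on)
  interpret G: prob_space G using field by (rule gaussian_field_prob_space)
  let ?\<Phi> = "\<lambda>\<mu>. \<integral>\<omega>. ln (\<integral>x. exp (\<psi> (smoothed_field c' l \<Lambda> x \<omega>)) \<partial>(\<mu> \<Otimes>\<^sub>M density lborel std_normal_density)) \<partial>G"
  have P_eq: "P_functional \<psi> c G l \<Lambda> J = (\<integral>(q, \<mu>). ?\<Phi> \<mu> \<partial>J)" if J: "sampling_measure P J" for P J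
    unfolding P_functional_def
  proof (intro Bochner_Integration.integral_cong refl, clarify)
    fix q \<mu> assume "(q, \<mu>) \<in> space J"
    then have "space \<mu> = cball 0 1"
      using sampling_measure_space[OF J] space_prob_algebra_ball_space by blast
    then show "(\<integral>\<omega>. ln (\<integral>(v, z). exp (\<psi> (\<Lambda> * l v \<omega> + \<Lambda> * z * sqrt (1 - c ((norm v)\<^sup>2))))
        \<partial>(\<mu> \<Otimes>\<^sub>M density lborel std_normal_density)) \<partial>G) = ?\<Phi> \<mu>"
      using c'_eq[OF norm2]
      by (intro Bochner_Integration.integral_cong refl arg_cong[where f=ln])
        (auto simp: smoothed_field_def space_pair_measure)
  qed
  have \<Phi>_meas: "?\<Phi> \<in> borel_measurable (prob_algebra ball_space)"
  proof (rule integral_ln_integral_measurable)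
    have [measurable]: "\<psi> \<in> borel_measurable borel"
      using \<psi>_cont by (rule borel_measurable_continuous_onI)
    have "case_prod (smoothed_field c' l \<Lambda>) \<in> borel_measurable ((ball_space \<Otimes>\<^sub>M borel) \<Otimes>\<^sub>M G)"
      by (rule smoothed_measurable[OF field' c'_meas c'_le c'_nonneg \<psi>_cont \<psi>_bound \<Lambda> L(1)])
    from measurable_compose[OF this, of \<psi> borel]
    show "(\<lambda>(x, \<omega>). \<psi> (smoothed_field c' l \<Lambda> x \<omega>)) \<in> borel_measurable ((ball_space \<Otimes>\<^sub>M borel) \<Otimes>\<^sub>M G)"
      by (simp add: split_beta')
    show "(\<lambda>\<mu>. \<mu> \<Otimes>\<^sub>M density lborel std_normal_density) \<in> prob_algebra ball_space \<rightarrow>\<^sub>M prob_algebra (ball_space \<Otimes>\<^sub>M borel)"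
      by (intro measurable_pair_prob measurable_ident_sets refl measurable_const)
        (simp add: space_prob_algebra prob_space_std_normal)
  qed (rule G.prob_space_axioms)
  let ?K = "4 * exp ((2 * (L + 1) * \<Lambda>)\<^sup>2)"
  \<comment> \<open>The bound does not involve the folding radius, so \<open>R=1\<close> is an
    arbitrary admissible value.\<close>
  have \<Phi>_bound: "\<bar>?\<Phi> \<mu>\<bar> \<le> ?K" if "\<mu> \<in> space (prob_algebra ball_space)" for \<mu>
    using smoothed_ln_fold(1)[OF field' c'_meas c'_le c'_nonneg \<psi>_cont \<psi>_bound \<Lambda> L(1) that, where R=1] by simp
  show ?thesis
  proof (rule continuous_map_real_uniform_approx)
    fix \<epsilon> :: real assume "0 < \<epsilon>"
    obtain f B where f: "continuous_on UNIV f" "\<And>q. \<bar>f q\<bar> \<le> B" "\<And>q. f (restrict q off_diag) = f q"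
      "f \<in> borel_measurable off_diag_space"
      "\<And>\<mu>. \<mu> \<in> space (prob_algebra ball_space) \<Longrightarrow>
        \<bar>?\<Phi> \<mu> - (\<integral>v. f (\<lambda>(i, j)\<in>off_diag. v i \<bullet> v j) \<partial>PiM (UNIV :: nat set) (\<lambda>_. \<mu>))\<bar> \<le> \<epsilon>"
      using smoothed_functional_approx[OF field' c'_meas c'_le c'_nonneg \<psi>_cont \<psi>_bound \<Lambda> L(1) c'_cont c'_bound \<open>0 < \<epsilon>\<close>]
      by blast
    let ?F = "\<lambda>\<mu>. \<integral>v. f (\<lambda>(i, j)\<in>off_diag. v i \<bullet> v j) \<partial>PiM (UNIV :: nat set) (\<lambda>_. \<mu> :: 'h measure)"
    have "(\<lambda>\<mu> :: 'h measure. \<integral>q. f q \<partial>replica_law \<mu>) \<in> borel_measurable (prob_algebra ball_space)"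
      using measurable_compose[OF measurable_prob_algebraD[OF replica_law_measurable]
        integral_measurable_subprob_algebra[OF f(4)]] .
    then have F_meas: "?F \<in> borel_measurable (prob_algebra ball_space)"
      by (simp add: integral_replica_law[OF _ f(4)] cong: measurable_cong)
    have F_bound: "\<bar>?F \<mu>\<bar> \<le> ?K + \<epsilon>" if "\<mu> \<in> space (prob_algebra ball_space)" for \<mu>
      using \<Phi>_bound[OF that] f(5)[OF that] by linarith
    have "\<bar>P_functional \<psi> c G l \<Lambda> (S P) - (\<integral>q. f q \<partial>P)\<bar> \<le> \<epsilon>" if P: "rost_law P" for P
    proof -
      note J = S[OF P]
      interpret J: prob_space "S P" using J by (simp add: sampling_measure_def)
      have i1: "integrable (S P) (\<lambda>(q, \<mu>). ?\<Phi> \<mu>)"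
        using J \<Phi>_meas \<Phi>_bound by (rule sampling_measure_integrable)
      have i2: "integrable (S P) (\<lambda>(q, \<mu>). ?F \<mu>)"
        using J F_meas F_bound by (rule sampling_measure_integrable)
      have "(\<integral>q. f q \<partial>P) = (\<integral>(q, \<mu>). ?F \<mu> \<partial>S P)"
        using integral_off_diag[OF J f(4,2)] by (simp add: f(3))
      then have "\<bar>P_functional \<psi> c G l \<Lambda> (S P) - (\<integral>q. f q \<partial>P)\<bar> =
          \<bar>\<integral>x. (case x of (q, \<mu>) \<Rightarrow> ?\<Phi> \<mu>) - (case x of (q, \<mu>) \<Rightarrow> ?F \<mu>) \<partial>S P\<bar>"
        by (simp only: P_eq[OF J] Bochner_Integration.integral_diff[OF i1 i2])
      also have "\<dots> \<le> (\<integral>x. \<bar>(case x of (q, \<mu>) \<Rightarrow> ?\<Phi> \<mu>) - (case x of (q, \<mu>) \<Rightarrow> ?F \<mu>)\<bar> \<partial>S P)"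
        by (rule integral_abs_bound)
      also have "\<dots> \<le> \<epsilon>"
      proof (rule J.integral_le_const)
        show "integrable (S P) (\<lambda>x. \<bar>(case x of (q, \<mu>) \<Rightarrow> ?\<Phi> \<mu>) - (case x of (q, \<mu>) \<Rightarrow> ?F \<mu>)\<bar>)"
          by (intro integrable_abs Bochner_Integration.integrable_diff i1 i2)
        show "AE x in S P. \<bar>(case x of (q, \<mu>) \<Rightarrow> ?\<Phi> \<mu>) - (case x of (q, \<mu>) \<Rightarrow> ?F \<mu>)\<bar> \<le> \<epsilon>"
        proof (rule AE_I2)
          fix x assume "x \<in> space (S P)"
          then show "\<bar>(case x of (q, \<mu>) \<Rightarrow> ?\<Phi> \<mu>) - (case x of (q, \<mu>) \<Rightarrow> ?F \<mu>)\<bar> \<le> \<epsilon>"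
            using f(5)[OF sampling_measure_space[OF J, of "fst x" "snd x"]] by (simp add: split_beta')
        qed
      qed
      finally show ?thesis .
    qed
    moreover have "continuous_map rost_topology euclideanreal (\<lambda>P. \<integral>q. f q \<partial>P)"
      using f(1) continuous_on_subset by (intro continuous_map_integral_rost) blast
    ultimately show "\<exists>h. continuous_map rost_topology euclideanreal h \<and>
        (\<forall>P\<in>topspace rost_topology. \<bar>P_functional \<psi> c G l \<Lambda> (S P) - h P\<bar> \<le> \<epsilon>)"
      using topspace_rost_topology by blast
  qed
qed

section \<open>Almost sure convergence of independent series\<close>

text \<open>
  The walk stopped when it leaves \<open>[-\<epsilon>, \<epsilon>]\<close>: the \<open>i\<close>-th step is taken only if no partial sum of the
  first \<open>i\<close> steps has left the interval.
\<close>

definition inside :: "real \<Rightarrow> nat \<Rightarrow> (nat \<Rightarrow> real) \<Rightarrow> bool" where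
  "inside \<epsilon> n x \<longleftrightarrow> (\<forall>k\<le>n. \<bar>\<Sum>i<k. x i\<bar> \<le> \<epsilon>)"

definition stopped_sum :: "real \<Rightarrow> nat \<Rightarrow> (nat \<Rightarrow> real) \<Rightarrow> real" where
  "stopped_sum \<epsilon> n x = (\<Sum>i<n. if inside \<epsilon> i x then x i else 0)"

lemma inside_mono: "inside \<epsilon> n x \<Longrightarrow> k \<le> n \<Longrightarrow> inside \<epsilon> k x"
  by (auto simp: inside_def)

lemma stopped_sum_inside: "(\<And>i. i < n \<Longrightarrow> inside \<epsilon> i x) \<Longrightarrow> stopped_sum \<epsilon> n x = (\<Sum>i<n. x i)"
  by (simp add: stopped_sum_def)

text \<open>No step is taken from the first exit time on, so the stopped sum stays frozen at the
  partial sum that left the interval.\<close>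

lemma stopped_sum_exit:
  assumes "\<not> inside \<epsilon> n x"
  shows "\<epsilon> < \<bar>stopped_sum \<epsilon> n x\<bar>"
proof -
  define k where "k = (LEAST k. \<epsilon> < \<bar>\<Sum>i<k. x i\<bar>)"
  obtain k0 where k0: "k0 \<le> n" "\<epsilon> < \<bar>\<Sum>i<k0. x i\<bar>" using assms by (auto simp: inside_def not_le)
  have k: "\<epsilon> < \<bar>\<Sum>i<k. x i\<bar>" unfolding k_def by (rule LeastI, rule k0(2))
  have "k \<le> n" using k0 unfolding k_def by (meson Least_le order_trans)
  have below: "inside \<epsilon> i x" if "i < k" for i
    unfolding inside_def
  proof (intro allI impI)
    fix j assume "j \<le> i"
    then have "j < k" using that by simp
    then show "\<bar>\<Sum>i<j. x i\<bar> \<le> \<epsilon>" unfolding k_def using not_less_Least[of j] not_less by blast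
  qed
  have above: "\<not> inside \<epsilon> i x" if "k \<le> i" for i
    using that k by (auto simp: inside_def not_le)
  have "stopped_sum \<epsilon> n x = (\<Sum>i<k. if inside \<epsilon> i x then x i else 0)"
    unfolding stopped_sum_def using \<open>k \<le> n\<close> above by (intro sum.mono_neutral_right) auto
  also have "\<dots> = (\<Sum>i<k. x i)" using below by simp
  finally show ?thesis using k by simp
qed

lemma inside_measurable [measurable]:
  assumes [measurable]: "\<And>i. i < n \<Longrightarrow> (\<lambda>\<omega>. f \<omega> i) \<in> borel_measurable M"
  shows "Measurable.pred M (\<lambda>\<omega>. inside \<epsilon> n (f \<omega>))"
proof -
  have "Measurable.pred M (\<lambda>\<omega>. \<forall>k\<in>{..n}. \<bar>\<Sum>i<k. f \<omega> i\<bar> \<le> \<epsilon>)"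
    by (intro pred_intros_finite) auto
  then show ?thesis by (simp add: inside_def atMost_def)
qed

section \<open>Kolmogorov's maximal inequality and convergence\<close>

context prob_space
begin

text \<open>The stopped sum is a martingale whose second moment grows at step \<open>n\<close> by at
  most that of \<open>X n\<close>. Leaving the interval makes it exceed \<open>\<epsilon>\<close> at
  the final time, so Chebyshev's inequality there controls all earlier times.\<close>

lemma kolmogorov_maximal_inequality:
  fixes X :: "nat \<Rightarrow> 'a \<Rightarrow> real"
  assumes indep: "indep_vars (\<lambda>_. borel) X UNIV"
    and int2: "\<And>i. integrable M (\<lambda>\<omega>. (X i \<omega>)\<^sup>2)" and zero: "\<And>i. expectation (X i) = 0" and \<epsilon>: "0 < \<epsilon>"
  shows "prob {\<omega> \<in> space M. \<not> inside \<epsilon> n (\<lambda>i. X i \<omega>)} \<le> (\<Sum>i<n. expectation (\<lambda>\<omega>. (X i \<omega>)\<^sup>2)) / \<epsilon>\<^sup>2"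
proof -
  have [measurable]: "X i \<in> borel_measurable M" for i
    using indep by (simp add: indep_vars_def)
  have int1: "integrable M (X i)" for i
    using int2 by (rule square_integrable_imp_integrable[rotated]) simp
  let ?T = "\<lambda>n \<omega>. stopped_sum \<epsilon> n (\<lambda>i. X i \<omega>)"
  have [measurable]: "?T n \<in> borel_measurable M" for n
    unfolding stopped_sum_def by measurable
  have "integrable M (\<lambda>\<omega>. (?T n \<omega>)\<^sup>2) \<and> expectation (\<lambda>\<omega>. (?T n \<omega>)\<^sup>2) \<le> (\<Sum>i<n. expectation (\<lambda>\<omega>. (X i \<omega>)\<^sup>2))"
  proof (induction n)
    case 0
    then show ?case by (simp add: stopped_sum_def)
  next
    case (Suc n)
    \<comment> \<open>The factor of \<open>X n\<close> in the cross term of the squared sum. It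
      depends on coordinates below \<open>n\<close> only, hence is independent of the centered
      \<open>X n\<close>, and is bounded by \<open>\<epsilon>\<close>, hence integrable.\<close>
    define g where "g x = (if inside \<epsilon> n x then (\<Sum>i<n. x i) else 0)" for x
    let ?I = "\<lambda>\<omega>. if inside \<epsilon> n (\<lambda>i. X i \<omega>) then 1 else 0 :: real"
    have g_bound: "\<bar>g x\<bar> \<le> \<epsilon>" for x
      using \<epsilon> by (auto simp: g_def inside_def)
    have g_restrict: "g (restrict x {..<n}) = g x" for x
      by (auto simp: g_def inside_def intro!: arg_cong2[where f="(\<le>)"] arg_cong[where f=abs] sum.cong)
    have g_meas: "g \<in> borel_measurable (PiM {..<n} (\<lambda>_. borel))"
      unfolding g_def[abs_def] by measurable
    have "indep_var (PiM {..<n} (\<lambda>_. borel)) (\<lambda>\<omega>. restrict (\<lambda>i. X i \<omega>) {..<n})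
        (PiM {n} (\<lambda>_. borel)) (\<lambda>\<omega>. restrict (\<lambda>i. X i \<omega>) {n})"
      using indep by (rule indep_var_restrict) auto
    then have "indep_var borel (g \<circ> (\<lambda>\<omega>. restrict (\<lambda>i. X i \<omega>) {..<n})) borel ((\<lambda>x. x n) \<circ> (\<lambda>\<omega>. restrict (\<lambda>i. X i \<omega>) {n}))"
      using g_meas by (rule indep_var_compose) simp
    then have ind: "indep_var borel (\<lambda>\<omega>. g (\<lambda>i. X i \<omega>)) borel (X n)"
      by (simp add: comp_def g_restrict)
    have g_meas': "(\<lambda>\<omega>. g (\<lambda>i. X i \<omega>)) \<in> borel_measurable M"
      unfolding g_def by measurable
    have int_g: "integrable M (\<lambda>\<omega>. g (\<lambda>i. X i \<omega>))"
      using g_bound g_meas' by (intro integrable_const_bound[where B=\<epsilon>]) auto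
    have int_gX: "integrable M (\<lambda>\<omega>. g (\<lambda>i. X i \<omega>) * X n \<omega>)"
      using ind int_g int1 by (rule indep_var_integrable)
    have gX: "expectation (\<lambda>\<omega>. g (\<lambda>i. X i \<omega>) * X n \<omega>) = 0"
      using indep_var_lebesgue_integral[OF ind int_g int1] zero by simp
    have int_I: "integrable M (\<lambda>\<omega>. ?I \<omega> * (X n \<omega>)\<^sup>2)"
      by (rule Bochner_Integration.integrable_bound[OF int2[of n]]) auto
    have eq: "(?T (Suc n) \<omega>)\<^sup>2 = (?T n \<omega>)\<^sup>2 + 2 * (g (\<lambda>i. X i \<omega>) * X n \<omega>) + ?I \<omega> * (X n \<omega>)\<^sup>2" for \<omega>
    proof (cases "inside \<epsilon> n (\<lambda>i. X i \<omega>)")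
      case True
      then have "?T n \<omega> = (\<Sum>i<n. X i \<omega>)" by (intro stopped_sum_inside) (auto intro: inside_mono)
      then show ?thesis using True by (simp add: stopped_sum_def g_def power2_eq_square algebra_simps)
    qed (simp add: stopped_sum_def g_def)
    have "expectation (\<lambda>\<omega>. ?I \<omega> * (X n \<omega>)\<^sup>2) \<le> expectation (\<lambda>\<omega>. (X n \<omega>)\<^sup>2)"
      by (intro integral_mono int_I int2) auto
    then show ?case
      unfolding eq using Suc int_gX gX int_I by simp
  qed
  then have T: "integrable M (\<lambda>\<omega>. (?T n \<omega>)\<^sup>2)"
    "expectation (\<lambda>\<omega>. (?T n \<omega>)\<^sup>2) \<le> (\<Sum>i<n. expectation (\<lambda>\<omega>. (X i \<omega>)\<^sup>2))" by auto
  have "prob {\<omega> \<in> space M. \<not> inside \<epsilon> n (\<lambda>i. X i \<omega>)} \<le> prob {\<omega> \<in> space M. \<epsilon> \<le> \<bar>?T n \<omega>\<bar>}"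
    using stopped_sum_exit by (intro finite_measure_mono) (auto intro: less_imp_le)
  also have "\<dots> \<le> expectation (\<lambda>\<omega>. (?T n \<omega>)\<^sup>2) / \<epsilon>\<^sup>2"
    using T(1) \<epsilon> by (intro second_moment_method) auto
  also have "\<dots> \<le> (\<Sum>i<n. expectation (\<lambda>\<omega>. (X i \<omega>)\<^sup>2)) / \<epsilon>\<^sup>2"
    using T(2) by (intro divide_right_mono) auto
  finally show ?thesis .
qed

text \<open>The maximal inequality for the sequence shifted by \<open>m\<close> bounds the
  probability that the sums after \<open>m\<close> ever move by more than \<open>\<epsilon>\<close>
  by a tail of the variance series. Letting \<open>m\<close> grow gives the Cauchy property.\<close>

lemma AE_summable_indep:
  fixes X :: "nat \<Rightarrow> 'a \<Rightarrow> real"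
  assumes indep: "indep_vars (\<lambda>_. borel) X UNIV"
    and int2: "\<And>i. integrable M (\<lambda>\<omega>. (X i \<omega>)\<^sup>2)" and zero: "\<And>i. expectation (X i) = 0"
    and sum: "summable (\<lambda>i. expectation (\<lambda>\<omega>. (X i \<omega>)\<^sup>2))"
  shows "AE \<omega> in M. summable (\<lambda>i. X i \<omega>)"
proof -
  let ?v = "\<lambda>i. expectation (\<lambda>\<omega>. (X i \<omega>)\<^sup>2)"
  have [measurable]: "X i \<in> borel_measurable M" for i
    using indep by (simp add: indep_vars_def)
  have exit: "prob {\<omega> \<in> space M. \<exists>n. \<not> inside \<epsilon> n (\<lambda>i. X (i + m) \<omega>)} \<le> (\<Sum>i. ?v (i + m)) / \<epsilon>\<^sup>2"
    if \<epsilon>: "0 < \<epsilon>" for \<epsilon> m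
  proof -
    let ?A = "\<lambda>n. {\<omega> \<in> space M. \<not> inside \<epsilon> n (\<lambda>i. X (i + m) \<omega>)}"
    have ind: "indep_vars (\<lambda>_. borel) (\<lambda>i. X (i + m)) UNIV"
    proof -
      \<comment> \<open>Reindexing: the shifted variables are single coordinates over the disjoint
        blocks \<open>{j + m}\<close>.\<close>
      have "indep_vars (\<lambda>j. PiM {j + m} (\<lambda>_. borel)) (\<lambda>j \<omega>. restrict (\<lambda>i. X i \<omega>) {j + m}) UNIV"
        using indep by (rule indep_vars_restrict) (auto simp: disjoint_family_on_def)
      then have "indep_vars (\<lambda>_. borel) (\<lambda>j \<omega>. (restrict (\<lambda>i. X i \<omega>) {j + m}) (j + m)) UNIV"
        by (rule indep_vars_compose2) simp
      then show ?thesis by simp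
    qed
    have "(\<lambda>n. prob (?A n)) \<longlonglongrightarrow> prob (\<Union>n. ?A n)"
      using inside_mono by (intro finite_Lim_measure_incseq) (auto simp: incseq_def)
    moreover have "prob (?A n) \<le> (\<Sum>i. ?v (i + m)) / \<epsilon>\<^sup>2" for n
    proof -
      have "prob (?A n) \<le> (\<Sum>i<n. ?v (i + m)) / \<epsilon>\<^sup>2"
        using ind int2 zero \<epsilon> by (rule kolmogorov_maximal_inequality)
      also have "\<dots> \<le> (\<Sum>i. ?v (i + m)) / \<epsilon>\<^sup>2"
        using summable_ignore_initial_segment[OF sum, of m] by (intro divide_right_mono sum_le_suminf) auto
      finally show ?thesis .
    qed
    ultimately have "prob (\<Union>n. ?A n) \<le> (\<Sum>i. ?v (i + m)) / \<epsilon>\<^sup>2"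
      by (intro LIMSEQ_le_const2) auto
    also have "(\<Union>n. ?A n) = {\<omega> \<in> space M. \<exists>n. \<not> inside \<epsilon> n (\<lambda>i. X (i + m) \<omega>)}" by auto
    finally show ?thesis .
  qed
  have "AE \<omega> in M. \<exists>m. \<forall>n. inside \<epsilon> n (\<lambda>i. X (i + m) \<omega>)" if \<epsilon>: "0 < \<epsilon>" for \<epsilon>
  proof -
    \<comment> \<open>The event that every tail leaves \<open>[-\<epsilon>, \<epsilon>]\<close>. It
      lies in the exit event of each single \<open>m\<close>, so all tail bounds apply to it at
      once.\<close>
    let ?B = "{\<omega> \<in> space M. \<forall>m. \<exists>n. \<not> inside \<epsilon> n (\<lambda>i. X (i + m) \<omega>)}"
    have "prob ?B \<le> (\<Sum>i. ?v (i + m)) / \<epsilon>\<^sup>2" for m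
      by (rule order_trans[OF finite_measure_mono exit[OF \<epsilon>, of m]]) auto
    moreover have "(\<lambda>m. (\<Sum>i. ?v (i + m)) / \<epsilon>\<^sup>2) \<longlonglongrightarrow> 0 / \<epsilon>\<^sup>2"
      using suminf_exist_split2[OF sum] \<epsilon> by (intro tendsto_divide tendsto_const) auto
    ultimately have "prob ?B \<le> 0 / \<epsilon>\<^sup>2"
      by (intro LIMSEQ_le_const) auto
    then have "prob ?B = 0" using measure_nonneg[of M ?B] by simp
    then have "AE \<omega> in M. \<omega> \<notin> ?B" by (subst (asm) prob_eq_0) auto
    then show ?thesis using AE_space by eventually_elim auto
  qed
  then have "AE \<omega> in M. \<forall>j. \<exists>m. \<forall>n. inside (inverse (real (Suc j))) n (\<lambda>i. X (i + m) \<omega>)"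
    unfolding AE_all_countable by simp
  then show ?thesis
  proof eventually_elim
    case (elim \<omega>)
    have "Cauchy (\<lambda>n. \<Sum>i<n. X i \<omega>)"
    proof (rule metric_CauchyI)
      fix e :: real assume "0 < e"
      then obtain j where j: "inverse (real (Suc j)) < e / 2" using reals_Archimedean[of "e / 2"] by auto
      obtain m where m: "\<And>n. inside (inverse (real (Suc j))) n (\<lambda>i. X (i + m) \<omega>)" using elim by blast
      have "\<bar>(\<Sum>i<n. X i \<omega>) - (\<Sum>i<m. X i \<omega>)\<bar> < e / 2" if "m \<le> n" for n
      proof -
        have "(\<Sum>i<n. X i \<omega>) - (\<Sum>i<m. X i \<omega>) = (\<Sum>i<n - m. X (i + m) \<omega>)"
          using that sum_diff_nat_ivl[of 0 m n "\<lambda>i. X i \<omega>"]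
            sum.shift_bounds_nat_ivl[of "\<lambda>i. X i \<omega>" 0 m "n - m"]
          by (simp add: atLeast0LessThan)
        also have "\<bar>\<dots>\<bar> \<le> inverse (real (Suc j))"
          using m[of "n - m"] by (auto simp: inside_def)
        finally show ?thesis using j by simp
      qed
      then have "dist (\<Sum>i<n. X i \<omega>) (\<Sum>i<n'. X i \<omega>) < e" if "m \<le> n" "m \<le> n'" for n n'
        using that by (smt (verit) dist_real_def field_sum_of_halves)
      then show "\<exists>m. \<forall>n\<ge>m. \<forall>n'\<ge>m. dist (\<Sum>i<n. X i \<omega>) (\<Sum>i<n'. X i \<omega>) < e" by blast
    qed
    then show ?case by (simp add: summable_iff_convergent Cauchy_convergent_iff)
  qed
qed

end

section \<open>Series of independent fields\<close>

lemma ell2_diff_scaled: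
  assumes "\<Lambda> \<in> ell2" "\<Lambda>' \<in> ell2"
  shows "(\<lambda>p. (\<Lambda> p - \<Lambda>' p) / d) \<in> ell2"
proof -
  have le: "(x - y)\<^sup>2 \<le> 2 * (x\<^sup>2 + y\<^sup>2)" for x y :: real
    using zero_le_power2[of "x + y"] by (simp add: power2_eq_square algebra_simps)
  have "summable (\<lambda>p. 2 * ((\<Lambda> p)\<^sup>2 + (\<Lambda>' p)\<^sup>2))"
    using assms by (intro summable_mult summable_add) (simp_all add: ell2_def)
  then have "summable (\<lambda>p. (\<Lambda> p - \<Lambda>' p)\<^sup>2)"
    by (rule summable_comparison_test'[where N=0]) (simp only: real_norm_def abs_power2 le)
  then show ?thesis
    by (simp add: ell2_def power_divide summable_divide)
qed

lemma suminf_dominated: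
  fixes f g :: "nat \<Rightarrow> real"
  assumes "\<And>p. 0 \<le> f p" "\<And>p. f p \<le> g p" "summable g"
  shows "summable f" "0 \<le> suminf f" "suminf f \<le> suminf g"
proof -
  show f: "summable f" using assms by (intro summable_comparison_test'[OF assms(3)]) auto
  show "0 \<le> suminf f" using assms f by (intro suminf_nonneg) auto
  show "suminf f \<le> suminf g" using assms f by (intro suminf_le) auto
qed

definition field_series :: "(nat \<Rightarrow> 'h \<Rightarrow> 'g \<Rightarrow> real) \<Rightarrow> (nat \<Rightarrow> real) \<Rightarrow> 'h \<Rightarrow> 'g \<Rightarrow> real" where
  "field_series l \<Lambda> v \<omega> = (\<Sum>p. \<Lambda> p * l p v \<omega>)"

context
  fixes G :: "'g measure" and l :: "nat \<Rightarrow> 'h::{real_inner, polish_space} \<Rightarrow> 'g \<Rightarrow> real"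
  assumes fields: "independent_power_fields G l"
begin

lemma power_field: "gaussian_field G (\<lambda>x. x ^ p) (l p)"
  using fields by (simp add: independent_power_fields_def)

interpretation G: prob_space G
  using power_field by (rule gaussian_field_prob_space)

lemma power_field_indep:
  assumes "v \<in> cball 0 1"
  shows "G.indep_vars (\<lambda>_. borel) (\<lambda>p \<omega>. \<Lambda> p * l p v \<omega>) UNIV"
proof -
  have "G.indep_vars (\<lambda>_. PiM (cball 0 1) (\<lambda>_. borel)) (\<lambda>p \<omega>. \<lambda>v\<in>cball 0 1. l p v \<omega>) UNIV"
    using fields by (simp add: independent_power_fields_def)
  then have "G.indep_vars (\<lambda>_. borel) (\<lambda>p \<omega>. \<Lambda> p * (\<lambda>v\<in>cball 0 1. l p v \<omega>) v) UNIV"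
    by (rule G.indep_vars_compose2) (intro borel_measurable_times borel_measurable_const measurable_component_singleton assms)
  then show ?thesis using assms by simp
qed

lemma scaled_power_field:
  assumes "v \<in> cball 0 1"
  shows "centered_gaussian G (\<lambda>\<omega>. \<Lambda> p * l p v \<omega>)"
    and "(\<integral>\<omega>. (\<Lambda> p * l p v \<omega>)\<^sup>2 \<partial>G) \<le> (\<Lambda> p)\<^sup>2" and "0 \<le> (\<integral>\<omega>. (\<Lambda> p * l p v \<omega>)\<^sup>2 \<partial>G)"
proof -
  show "centered_gaussian G (\<lambda>\<omega>. \<Lambda> p * l p v \<omega>)"
    using centered_gaussian_cmult[OF G.prob_space_axioms gaussian_field_single(1)[OF power_field assms]] .
  have "(\<integral>\<omega>. (\<Lambda> p * l p v \<omega>)\<^sup>2 \<partial>G) = (\<Lambda> p)\<^sup>2 * ((norm v)\<^sup>2) ^ p"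
    using gaussian_field_single(2)[OF power_field assms, of p] by (simp add: power_mult_distrib)
  moreover have "((norm v)\<^sup>2) ^ p \<le> 1" using assms by (simp add: power_le_one)
  ultimately show "(\<integral>\<omega>. (\<Lambda> p * l p v \<omega>)\<^sup>2 \<partial>G) \<le> (\<Lambda> p)\<^sup>2"
    using mult_left_mono[of "((norm v)\<^sup>2) ^ p" 1 "(\<Lambda> p)\<^sup>2"] by simp
qed simp

text \<open>The null set depends on \<open>v\<close>. This suffices, since the expectation over
  \<open>G\<close> is always estimated at a fixed \<open>v\<close> first.\<close>

lemma field_series_converges:
  assumes "\<Lambda> \<in> ell2" "v \<in> cball 0 1"
  shows "AE \<omega> in G. summable (\<lambda>p. \<Lambda> p * l p v \<omega>)"
proof (rule G.AE_summable_indep[OF power_field_indep[OF assms(2)]])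
  show "integrable G (\<lambda>\<omega>. (\<Lambda> i * l i v \<omega>)\<^sup>2)" for i
    by (intro G.centered_gaussian_integrable_power2 scaled_power_field assms)
  show "(\<integral>\<omega>. \<Lambda> i * l i v \<omega> \<partial>G) = 0" for i
    by (intro G.centered_gaussian_expectation_0 scaled_power_field assms)
  show "summable (\<lambda>i. \<integral>\<omega>. (\<Lambda> i * l i v \<omega>)\<^sup>2 \<partial>G)"
  proof (rule suminf_dominated(1))
    show "summable (\<lambda>p. (\<Lambda> p)\<^sup>2)" using assms(1) by (simp add: ell2_def)
  qed (intro scaled_power_field assms)+
qed

lemma power_field_measurable: "v \<in> cball 0 1 \<Longrightarrow> l p v \<in> borel_measurable G"
  using gaussian_field_single(1)[OF power_field] G.centered_gaussian_measurable by blast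

text \<open>Independence factors the expectation, and the variance
  \<open>(\<Lambda> p)\<^sup>2 * norm v ^ (2 * p)\<close> of each term is at most
  \<open>(\<Lambda> p)\<^sup>2\<close>; the bound depends neither on \<open>n\<close> nor on
  \<open>v\<close>.\<close>

lemma partial_sum_exp:
  assumes \<Lambda>: "\<Lambda> \<in> ell2" and v: "v \<in> cball 0 1"
  shows "(\<integral>\<^sup>+\<omega>. ennreal (exp (t * (\<Sum>p<n. \<Lambda> p * l p v \<omega>))) \<partial>G) \<le> ennreal (exp (t\<^sup>2 * (\<Sum>p. (\<Lambda> p)\<^sup>2) / 2))"
proof -
  let ?X = "\<lambda>p \<omega>. \<Lambda> p * l p v \<omega>"
  note power_field_measurable[OF v, measurable]
  have "(\<integral>\<^sup>+\<omega>. ennreal (exp (t * (\<Sum>p<n. ?X p \<omega>))) \<partial>G) = (\<integral>\<^sup>+\<omega>. (\<Prod>p<n. ennreal (exp (t * ?X p \<omega>))) \<partial>G)"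
    by (simp add: sum_distrib_left exp_sum prod_ennreal)
  also have "\<dots> = (\<Prod>p<n. \<integral>\<^sup>+\<omega>. ennreal (exp (t * ?X p \<omega>)) \<partial>G)"
  proof (rule G.indep_vars_nn_integral)
    have "G.indep_vars (\<lambda>_. borel) ?X {..<n}"
      by (rule G.indep_vars_subset[OF power_field_indep[OF v]]) simp
    then show "G.indep_vars (\<lambda>_. borel) (\<lambda>p \<omega>. ennreal (exp (t * ?X p \<omega>))) {..<n}"
      by (rule G.indep_vars_compose2) measurable
  qed auto
  also have "\<dots> = (\<Prod>p<n. ennreal (exp (t\<^sup>2 * (\<integral>\<omega>. (?X p \<omega>)\<^sup>2 \<partial>G) / 2)))"
    by (intro prod.cong refl G.centered_gaussian_exp scaled_power_field v)
  also have "\<dots> = ennreal (exp (t\<^sup>2 * (\<Sum>p<n. \<integral>\<omega>. (?X p \<omega>)\<^sup>2 \<partial>G) / 2))"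
    by (simp add: prod_ennreal exp_sum sum_distrib_left sum_divide_distrib)
  also have "\<dots> \<le> ennreal (exp (t\<^sup>2 * (\<Sum>p. (\<Lambda> p)\<^sup>2) / 2))"
  proof -
    have "(\<Sum>p<n. \<integral>\<omega>. (?X p \<omega>)\<^sup>2 \<partial>G) \<le> (\<Sum>p<n. (\<Lambda> p)\<^sup>2)"
      by (intro sum_mono scaled_power_field v)
    also have "\<dots> \<le> (\<Sum>p. (\<Lambda> p)\<^sup>2)" using \<Lambda> by (intro sum_le_suminf) (auto simp: ell2_def)
    finally show ?thesis by (intro ennreal_leI) (simp add: mult_left_mono)
  qed
  finally show ?thesis .
qed

text \<open>Fatou's lemma along the partial sums: almost sure convergence is enough for an upper
  bound, and the law of the limit need not be identified.\<close>

lemma field_series_exp: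
  assumes \<Lambda>: "\<Lambda> \<in> ell2" and v: "v \<in> cball 0 1"
  shows "(\<integral>\<^sup>+\<omega>. ennreal (exp (t * \<bar>field_series l \<Lambda> v \<omega>\<bar>)) \<partial>G) \<le> ennreal (2 * exp (t\<^sup>2 * (\<Sum>p. (\<Lambda> p)\<^sup>2) / 2))"
    (is "_ \<le> ?K")
proof -
  let ?S = "\<lambda>n \<omega>. \<Sum>p<n. \<Lambda> p * l p v \<omega>"
  note power_field_measurable[OF v, measurable]
  have bound: "(\<integral>\<^sup>+\<omega>. ennreal (exp (t * \<bar>?S n \<omega>\<bar>)) \<partial>G) \<le> ?K" for n
  proof -
    have "(\<integral>\<^sup>+\<omega>. ennreal (exp (t * \<bar>?S n \<omega>\<bar>)) \<partial>G) \<le>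
        (\<integral>\<^sup>+\<omega>. ennreal (exp (t * ?S n \<omega>)) + ennreal (exp ((- t) * ?S n \<omega>)) \<partial>G)"
      by (intro nn_integral_mono) (auto simp: abs_if simp flip: ennreal_plus)
    also have "\<dots> = (\<integral>\<^sup>+\<omega>. ennreal (exp (t * ?S n \<omega>)) \<partial>G) + (\<integral>\<^sup>+\<omega>. ennreal (exp ((- t) * ?S n \<omega>)) \<partial>G)"
      by (rule nn_integral_add) measurable
    also have "\<dots> \<le> ennreal (exp (t\<^sup>2 * (\<Sum>p. (\<Lambda> p)\<^sup>2) / 2)) + ennreal (exp ((- t)\<^sup>2 * (\<Sum>p. (\<Lambda> p)\<^sup>2) / 2))"
      by (intro add_mono partial_sum_exp \<Lambda> v)
    also have "\<dots> = ?K" by (simp flip: ennreal_plus)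
    finally show ?thesis .
  qed
  have "(\<integral>\<^sup>+\<omega>. ennreal (exp (t * \<bar>field_series l \<Lambda> v \<omega>\<bar>)) \<partial>G) =
      (\<integral>\<^sup>+\<omega>. liminf (\<lambda>n. ennreal (exp (t * \<bar>?S n \<omega>\<bar>))) \<partial>G)"
  proof (rule nn_integral_cong_AE)
    show "AE \<omega> in G. ennreal (exp (t * \<bar>field_series l \<Lambda> v \<omega>\<bar>)) = liminf (\<lambda>n. ennreal (exp (t * \<bar>?S n \<omega>\<bar>)))"
      using field_series_converges[OF \<Lambda> v]
    proof eventually_elim
      case (elim \<omega>)
      then have "(\<lambda>n. ?S n \<omega>) \<longlonglongrightarrow> field_series l \<Lambda> v \<omega>"
        unfolding field_series_def by (rule summable_LIMSEQ)
      then have "(\<lambda>n. ennreal (exp (t * \<bar>?S n \<omega>\<bar>))) \<longlonglongrightarrow> ennreal (exp (t * \<bar>field_series l \<Lambda> v \<omega>\<bar>))"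
        by (intro tendsto_intros tendsto_ennrealI)
      from lim_imp_Liminf[OF sequentially_bot this] show ?case by (rule sym)
    qed
  qed
  also have "\<dots> \<le> liminf (\<lambda>n. \<integral>\<^sup>+\<omega>. ennreal (exp (t * \<bar>?S n \<omega>\<bar>)) \<partial>G)"
    by (rule nn_integral_liminf) measurable
  also have "\<dots> \<le> ?K"
    using bound by (intro Liminf_le) auto
  finally show ?thesis .
qed

text \<open>Linearity of \<open>suminf\<close> requires both series to converge, hence the almost
  sure form.\<close>

lemma field_series_diff:
  assumes \<Lambda>: "\<Lambda> \<in> ell2" and \<Lambda>': "\<Lambda>' \<in> ell2" and v: "v \<in> cball 0 1"
  shows "AE \<omega> in G. (field_series l \<Lambda> v \<omega> - field_series l \<Lambda>' v \<omega>) / d = field_series l (\<lambda>p. (\<Lambda> p - \<Lambda>' p) / d) v \<omega>"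
  using field_series_converges[OF \<Lambda> v] field_series_converges[OF \<Lambda>' v]
proof eventually_elim
  case (elim \<omega>)
  have "(field_series l \<Lambda> v \<omega> - field_series l \<Lambda>' v \<omega>) / d = (\<Sum>p. (\<Lambda> p * l p v \<omega> - \<Lambda>' p * l p v \<omega>) / d)"
    unfolding field_series_def using elim by (simp add: suminf_diff suminf_divide summable_diff)
  then show ?case by (simp add: field_series_def algebra_simps diff_divide_distrib)
qed

lemma field_series_measurable:
  "(\<lambda>(v, \<omega>). field_series l \<Lambda> v \<omega>) \<in> borel_measurable (ball_space \<Otimes>\<^sub>M G)"
proof -
  have [measurable]: "(\<lambda>x. l p (fst x) (snd x)) \<in> borel_measurable (ball_space \<Otimes>\<^sub>M G)" for p
    using gaussian_field_measurable[OF power_field, of p] by (simp add: split_beta')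
  show ?thesis unfolding field_series_def split_beta' by measurable
qed

end

section \<open>The Lipschitz bound\<close>

lemma abs_ln_cosh_le: "\<bar>ln (cosh x)\<bar> \<le> \<bar>x :: real\<bar>"
  and abs_ln_cosh_diff_le: "\<bar>ln (cosh x) - ln (cosh y)\<bar> \<le> \<bar>x - y :: real\<bar>"
proof -
  have *: "\<bar>ln (cosh x) - ln (cosh y)\<bar> \<le> \<bar>x - y\<bar>" for x y :: real
  proof -
    have d: "((\<lambda>x. ln (cosh x)) has_field_derivative tanh x) (at x)" for x :: real
      using cosh_real_pos[of x] by (auto intro!: derivative_eq_intros simp: tanh_def)
    have "\<bar>tanh x\<bar> \<le> 1" for x :: real
      using tanh_real_bounds[of x] by (simp add: abs_le_iff less_imp_le)
    then have "norm (ln (cosh x) - ln (cosh y)) \<le> 1 * norm (x - y)"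
      using d by (intro field_differentiable_bound[of UNIV "\<lambda>x. ln (cosh x)" tanh]) auto
    then show ?thesis by simp
  qed
  show "\<bar>ln (cosh x) - ln (cosh y)\<bar> \<le> \<bar>x - y\<bar>" by (rule *)
  show "\<bar>ln (cosh x)\<bar> \<le> \<bar>x\<bar>" using *[of x 0] by simp
qed

lemma ell2_norm_power2: "\<Lambda> \<in> ell2 \<Longrightarrow> (ell2_norm \<Lambda>)\<^sup>2 = (\<Sum>p. (\<Lambda> p)\<^sup>2)"
  unfolding ell2_norm_def ell2_def by (intro real_sqrt_pow2 suminf_nonneg) auto

text \<open>Young's inequality with weight \<open>d\<close>. When the squares
  \<open>(x - y)\<^sup>2\<close> sum to \<open>d\<^sup>2\<close>, both terms sum to a multiple of
  \<open>d\<close>, which does the work of Cauchy-Schwarz for the series.\<close>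

lemma abs_power2_diff_le:
  fixes x y d :: real
  assumes "0 < d"
  shows "\<bar>x\<^sup>2 - y\<^sup>2\<bar> \<le> (1 + 1 / d) * (x - y)\<^sup>2 + d * y\<^sup>2"
proof -
  have "0 \<le> (\<bar>x - y\<bar> - d * \<bar>y\<bar>)\<^sup>2" by simp
  then have "2 * (\<bar>x - y\<bar> * \<bar>y\<bar>) * d \<le> (x - y)\<^sup>2 + d\<^sup>2 * y\<^sup>2"
    unfolding power2_diff power_mult_distrib power2_abs by (simp add: mult_ac)
  also have "\<dots> = ((x - y)\<^sup>2 / d + d * y\<^sup>2) * d"
    using assms by (simp add: distrib_right power2_eq_square)
  finally have "2 * (\<bar>x - y\<bar> * \<bar>y\<bar>) \<le> (x - y)\<^sup>2 / d + d * y\<^sup>2"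
    using assms by simp
  moreover have "\<bar>x\<^sup>2 - y\<^sup>2\<bar> \<le> (x - y)\<^sup>2 + 2 * (\<bar>x - y\<bar> * \<bar>y\<bar>)"
  proof -
    have "x\<^sup>2 - y\<^sup>2 = (x - y)\<^sup>2 + 2 * ((x - y) * y)" by (simp add: power2_eq_square algebra_simps)
    also have "\<bar>\<dots>\<bar> \<le> \<bar>(x - y)\<^sup>2\<bar> + \<bar>2 * ((x - y) * y)\<bar>" by (rule abs_triangle_ineq)
    finally show ?thesis by (simp add: abs_mult)
  qed
  ultimately show ?thesis by (simp add: algebra_simps)
qed

text \<open>The weights \<open>w\<close> stand for the powers \<open>norm v ^ (2 * p)\<close>.\<close>

lemma ell2_weighted_diff:
  assumes \<Lambda>: "\<Lambda> \<in> ell2" "\<Lambda>' \<in> ell2" and d: "d = ell2_norm (\<lambda>p. \<Lambda> p - \<Lambda>' p)" "0 < d"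
    and w: "\<And>p. 0 \<le> w p" "\<And>p. w p \<le> (1 :: real)"
  shows "\<bar>(\<Sum>p. (\<Lambda> p)\<^sup>2 * w p) - (\<Sum>p. (\<Lambda>' p)\<^sup>2 * w p)\<bar> \<le> d * (d + 1 + (\<Sum>p. (\<Lambda>' p)\<^sup>2))"
proof -
  have \<Delta>: "(\<lambda>p. \<Lambda> p - \<Lambda>' p) \<in> ell2" using ell2_diff_scaled[OF \<Lambda>, of 1] by simp
  have s: "summable (\<lambda>p. (\<Lambda> p - \<Lambda>' p)\<^sup>2)" "summable (\<lambda>p. (\<Lambda>' p)\<^sup>2)" "summable (\<lambda>p. (\<Lambda> p)\<^sup>2)"
    using \<Delta> \<Lambda> by (simp_all add: ell2_def)
  have sw: "summable (\<lambda>p. (f p)\<^sup>2 * w p)" if "summable (\<lambda>p. (f p)\<^sup>2)" for f :: "nat \<Rightarrow> real"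
    by (rule suminf_dominated(1)[OF _ _ that]) (simp_all add: w mult_left_le)
  \<comment> \<open>A summable majorant independent of the weights, with sum
    \<open>d\<^sup>2 + d + d * (\<Sum>p. (\<Lambda>' p)\<^sup>2)\<close>.\<close>
  let ?g = "\<lambda>p. (1 + 1 / d) * (\<Lambda> p - \<Lambda>' p)\<^sup>2 + d * (\<Lambda>' p)\<^sup>2"
  have g: "summable ?g" using s by (intro summable_add summable_mult)
  have le: "\<bar>(\<Lambda> p)\<^sup>2 * w p - (\<Lambda>' p)\<^sup>2 * w p\<bar> \<le> ?g p" for p
  proof -
    have "\<bar>(\<Lambda> p)\<^sup>2 * w p - (\<Lambda>' p)\<^sup>2 * w p\<bar> = \<bar>(\<Lambda> p)\<^sup>2 - (\<Lambda>' p)\<^sup>2\<bar> * w p"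
      using w by (simp add: abs_mult left_diff_distrib[symmetric])
    also have "\<dots> \<le> \<bar>(\<Lambda> p)\<^sup>2 - (\<Lambda>' p)\<^sup>2\<bar>" using w by (simp add: mult_left_le)
    also have "\<dots> \<le> ?g p" using d(2) by (rule abs_power2_diff_le)
    finally show ?thesis .
  qed
  have abs: "summable (\<lambda>p. \<bar>(\<Lambda> p)\<^sup>2 * w p - (\<Lambda>' p)\<^sup>2 * w p\<bar>)"
    by (rule suminf_dominated(1)[OF _ le g]) simp
  have "\<bar>(\<Sum>p. (\<Lambda> p)\<^sup>2 * w p) - (\<Sum>p. (\<Lambda>' p)\<^sup>2 * w p)\<bar> = \<bar>\<Sum>p. (\<Lambda> p)\<^sup>2 * w p - (\<Lambda>' p)\<^sup>2 * w p\<bar>"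
    using s by (simp add: suminf_diff sw)
  also have "\<dots> \<le> (\<Sum>p. \<bar>(\<Lambda> p)\<^sup>2 * w p - (\<Lambda>' p)\<^sup>2 * w p\<bar>)" by (rule summable_rabs[OF abs])
  also have "\<dots> \<le> (\<Sum>p. ?g p)" by (rule suminf_le[OF le abs g])
  also have "\<dots> = (1 + 1 / d) * d\<^sup>2 + d * (\<Sum>p. (\<Lambda>' p)\<^sup>2)"
    using s unfolding d(1) ell2_norm_power2[OF \<Delta>]
    by (simp only: suminf_add[symmetric] suminf_mult summable_mult)
  also have "\<dots> = d * (d + 1 + (\<Sum>p. (\<Lambda>' p)\<^sup>2))" using d(2) by (simp add: power2_eq_square field_simps)
  finally show ?thesis .
qed

text \<open>On the constants: \<open>\<delta> + 1 + s'\<close> bounds the change of the variances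
  divided by \<open>d\<close>, and \<open>\<delta> * (\<delta> + 1 + s') + s'\<close> bounds the sum
  of all \<open>(\<Lambda> p)\<^sup>2\<close>. The three exponentials are moments of order
  \<open>t = 6\<close> of the normalised difference and of the two series, with
  \<open>18 = t\<^sup>2 / 2\<close>.\<close>

lemma P_functional_seq_lipschitz:
  fixes l :: "nat \<Rightarrow> 'h::{real_inner, polish_space} \<Rightarrow> 'g \<Rightarrow> real"
  assumes fields: "independent_power_fields G l"
    and \<psi>: "\<psi> = (\<lambda>x. ln (cosh x)) \<or> \<psi> = (\<lambda>x. x)"
    and \<Lambda>: "\<Lambda> \<in> ell2" "\<Lambda>' \<in> ell2" and d: "d = ell2_norm (\<lambda>p. \<Lambda> p - \<Lambda>' p)" "d < \<delta>"
    and J: "sampling_measure P J"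
    and s': "s' = (\<Sum>p. (\<Lambda>' p)\<^sup>2)"
    and E: "E = (\<delta> + 1 + s') + ((\<delta> * (\<delta> + 1 + s') + s') + s')"
  shows "\<bar>P_functional_seq \<psi> G l \<Lambda> J - P_functional_seq \<psi> G l \<Lambda>' J\<bar> \<le>
    ((\<delta> + 1 + s') + exp (2 * E) * (2 * exp 18 + 2 * exp (18 * (\<delta> * (\<delta> + 1 + s') + s')) + 2 * exp (18 * s'))) * d"
\<comment> \<open>The argument divides by \<open>d\<close>, so equal parameters are treated
  apart.\<close>
proof (cases "d = 0")
  case True
  have \<Delta>: "(\<lambda>p. \<Lambda> p - \<Lambda>' p) \<in> ell2" using ell2_diff_scaled[OF \<Lambda>, of 1] by simp
  then have "(\<Sum>p. (\<Lambda> p - \<Lambda>' p)\<^sup>2) = 0" using ell2_norm_power2[OF \<Delta>] True d by simp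
  then have "\<forall>p. (\<Lambda> p - \<Lambda>' p)\<^sup>2 = 0"
    using \<Delta> by (subst (asm) suminf_eq_zero_iff) (auto simp: ell2_def)
  then have "\<Lambda> = \<Lambda>'" by auto
  then show ?thesis using True by simp
next
  case False
  moreover have "0 \<le> d" unfolding d(1) ell2_norm_def using ell2_diff_scaled[OF \<Lambda>, of 1]
    by (auto simp: ell2_def intro!: real_sqrt_ge_zero suminf_nonneg)
  ultimately have d0: "0 < d" by simp
  interpret G: prob_space G
    using power_field[OF fields] by (rule gaussian_field_prob_space)
  have \<psi>_le: "\<bar>\<psi> x\<bar> \<le> \<bar>x\<bar>" and \<psi>_diff: "\<bar>\<psi> x - \<psi> y\<bar> \<le> \<bar>x - y\<bar>" for x y
    using \<psi> abs_ln_cosh_le abs_ln_cosh_diff_le by auto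
  have [measurable]: "\<psi> \<in> borel_measurable borel"
  proof -
    have "(\<lambda>x :: real. ln (cosh x)) \<in> borel_measurable borel"
      by (intro borel_measurable_continuous_onI continuous_intros) auto
    then show ?thesis using \<psi> by auto
  qed
  define s where "s = (\<Sum>p. (\<Lambda> p)\<^sup>2)"
  define D where "D = \<delta> + 1 + s'"
  have s'0: "0 \<le> s'" using \<Lambda> by (auto simp: s' ell2_def intro!: suminf_nonneg)
  have D: "d * (d + 1 + s') \<le> d * D"
    using d d0 by (intro mult_left_mono) (auto simp: D_def)
  have D0: "0 \<le> D" using d d0 s'0 by (simp add: D_def)
  have ss': "\<bar>s - s'\<bar> \<le> d * D"
    using ell2_weighted_diff[OF \<Lambda> d(1) d0, of "\<lambda>_. 1"] D by (simp add: s_def s')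
  have "d * D \<le> \<delta> * D" using d D0 by (intro mult_right_mono) auto
  then have s_le: "s \<le> \<delta> * D + s'" using ss' by linarith
  define var where "var L v = (\<Sum>p. (L p)\<^sup>2 * norm v ^ (2 * p))" for L and v :: 'h
  have var: "0 \<le> var L v" "var L v \<le> (\<Sum>p. (L p)\<^sup>2)" if "L \<in> ell2" "v \<in> cball 0 1" for L v
  proof -
    have "summable (\<lambda>p. (L p)\<^sup>2)" using that by (simp add: ell2_def)
    from suminf_dominated(2,3)[OF _ _ this] that show "0 \<le> var L v" "var L v \<le> (\<Sum>p. (L p)\<^sup>2)"
      unfolding var_def by (simp_all add: mult_left_le power_le_one)
  qed
  have var_diff: "\<bar>var \<Lambda> v - var \<Lambda>' v\<bar> \<le> d * D" if "v \<in> cball 0 1" for v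
    using ell2_weighted_diff[OF \<Lambda> d(1) d0, of "\<lambda>p. norm v ^ (2 * p)"] that D
    by (simp add: var_def s' power_le_one)
  define H where "H L v \<omega> = \<psi> (field_series l L v \<omega>) - var L v / 2" for L v \<omega>
  \<comment> \<open>The difference quotient is taken of the values of the two series, so that the
    domination holds at every \<open>\<omega>\<close>. That it is itself a series with coefficients
    of norm 1 holds almost surely, and is used only under the integral in
    \<open>W_bound\<close>.\<close>
  define W where "W v \<omega> = \<bar>(field_series l \<Lambda> v \<omega> - field_series l \<Lambda>' v \<omega>) / d\<bar> +
    (\<bar>field_series l \<Lambda> v \<omega>\<bar> + \<bar>field_series l \<Lambda>' v \<omega>\<bar>) + E" for v \<omega>
  have E': "E = D + ((\<delta> * D + s') + s')" by (simp add: E D_def)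
  have E0: "0 \<le> \<delta> * D" using d d0 D0 by simp
  have H: "\<bar>H \<Lambda> v \<omega>\<bar> \<le> \<bar>field_series l \<Lambda> v \<omega>\<bar> + s" "\<bar>H \<Lambda>' v \<omega>\<bar> \<le> \<bar>field_series l \<Lambda>' v \<omega>\<bar> + s'"
    if "v \<in> cball 0 1" for v \<omega>
    using \<psi>_le[of "field_series l \<Lambda> v \<omega>"] \<psi>_le[of "field_series l \<Lambda>' v \<omega>"]
      var[OF \<Lambda>(1) that] var[OF \<Lambda>(2) that] unfolding H_def s_def[symmetric] s'[symmetric] by linarith+
  have HW: "\<bar>H \<Lambda> v \<omega>\<bar> \<le> W v \<omega>" "\<bar>H \<Lambda>' v \<omega>\<bar> \<le> W v \<omega>" if "v \<in> cball 0 1" for v \<omega>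
    using H[OF that, of \<omega>] s_le s'0 D0 E0 unfolding W_def E' by linarith+
  have exp_diff: "\<bar>exp (H \<Lambda> v \<omega>) - exp (H \<Lambda>' v \<omega>)\<bar> \<le> d * exp (W v \<omega>)" if v: "v \<in> cball 0 1" for v \<omega>
  proof -
    let ?g = "\<bar>(field_series l \<Lambda> v \<omega> - field_series l \<Lambda>' v \<omega>) / d\<bar>"
    let ?m = "\<bar>field_series l \<Lambda> v \<omega>\<bar> + \<bar>field_series l \<Lambda>' v \<omega>\<bar> + ((\<delta> * D + s') + s')"
    have g: "\<bar>field_series l \<Lambda> v \<omega> - field_series l \<Lambda>' v \<omega>\<bar> = d * ?g" using d0 by simp
    have "\<bar>H \<Lambda> v \<omega> - H \<Lambda>' v \<omega>\<bar> \<le> d * ?g + d * D"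
      using \<psi>_diff[of "field_series l \<Lambda> v \<omega>" "field_series l \<Lambda>' v \<omega>"] var_diff[OF v] g
      unfolding H_def by linarith
    also have "\<dots> = d * (?g + D)" by (simp add: algebra_simps)
    finally have 1: "\<bar>H \<Lambda> v \<omega> - H \<Lambda>' v \<omega>\<bar> \<le> d * (?g + D)" .
    \<comment> \<open>A one-sided mean value estimate from \<open>1 + x \<le> exp x\<close>.\<close>
    have exp_lip: "exp a - exp b \<le> \<bar>a - b\<bar> * exp m" if "a \<le> m" for a b m :: real
    proof (cases "a \<le> b")
      case True
      then have "exp a \<le> exp b" by simp
      moreover have "0 \<le> \<bar>a - b\<bar> * exp m" by simp
      ultimately show ?thesis by linarith
    next
      case False
      have "exp a * (1 + (b - a)) \<le> exp a * exp (b - a)" by (intro mult_left_mono exp_ge_add_one_self) auto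
      then have "exp a - exp b \<le> (a - b) * exp a" by (simp add: algebra_simps exp_diff)
      also have "\<dots> \<le> (a - b) * exp m" using that False by (intro mult_left_mono) auto
      finally show ?thesis using False by simp
    qed
    have "H \<Lambda> v \<omega> \<le> ?m" "H \<Lambda>' v \<omega> \<le> ?m"
      using H[OF v, of \<omega>] s_le s'0 E0 by linarith+
    then have "\<bar>exp (H \<Lambda> v \<omega>) - exp (H \<Lambda>' v \<omega>)\<bar> \<le> \<bar>H \<Lambda> v \<omega> - H \<Lambda>' v \<omega>\<bar> * exp ?m"
      using exp_lip[of "H \<Lambda> v \<omega>" ?m "H \<Lambda>' v \<omega>"] exp_lip[of "H \<Lambda>' v \<omega>" ?m "H \<Lambda> v \<omega>"]
      by (simp add: abs_le_iff abs_minus_commute)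
    also have "\<dots> \<le> d * exp (?g + D) * exp ?m"
    proof (rule mult_right_mono)
      \<comment> \<open>The linear factor is absorbed into an exponential; this is why
        \<open>W\<close> contains the difference quotient and, within \<open>E\<close>, the constant
        \<open>D\<close>.\<close>
      have "?g + D \<le> exp (?g + D)" using exp_ge_add_one_self[of "?g + D"] by linarith
      then show "\<bar>H \<Lambda> v \<omega> - H \<Lambda>' v \<omega>\<bar> \<le> d * exp (?g + D)"
        using 1 d0 by (meson mult_left_mono less_imp_le order_trans)
    qed simp
    also have "\<dots> = d * exp (W v \<omega>)"
      unfolding W_def E' by (simp add: exp_add)
    finally show ?thesis .
  qed
  let ?C = "2 * exp 18 + 2 * exp (18 * (\<delta> * D + s')) + 2 * exp (18 * s')"
  let ?K = "exp (2 * E) * ?C"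
  have W_bound: "(\<integral>\<^sup>+\<omega>. ennreal (exp (2 * W v \<omega>)) \<partial>G) \<le> ennreal ?K" if v: "v \<in> cball 0 1" for v
  proof -
    have [measurable]: "field_series l L v \<in> borel_measurable G" for L
      using measurable_compose[OF measurable_Pair1' field_series_measurable[OF fields, of L]] v
      by (simp add: space_ball_space)
    let ?\<Delta> = "\<lambda>p. (\<Lambda> p - \<Lambda>' p) / d"
    have \<Delta>: "?\<Delta> \<in> ell2" using \<Lambda> by (rule ell2_diff_scaled)
    \<comment> \<open>The normalisation by \<open>d\<close> makes the moment bound for the
      difference independent of \<open>d\<close>.\<close>
    have \<Delta>_sum: "(\<Sum>p. (?\<Delta> p)\<^sup>2) = 1"
    proof -
      have \<Delta>1: "(\<lambda>p. \<Lambda> p - \<Lambda>' p) \<in> ell2" using ell2_diff_scaled[OF \<Lambda>, of 1] by simp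
      then have "(\<Sum>p. (?\<Delta> p)\<^sup>2) = (\<Sum>p. (\<Lambda> p - \<Lambda>' p)\<^sup>2) / d\<^sup>2"
        by (simp add: power_divide suminf_divide ell2_def)
      also have "(\<Sum>p. (\<Lambda> p - \<Lambda>' p)\<^sup>2) = d\<^sup>2"
        unfolding d(1) by (rule ell2_norm_power2[OF \<Delta>1, symmetric])
      finally show ?thesis using d0 by simp
    qed
    \<comment> \<open>The sum is at most three times its largest term. This separates the three
      series, which are not independent of each other, at the price of the exponent
      \<open>6 = 2 * 3\<close>.\<close>
    have max3: "exp (2 * (a + (b + c))) \<le> exp (6 * a) + exp (6 * b) + exp (6 * c)" for a b c :: real
    proof -
      have "2 * (a + (b + c)) \<le> 6 * a \<or> 2 * (a + (b + c)) \<le> 6 * b \<or> 2 * (a + (b + c)) \<le> 6 * c" by (smt (verit))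
      then have "exp (2 * (a + (b + c))) \<le> exp (6 * a) \<or> exp (2 * (a + (b + c))) \<le> exp (6 * b) \<or>
          exp (2 * (a + (b + c))) \<le> exp (6 * c)" by simp
      then show ?thesis
        using exp_gt_zero[of "6 * a"] exp_gt_zero[of "6 * b"] exp_gt_zero[of "6 * c"] by linarith
    qed
    let ?e = "\<lambda>L \<omega>. ennreal (exp (6 * \<bar>field_series l L v \<omega>\<bar>))"
    have "(\<integral>\<^sup>+\<omega>. ennreal (exp (2 * W v \<omega>)) \<partial>G) \<le>
        (\<integral>\<^sup>+\<omega>. ennreal (exp (2 * E)) * (?e ?\<Delta> \<omega> + ?e \<Lambda> \<omega> + ?e \<Lambda>' \<omega>) \<partial>G)"
    proof (rule nn_integral_mono_AE)
      show "AE \<omega> in G. ennreal (exp (2 * W v \<omega>)) \<le> ennreal (exp (2 * E)) * (?e ?\<Delta> \<omega> + ?e \<Lambda> \<omega> + ?e \<Lambda>' \<omega>)"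
        using field_series_diff[OF fields \<Lambda> v, of d]
      proof eventually_elim
        case (elim \<omega>)
        have "exp (2 * W v \<omega>) = exp (2 * E) * exp (2 * (\<bar>field_series l ?\<Delta> v \<omega>\<bar> +
            (\<bar>field_series l \<Lambda> v \<omega>\<bar> + \<bar>field_series l \<Lambda>' v \<omega>\<bar>)))"
          unfolding W_def elim exp_add[symmetric] by (simp add: algebra_simps)
        also have "\<dots> \<le> exp (2 * E) * (exp (6 * \<bar>field_series l ?\<Delta> v \<omega>\<bar>) +
            exp (6 * \<bar>field_series l \<Lambda> v \<omega>\<bar>) + exp (6 * \<bar>field_series l \<Lambda>' v \<omega>\<bar>))"
          by (intro mult_left_mono max3) simp
        finally show ?case
          by (simp add: ennreal_mult[symmetric] ennreal_plus[symmetric] del: ennreal_plus)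
      qed
    qed
    also have "\<dots> = ennreal (exp (2 * E)) *
        ((\<integral>\<^sup>+\<omega>. ?e ?\<Delta> \<omega> \<partial>G) + (\<integral>\<^sup>+\<omega>. ?e \<Lambda> \<omega> \<partial>G) + (\<integral>\<^sup>+\<omega>. ?e \<Lambda>' \<omega> \<partial>G))"
      by (simp add: nn_integral_cmult nn_integral_add)
    also have "\<dots> \<le> ennreal (exp (2 * E)) *
        (ennreal (2 * exp 18) + ennreal (2 * exp (18 * (\<delta> * D + s'))) + ennreal (2 * exp (18 * s')))"
    proof (intro mult_left_mono add_mono)
      show "(\<integral>\<^sup>+\<omega>. ?e ?\<Delta> \<omega> \<partial>G) \<le> ennreal (2 * exp 18)"
        using field_series_exp[OF fields \<Delta> v, of 6] unfolding \<Delta>_sum by simp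
      show "(\<integral>\<^sup>+\<omega>. ?e \<Lambda> \<omega> \<partial>G) \<le> ennreal (2 * exp (18 * (\<delta> * D + s')))"
        using field_series_exp[OF fields \<Lambda>(1) v, of 6] s_le unfolding s_def[symmetric]
        by (auto elim!: order_trans intro!: ennreal_leI)
      show "(\<integral>\<^sup>+\<omega>. ?e \<Lambda>' \<omega> \<partial>G) \<le> ennreal (2 * exp (18 * s'))"
        using field_series_exp[OF fields \<Lambda>(2) v, of 6] unfolding s'[symmetric] by simp
    qed simp
    also have "\<dots> = ennreal ?K"
      by (simp add: ennreal_mult[symmetric] ennreal_plus[symmetric] del: ennreal_plus)
    finally show ?thesis .
  qed
  have var_meas: "var L \<in> borel_measurable ball_space" for L
    unfolding var_def[abs_def] by measurable
  have [measurable]: "(\<lambda>x. field_series l L (fst x) (snd x)) \<in> borel_measurable (ball_space \<Otimes>\<^sub>M G)" for L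
    using field_series_measurable[OF fields, of L] by (simp add: split_beta')
  have H_meas: "(\<lambda>(v, \<omega>). H L v \<omega>) \<in> borel_measurable (ball_space \<Otimes>\<^sub>M G)" for L
    using var_meas[of L] unfolding H_def split_beta' by measurable
  have W_meas: "(\<lambda>(v, \<omega>). W v \<omega>) \<in> borel_measurable (ball_space \<Otimes>\<^sub>M G)"
    unfolding W_def split_beta' by measurable
  define \<Phi> where "\<Phi> L \<mu> = (\<integral>\<omega>. ln (\<integral>v. exp (H L v \<omega>) \<partial>\<mu>) \<partial>G)" for L \<mu>
  have \<Phi>_meas: "\<Phi> L \<in> borel_measurable (prob_algebra ball_space)" for L
    unfolding \<Phi>_def[abs_def]
    by (rule integral_ln_integral_measurable[where \<kappa>="\<lambda>\<mu>. \<mu>", OF H_meas G.prob_space_axioms]) simp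
  have \<Phi>_bounds: "\<bar>\<Phi> \<Lambda> \<mu>\<bar> \<le> ?K" "\<bar>\<Phi> \<Lambda>' \<mu>\<bar> \<le> ?K" "\<bar>\<Phi> \<Lambda> \<mu> - \<Phi> \<Lambda>' \<mu>\<bar> \<le> d * ?K"
    if \<mu>: "\<mu> \<in> space (prob_algebra ball_space)" for \<mu>
  proof -
    have p: "prob_space \<mu>" and sets: "sets \<mu> = sets ball_space" using \<mu> by (auto simp: space_prob_algebra)
    interpret \<mu>: prob_space \<mu> by (rule p)
    have sp: "space \<mu> = cball 0 1" using \<mu> by (rule space_prob_algebra_ball_space)
    have meas_eq: "borel_measurable (\<mu> \<Otimes>\<^sub>M G) = (borel_measurable (ball_space \<Otimes>\<^sub>M G) :: ('h \<times> 'g \<Rightarrow> real) set)"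
      using sets by (intro measurable_cong_sets sets_pair_measure_cong) auto
    have mH: "case_prod (H L) \<in> borel_measurable (\<mu> \<Otimes>\<^sub>M G)" for L
      unfolding meas_eq using H_meas .
    have mW: "case_prod W \<in> borel_measurable (\<mu> \<Otimes>\<^sub>M G)"
      unfolding meas_eq using W_meas .
    have "(\<integral>\<^sup>+v. \<integral>\<^sup>+\<omega>. ennreal (exp (2 * W v \<omega>)) \<partial>G \<partial>\<mu>) \<le> (\<integral>\<^sup>+v. ennreal ?K \<partial>\<mu>)"
      using W_bound sp by (intro nn_integral_mono) auto
    then have K: "(\<integral>\<^sup>+v. \<integral>\<^sup>+\<omega>. ennreal (exp (2 * W v \<omega>)) \<partial>G \<partial>\<mu>) \<le> ennreal ?K"
      by (simp add: \<mu>.emeasure_space_1)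
    have K0: "0 \<le> ?K" by simp
    have U: "\<bar>H \<Lambda> v \<omega>\<bar> \<le> W v \<omega>" "\<bar>H \<Lambda>' v \<omega>\<bar> \<le> W v \<omega>"
      "\<bar>exp (H \<Lambda> v \<omega>) - exp (H \<Lambda>' v \<omega>)\<bar> \<le> d * exp (W v \<omega>)"
      "\<bar>exp (H \<Lambda>' v \<omega>) - exp (H \<Lambda>' v \<omega>)\<bar> \<le> 0 * exp (W v \<omega>)" if "v \<in> space \<mu>" for v \<omega>
      using HW[of v] exp_diff[of v] that sp by auto
    note ln_bound = expectation_ln_integral_exp[OF p G.prob_space_axioms mH mH mW _ _ _ K K0]
    show "\<bar>\<Phi> \<Lambda> \<mu>\<bar> \<le> ?K"
      unfolding \<Phi>_def by (rule ln_bound(2)[OF U(1) U(2) U(3)])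
    show "\<bar>\<Phi> \<Lambda>' \<mu>\<bar> \<le> ?K"
      unfolding \<Phi>_def by (rule ln_bound(2)[OF U(2) U(2) U(4)])
    show "\<bar>\<Phi> \<Lambda> \<mu> - \<Phi> \<Lambda>' \<mu>\<bar> \<le> d * ?K"
      unfolding \<Phi>_def by (rule ln_bound(3)[OF U(1) U(2) U(3)])
  qed
  interpret J: prob_space J using J by (simp add: sampling_measure_def)
  have i1: "integrable J (\<lambda>(q, \<mu>). \<Phi> \<Lambda> \<mu>)"
    using J \<Phi>_meas \<Phi>_bounds(1) by (rule sampling_measure_integrable)
  have i2: "integrable J (\<lambda>(q, \<mu>). \<Phi> \<Lambda>' \<mu>)"
    using J \<Phi>_meas \<Phi>_bounds(2) by (rule sampling_measure_integrable)
  have P: "P_functional_seq \<psi> G l L J = (\<Sum>p. (L p)\<^sup>2) / 2 + (\<integral>(q, \<mu>). \<Phi> L \<mu> \<partial>J)" for L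
    unfolding P_functional_seq_def \<Phi>_def H_def var_def field_series_def ..
  have "\<bar>(\<integral>(q, \<mu>). \<Phi> \<Lambda> \<mu> \<partial>J) - (\<integral>(q, \<mu>). \<Phi> \<Lambda>' \<mu> \<partial>J)\<bar> =
      \<bar>\<integral>x. (case x of (q, \<mu>) \<Rightarrow> \<Phi> \<Lambda> \<mu>) - (case x of (q, \<mu>) \<Rightarrow> \<Phi> \<Lambda>' \<mu>) \<partial>J\<bar>"
    by (simp only: Bochner_Integration.integral_diff[OF i1 i2])
  also have "\<dots> \<le> (\<integral>x. \<bar>(case x of (q, \<mu>) \<Rightarrow> \<Phi> \<Lambda> \<mu>) - (case x of (q, \<mu>) \<Rightarrow> \<Phi> \<Lambda>' \<mu>)\<bar> \<partial>J)"
    by (rule integral_abs_bound)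
  also have "\<dots> \<le> d * ?K"
  proof (rule J.integral_le_const)
    show "integrable J (\<lambda>x. \<bar>(case x of (q, \<mu>) \<Rightarrow> \<Phi> \<Lambda> \<mu>) - (case x of (q, \<mu>) \<Rightarrow> \<Phi> \<Lambda>' \<mu>)\<bar>)"
      by (intro integrable_abs Bochner_Integration.integrable_diff i1 i2)
    show "AE x in J. \<bar>(case x of (q, \<mu>) \<Rightarrow> \<Phi> \<Lambda> \<mu>) - (case x of (q, \<mu>) \<Rightarrow> \<Phi> \<Lambda>' \<mu>)\<bar> \<le> d * ?K"
    proof (rule AE_I2)
      fix x assume "x \<in> space J"
      then show "\<bar>(case x of (q, \<mu>) \<Rightarrow> \<Phi> \<Lambda> \<mu>) - (case x of (q, \<mu>) \<Rightarrow> \<Phi> \<Lambda>' \<mu>)\<bar> \<le> d * ?K"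
        using \<Phi>_bounds(3)[OF sampling_measure_space[OF J, of "fst x" "snd x"]] by (simp add: split_beta')
    qed
  qed
  \<comment> \<open>The summand \<open>d * D\<close> covers the deterministic half sums of squares
    in front of the integral.\<close>
  finally have "\<bar>P_functional_seq \<psi> G l \<Lambda> J - P_functional_seq \<psi> G l \<Lambda>' J\<bar> \<le> d * D + d * ?K"
    using ss' unfolding P s_def[symmetric] s'[symmetric] by linarith
  also have "\<dots> = (D + ?K) * d"
  proof -
    have "d * D + d * k = (D + k) * d" for k by (simp add: algebra_simps)
    then show ?thesis .
  qed
  finally show ?thesis unfolding D_def .
qed

text \<open>The maximum over ROSt laws is expressed as a bound valid for every law and each of its
  sampling measures.\<close>

theorem proposition2p5:
  assumes infinite_dim: "\<not> (\<exists>B :: 'h::{real_inner, polish_space} set. finite B \<and> span B = UNIV)"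
  shows
    "(\<forall>(\<psi> :: real \<Rightarrow> real) (c :: real \<Rightarrow> real) (G :: 'g measure) (l :: 'h \<Rightarrow> 'g \<Rightarrow> real)
        (S :: overlap measure \<Rightarrow> (overlap \<times> 'h measure) measure) (\<Lambda> :: real).
        \<psi> C1_differentiable_on UNIV \<and> bounded (range (deriv \<psi>)) \<and> \<psi> 0 = 0 \<and>
        continuous_on {-1..1} c \<and> c 1 = 1 \<and> pos_def_on_ball TYPE('h) c \<and>
        gaussian_field G c l \<and> (\<forall>P. rost_law P \<longrightarrow> sampling_measure P (S P)) \<and> \<Lambda> \<ge> 0
        \<longrightarrow> continuous_map rost_topology euclideanreal (\<lambda>P. P_functional \<psi> c G l \<Lambda> (S P)))
     \<and>
     (\<forall>\<delta>>0. \<forall>\<Lambda>'\<in>ell2. \<exists>K>0.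
        \<forall>(\<psi> :: real \<Rightarrow> real) (G :: 'k measure) (l :: nat \<Rightarrow> 'h \<Rightarrow> 'k \<Rightarrow> real).
        (\<psi> = (\<lambda>x. ln (cosh x)) \<or> \<psi> = (\<lambda>x. x)) \<and> independent_power_fields G l
        \<longrightarrow> (\<forall>\<Lambda>\<in>ell2. ell2_norm (\<lambda>p. \<Lambda> p - \<Lambda>' p) < \<delta> \<longrightarrow>
              (\<forall>P J. rost_law P \<and> sampling_measure P J \<longrightarrow>
                 \<bar>P_functional_seq \<psi> G l \<Lambda> J - P_functional_seq \<psi> G l \<Lambda>' J\<bar>
                   \<le> K * ell2_norm (\<lambda>p. \<Lambda> p - \<Lambda>' p))))"
proof (intro conjI allI impI ballI)
  fix \<psi> c :: "real \<Rightarrow> real" and G :: "'g measure" and l :: "'h \<Rightarrow> 'g \<Rightarrow> real"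
    and S :: "overlap measure \<Rightarrow> (overlap \<times> 'h measure) measure" and \<Lambda> :: real
  assume "\<psi> C1_differentiable_on UNIV \<and> bounded (range (deriv \<psi>)) \<and> \<psi> 0 = 0 \<and>
    continuous_on {-1..1} c \<and> c 1 = 1 \<and> pos_def_on_ball TYPE('h) c \<and>
    gaussian_field G c l \<and> (\<forall>P. rost_law P \<longrightarrow> sampling_measure P (S P)) \<and> \<Lambda> \<ge> 0"
  then show "continuous_map rost_topology euclideanreal (\<lambda>P. P_functional \<psi> c G l \<Lambda> (S P))"
    by (intro P_functional_continuous infinite_dim) auto
next
  fix \<delta> :: real and \<Lambda>' :: "nat \<Rightarrow> real"
  assume \<delta>: "0 < \<delta>" and \<Lambda>': "\<Lambda>' \<in> ell2"
  define s' where "s' = (\<Sum>p. (\<Lambda>' p)\<^sup>2)"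
  define E where "E = (\<delta> + 1 + s') + ((\<delta> * (\<delta> + 1 + s') + s') + s')"
  \<comment> \<open>Built from \<open>\<delta>\<close> and \<open>\<Lambda>'\<close> alone, before
    \<open>\<psi>\<close>, the fields and \<open>\<Lambda>\<close> are given.\<close>
  define K where "K = (\<delta> + 1 + s') +
    exp (2 * E) * (2 * exp 18 + 2 * exp (18 * (\<delta> * (\<delta> + 1 + s') + s')) + 2 * exp (18 * s'))"
  have "0 \<le> s'" using \<Lambda>' by (auto simp: s'_def ell2_def intro!: suminf_nonneg)
  then have "0 < K"
    unfolding K_def using \<delta> by (intro add_pos_pos add_pos_nonneg mult_pos_pos) auto
  moreover have "\<bar>P_functional_seq \<psi> G l \<Lambda> J - P_functional_seq \<psi> G l \<Lambda>' J\<bar> \<le> K * ell2_norm (\<lambda>p. \<Lambda> p - \<Lambda>' p)"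
    if "\<psi> = (\<lambda>x. ln (cosh x)) \<or> \<psi> = (\<lambda>x. x)" "independent_power_fields G l" "\<Lambda> \<in> ell2"
      "ell2_norm (\<lambda>p. \<Lambda> p - \<Lambda>' p) < \<delta>" "sampling_measure P J"
    for \<psi> and G :: "'k measure" and l :: "nat \<Rightarrow> 'h \<Rightarrow> 'k \<Rightarrow> real" and \<Lambda> P J
    unfolding K_def
    by (rule P_functional_seq_lipschitz[OF that(2,1,3) \<Lambda>' refl that(4,5) s'_def E_def])
  ultimately show "\<exists>K>0. \<forall>(\<psi> :: real \<Rightarrow> real) (G :: 'k measure) (l :: nat \<Rightarrow> 'h \<Rightarrow> 'k \<Rightarrow> real).
      (\<psi> = (\<lambda>x. ln (cosh x)) \<or> \<psi> = (\<lambda>x. x)) \<and> independent_power_fields G l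
      \<longrightarrow> (\<forall>\<Lambda>\<in>ell2. ell2_norm (\<lambda>p. \<Lambda> p - \<Lambda>' p) < \<delta> \<longrightarrow>
            (\<forall>P J. rost_law P \<and> sampling_measure P J \<longrightarrow>
               \<bar>P_functional_seq \<psi> G l \<Lambda> J - P_functional_seq \<psi> G l \<Lambda>' J\<bar>
                 \<le> K * ell2_norm (\<lambda>p. \<Lambda> p - \<Lambda>' p)))"
    by blast
qed

end
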